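(* Let $k\ge1$ and let $\lambda,\mu,\nu$ be partitions with at most $k$ parts. Then $\mathbf{c}_{\lambda\mu}^{\nu}$ equals the number of pairs $(\mu^+,T)$ where $\mu^+$ is a partition obtained from $\mu$ by adding some number (possibly zero) of its outer corners, and $T$ is a semistandard ballot set-valued tableau of shape $\mu^+\oplus\lambda$ and content $\nu$.
   Context: Partitions are weakly decreasing finite sequences of nonnegative integers, $|\lambda|=\sum\lambda_i$; the diagram of $\lambda$ has $\lambda_i$ left-justified boxes in row $i$, rows numbered top to bottom. An outer corner of $\mu$ is a box whose addition to the diagram of $\mu$ gives the diagram of a partition; adding several outer corners simultaneously is allowed. Shape $\mu\oplus\lambda$: the diagrams of $\mu$ and $\lambda$ placed corner to corner, with $\lambda$ to the upper right and $\mu$ to the lower left, i.e. the top-right corner of the diagram of $\mu$ touches the bottom-left corner of the diagram of $\lambda$ (the rows of $\lambda$ lie above the rows of $\mu$ and are shifted right by $\mu_1$ columns). A set-valued tableau (with values in $\{1,\dots,k\}$) fills each box with a nonempty subset of $\{1,\dots,k\}$. It is semistandard if for horizontally adjacent boxes $A$ (left), $B$ (right) we have $\max A\le\min B$, and for vertically adjacent boxes $A$ (above), $B$ (below) we have $\max A<\min B$. Its reverse row word is obtained by reading the boxes row by row from top to bottom, each row from right to left, writing the elements of each box from largest to smallest. The content of a word $w$ is $(m_1,\dots,m_k)$ with $m_i$ the number of occurrences of $i$; $w$ is ballot if the content of every initial segment is weakly decreasing. A tableau's content and ballotness are those of its reverse row word. Coefficients: for a partition $\lambda$, $G_\lambda=\sum_T(-1)^{|T|-|\lambda|}x^T$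 summed over semistandard set-valued tableaux $T$ of shape $\lambda$ with entries nonempty finite sets of positive integers, $|T|$ the total number of entries and $x^T=\prod_{\text{boxes}}\prod_{a\in\text{box}}x_a$ (stable Grothendieck polynomials). Let $\mathcal G_\lambda=G_\lambda\cdot(1-G_1)$ and define the integers $\mathbf c_{\lambda\mu}^{\nu}$ by $\mathcal G_\lambda\mathcal G_\mu=\sum_\nu(-1)^{|\nu|-|\lambda|-|\mu|}\mathbf c_{\lambda\mu}^{\nu}\mathcal G_\nu$. *)

theory Defs
  imports Main "HOL-Library.Multiset" "HOL-Library.FuncSet" "HOL-Library.Sublist"
begin

section \<open>Partitions and shapes\<close>

text \<open>A partition is stored as the sequence of its parts padded with zeros, so that two sequences
  differing only in trailing zeros are the same object. Rows, columns and parts are indexed from 0.\<close>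

definition partitions :: "(nat \<Rightarrow> nat) set" where
  "partitions = {la. antimono la \<and> finite {i. la i \<noteq> 0}}"

definition num_parts :: "(nat \<Rightarrow> nat) \<Rightarrow> nat" where
  "num_parts la = card {i. la i \<noteq> 0}"

definition psize :: "(nat \<Rightarrow> nat) \<Rightarrow> nat" where
  "psize la = (\<Sum>i | la i \<noteq> 0. la i)"

text \<open>Boxes are pairs (row, column); rows are numbered from top to bottom.\<close>

type_synonym box = "nat \<times> nat"

definition diagram :: "(nat \<Rightarrow> nat) \<Rightarrow> box set" where
  "diagram la = {(i, j). j < la i}"

definition outer_corners :: "(nat \<Rightarrow> nat) \<Rightarrow> box set" where
  "outer_corners mu =
     {b. b \<notin> diagram mu \<and> (\<exists>rho\<in>partitions. diagram rho = insert b (diagram mu))}"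

text \<open>The diagram of \<open>la\<close> occupies the top rows and is moved right by the length of the first row
  of \<open>mu\<close>; the diagram of \<open>mu\<close> is moved below the last nonempty row of \<open>la\<close>.\<close>

definition oplus_shape :: "(nat \<Rightarrow> nat) \<Rightarrow> (nat \<Rightarrow> nat) \<Rightarrow> box set" where
  "oplus_shape mu la =
     (\<lambda>(i, j). (i, j + mu 0)) ` diagram la \<union> (\<lambda>(i, j). (i + num_parts la, j)) ` diagram mu"


section \<open>Set-valued tableaux\<close>

text \<open>Tableaux are extensional functions, hence determined by their values on the shape.\<close>

definition set_valued_tableaux :: "box set \<Rightarrow> nat set \<Rightarrow> (box \<Rightarrow> nat set) set" where
  "set_valued_tableaux D A = D \<rightarrow>\<^sub>E {X. X \<noteq> {} \<and> finite X \<and> X \<subseteq> A}"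

definition semistandard :: "box set \<Rightarrow> (box \<Rightarrow> nat set) \<Rightarrow> bool" where
  "semistandard D T \<longleftrightarrow>
     (\<forall>i j. (i, j) \<in> D \<and> (i, Suc j) \<in> D \<longrightarrow> Max (T (i, j)) \<le> Min (T (i, Suc j))) \<and>
     (\<forall>i j. (i, j) \<in> D \<and> (Suc i, j) \<in> D \<longrightarrow> Max (T (i, j)) < Min (T (Suc i, j)))"

definition reverse_row_word :: "box set \<Rightarrow> (box \<Rightarrow> nat set) \<Rightarrow> nat list" where
  "reverse_row_word D T =
     concat (map (\<lambda>i. concat (map (\<lambda>j. rev (sorted_list_of_set (T (i, j))))
                                 (rev (sorted_list_of_set {j. (i, j) \<in> D}))))
                 (sorted_list_of_set (fst ` D)))"

text \<open>Letters are positive integers, while sequences are indexed from 0: entry \<open>i\<close> of the content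
  counts the letter \<open>i + 1\<close>.\<close>

definition content :: "nat list \<Rightarrow> nat \<Rightarrow> nat" where
  "content w = (\<lambda>i. count_list w (Suc i))"

definition ballot :: "nat list \<Rightarrow> bool" where
  "ballot w \<longleftrightarrow> (\<forall>u. prefix u w \<longrightarrow> antimono (content u))"


section \<open>Power series in infinitely many variables\<close>

text \<open>A monomial in the variables \<open>x\<^sub>a\<close> is the multiset of the indices \<open>a\<close> occurring in it, and a
  formal power series with integer coefficients is the function sending a monomial to its
  coefficient.\<close>

type_synonym series = "nat multiset \<Rightarrow> int"

definition series_one :: series where
  "series_one M = (if M = {#} then 1 else 0)"

definition series_minus :: "series \<Rightarrow> series \<Rightarrow> series" where
  "series_minus f g M = f M - g M"

definition series_times :: "series \<Rightarrow> series \<Rightarrow> series" where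
  "series_times f g M = (\<Sum>(A, B) | A + B = M. f A * g B)"

lemma finite_submultisets: "finite {A. A \<subseteq># (M :: 'a multiset)}"
proof (induction M)
  case (add x M)
  have "{A. A \<subseteq># add_mset x M} \<subseteq> {A. A \<subseteq># M} \<union> add_mset x ` {A. A \<subseteq># M}"
  proof clarify
    fix A
    assume A: "A \<subseteq># add_mset x M" "A \<notin> add_mset x ` {A. A \<subseteq># M}"
    have "x \<notin># A"
    proof
      assume "x \<in># A"
      then obtain B where "A = add_mset x B" by (metis multi_member_split)
      with A show False by auto
    qed
    with A(1) show "A \<subseteq># M"
      by (metis diff_single_trivial subset_eq_diff_conv add_mset_add_single)
  qed
  with add show ?case by (auto intro: finite_subset)
qed auto

lemma finite_splittings: "finite {(A, B). A + B = (M :: 'a multiset)}"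
proof (rule finite_subset)
  show "{(A, B). A + B = M} \<subseteq> {A. A \<subseteq># M} \<times> {A. A \<subseteq># M}"
    by auto
qed (intro finite_cartesian_product finite_submultisets)


section \<open>Stable Grothendieck polynomials and their structure constants\<close>

definition tableau_monomial :: "box set \<Rightarrow> (box \<Rightarrow> nat set) \<Rightarrow> nat multiset" where
  "tableau_monomial D T = (\<Sum>b\<in>D. mset_set (T b))"

definition tableau_size :: "box set \<Rightarrow> (box \<Rightarrow> nat set) \<Rightarrow> nat" where
  "tableau_size D T = (\<Sum>b\<in>D. card (T b))"

definition groth_tableaux :: "(nat \<Rightarrow> nat) \<Rightarrow> nat multiset \<Rightarrow> (box \<Rightarrow> nat set) set" where
  "groth_tableaux la M =
     {T \<in> set_valued_tableaux (diagram la) {1..}.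
        semistandard (diagram la) T \<and> tableau_monomial (diagram la) T = M}"

text \<open>The coefficient at \<open>M\<close> of the defining sum over all tableaux collects the finitely many
  tableaux whose monomial is \<open>M\<close>. The exponent is never truncated since boxes are nonempty.\<close>

definition groth :: "(nat \<Rightarrow> nat) \<Rightarrow> series" where
  "groth la M = (\<Sum>T\<in>groth_tableaux la M. (-1) ^ (tableau_size (diagram la) T - psize la))"

definition one_box :: "nat \<Rightarrow> nat" where
  "one_box = (\<lambda>_. 0)(0 := 1)"

definition cal_groth :: "(nat \<Rightarrow> nat) \<Rightarrow> series" where
  "cal_groth la = series_times (groth la) (series_minus series_one (groth one_box))"

text \<open>The expansion is taken coefficientwise: for every monomial only finitely many
  \<open>cal_groth nu\<close> have a nonzero coefficient (lemma \<open>finite_cal_groth_support\<close> below). The sign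
  exponent \<open>|nu| - |la| - |mu|\<close>, which may be negative, is replaced by one of the same parity.\<close>

definition is_expansion ::
  "(nat \<Rightarrow> nat) \<Rightarrow> (nat \<Rightarrow> nat) \<Rightarrow> ((nat \<Rightarrow> nat) \<Rightarrow> int) \<Rightarrow> bool" where
  "is_expansion la mu c \<longleftrightarrow>
     (\<forall>nu. nu \<notin> partitions \<longrightarrow> c nu = 0) \<and>
     (\<forall>M. series_times (cal_groth la) (cal_groth mu) M =
        (\<Sum>nu \<in> {nu \<in> partitions. cal_groth nu M \<noteq> 0}.
           (-1) ^ (psize nu + psize la + psize mu) * c nu * cal_groth nu M))"

definition structure_constant :: "(nat \<Rightarrow> nat) \<Rightarrow> (nat \<Rightarrow> nat) \<Rightarrow> (nat \<Rightarrow> nat) \<Rightarrow> int" where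
  "structure_constant la mu = (THE c. is_expansion la mu c)"

lemma finite_partitions_psize_le: "finite {nu \<in> partitions. psize nu \<le> n}"
proof (rule finite_subset)
  show "{nu \<in> partitions. psize nu \<le> n} \<subseteq>
    {f. \<forall>i. (i \<in> {..<n} \<longrightarrow> f i \<in> {..n}) \<and> (i \<notin> {..<n} \<longrightarrow> f i = 0)}"
  proof clarify
    fix nu i
    assume nu: "nu \<in> partitions" and le: "psize nu \<le> n"
    have fin: "finite {i. nu i \<noteq> 0}" and anti: "antimono nu"
      using nu by (auto simp: partitions_def)
    have 1: "nu i \<le> n"
    proof (cases "nu i = 0")
      case False
      then have "nu i \<le> psize nu"
        unfolding psize_def by (intro member_le_sum) (use fin in auto)
      with le show ?thesis by simp
    qed simp
    have 2: "nu i = 0" if "\<not> i < n"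
    proof (rule ccontr)
      assume ne: "nu i \<noteq> 0"
      have "{..i} \<subseteq> {i. nu i \<noteq> 0}"
      proof
        fix j assume "j \<in> {..i}"
        then have "nu i \<le> nu j" using anti by (simp add: antimonoD)
        with ne show "j \<in> {i. nu i \<noteq> 0}" by simp
      qed
      then have "card {..i} \<le> card {i. nu i \<noteq> 0}"
        by (rule card_mono[OF fin])
      also have "\<dots> \<le> psize nu"
        unfolding psize_def card_eq_sum by (rule sum_mono) auto
      finally show False using le that by simp
    qed
    from 1 2 show "(i \<in> {..<n} \<longrightarrow> nu i \<in> {..n}) \<and> (i \<notin> {..<n} \<longrightarrow> nu i = 0)"
      by auto
  qed
  show "finite {f. \<forall>i. (i \<in> {..<n} \<longrightarrow> f i \<in> {..n}) \<and> (i \<notin> {..<n} \<longrightarrow> f i = (0::nat))}"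
    by (rule finite_set_of_finite_funs) auto
qed

lemma diagram_Sigma: "diagram la = Sigma {i. la i \<noteq> 0} (\<lambda>i. {..<la i})"
  by (auto simp: diagram_def)

lemma finite_groth_tableaux:
  assumes "la \<in> partitions"
  shows "finite (groth_tableaux la M)"
proof (rule finite_subset)
  have fin: "finite (diagram la)"
    using assms by (auto simp: diagram_Sigma partitions_def)
  show "groth_tableaux la M \<subseteq> diagram la \<rightarrow>\<^sub>E Pow (set_mset M)"
  proof
    fix T assume T: "T \<in> groth_tableaux la M"
    then have PiE: "T \<in> diagram la \<rightarrow>\<^sub>E {X. X \<noteq> {} \<and> finite X \<and> X \<subseteq> {1..}}"
      and M: "M = (\<Sum>b\<in>diagram la. mset_set (T b))"
      by (auto simp: groth_tableaux_def tableau_monomial_def set_valued_tableaux_def)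
    have "set_mset M = (\<Union>b\<in>diagram la. T b)"
      unfolding M set_mset_sum[OF fin] using PiE by (auto simp: PiE_iff)
    with PiE show "T \<in> diagram la \<rightarrow>\<^sub>E Pow (set_mset M)"
      by (auto simp: PiE_iff)
  qed
  show "finite (diagram la \<rightarrow>\<^sub>E Pow (set_mset M))"
    using fin by (intro finite_PiE) auto
qed

lemma groth_nonzero_imp_psize_le:
  assumes la: "la \<in> partitions" and "groth la M \<noteq> 0"
  shows "psize la \<le> size M"
proof -
  have fin: "finite {i. la i \<noteq> 0}"
    using la by (simp add: partitions_def)
  obtain T where "T \<in> groth_tableaux la M"
    using assms(2) by (force simp: groth_def)
  then have T: "T \<in> set_valued_tableaux (diagram la) {1..}"
    and M: "M = (\<Sum>b\<in>diagram la. mset_set (T b))"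
    by (auto simp: groth_tableaux_def tableau_monomial_def)
  have "psize la = card (diagram la)"
    using fin by (simp add: diagram_Sigma psize_def)
  also have "\<dots> = (\<Sum>b\<in>diagram la. 1)"
    by simp
  also have "\<dots> \<le> (\<Sum>b\<in>diagram la. size (mset_set (T b)))"
  proof (rule sum_mono)
    fix b assume "b \<in> diagram la"
    then have "T b \<noteq> {}" "finite (T b)"
      using T by (auto simp: set_valued_tableaux_def PiE_iff)
    then show "1 \<le> size (mset_set (T b))"
      by (simp add: Suc_le_eq card_gt_0_iff)
  qed
  also have "\<dots> = size M"
    unfolding M by (simp add: size_multiset_sum)
  finally show ?thesis .
qed

lemma finite_cal_groth_support: "finite {nu \<in> partitions. cal_groth nu M \<noteq> 0}"
proof (rule finite_subset)
  show "{nu \<in> partitions. cal_groth nu M \<noteq> 0} \<subseteq> {nu \<in> partitions. psize nu \<le> size M}"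
  proof clarify
    fix nu assume nu: "nu \<in> partitions" "cal_groth nu M \<noteq> 0"
    then obtain A B where "A + B = M" "groth nu A \<noteq> 0"
      unfolding cal_groth_def series_times_def
      by (force elim!: sum.not_neutral_contains_not_neutral)
    with groth_nonzero_imp_psize_le[OF nu(1), of A] show "psize nu \<le> size M"
      by auto
  qed
qed (rule finite_partitions_psize_le)

end

theory Submission
  imports Defs "HOL-Combinatorics.Permutations" "HOL-Computational_Algebra.Polynomial"
begin

text \<open>In \<open>n\<close> variables let \<open>A\<^sub>\<alpha>\<close> be the antisymmetrization of
  \<open>\<Prod>\<^sub>j x\<^sub>j ^ (\<alpha>\<^sub>j + n - 1 - j) * (1 - x\<^sub>j) ^ j\<close>, with indices from 0. Since \<open>G\<^sub>\<mu>\<close> is symmetric,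
  \<open>A\<^sub>\<lambda> * G\<^sub>\<mu>\<close> is the signed sum of \<open>A\<close> at \<open>\<lambda> + content T\<close> over all tableaux \<open>T\<close> of
  shape \<open>\<mu>\<close>. The tableaux that are not ballot from \<open>\<lambda>\<close> cancel: take the first row \<open>r\<close> with a
  violation, the largest violated pair of letters in it, and vary the two letters in the rows from
  \<open>r\<close> on. The sum over these variations, times the base monomial, factors over the rows into a
  function symmetric in the two variables, and so is antisymmetrized to zero. For \<open>\<lambda> = 0\<close>
  only the superstandard tableau is ballot, which gives \<open>A\<^sub>0 * G\<^sub>\<mu> = A\<^sub>\<mu>\<close>. Cancelling
  \<open>A\<^sub>0\<close> expands \<open>G\<^sub>\<lambda> * G\<^sub>\<mu>\<close>, and the case of a single box expands
  \<open>G\<^sub>\<mu> * (1 - G\<^sub>1)\<close> over the shapes obtained by adding outer corners.\<close>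

hide_const (open) Polynomial.content
hide_fact (open) Polynomial.content_def

section \<open>Two-variable sums over one row\<close>

text \<open>The powers of \<open>1 - x j\<close> in the base belong to the bialternant formula
  \<open>A\<^sub>\<mu> / A\<^sub>0\<close> for stable Grothendieck polynomials, which is not
  presupposed but drops out of the cancellation. Neighbouring indices differ by one factor
  \<open>1 - x j\<close>, and it is this factor that restores the symmetry of the violating row when
  boxes hold several letters. The obstacle to factoring over the rows is that an extra letter of one
  row is limited by the shape of the next; it is therefore stored with the row that limits it. In
  the product for \<lambda> and \<mu> one factor 1 - G_1 acts on \<mu> and creates the added
  corners, the other remains and turns each G_\<nu> into its normalized form. Ballotness forces the
  part on \<lambda> to be superstandard, so only a tableau ballot from \<lambda> is left below it.
  Cancelling \<open>A\<^sub>0\<close> needs a domain where it does not vanish: the points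
  \<open>X ^ (B ^ a)\<close> in integer polynomials give one and still tell monomials apart. The
  constants are a definite description, so uniqueness is also due; it is read off the lowest degree,
  by dominance order, as for Schur functions.\<close>

definition symm2 :: "('a \<Rightarrow> 'a \<Rightarrow> 'b) \<Rightarrow> bool" where
  "symm2 f \<longleftrightarrow> (\<forall>x y. f x y = f y x)"

text \<open>The complete homogeneous polynomial of degree \<open>m - 1\<close> in two variables,
  indexed by its number of terms so that an empty range gives 0.\<close>

definition hsum :: "nat \<Rightarrow> 'a::comm_ring_1 \<Rightarrow> 'a \<Rightarrow> 'a" where
  "hsum m x y = (\<Sum>a<m. x ^ a * y ^ (m - Suc a))"

lemma hsum_0 [simp]: "hsum 0 x y = 0"
  by (simp add: hsum_def)

lemma hsum_Suc: "hsum (Suc m) x y = y * hsum m x y + x ^ m"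
proof -
  have "(\<Sum>a<m. x ^ a * y ^ (m - a)) = (\<Sum>a<m. y * (x ^ a * y ^ (m - Suc a)))"
  proof (rule sum.cong)
    fix a assume "a \<in> {..<m}"
    then have "m - a = Suc (m - Suc a)" by auto
    then show "x ^ a * y ^ (m - a) = y * (x ^ a * y ^ (m - Suc a))"
      by (simp only: power_Suc ac_simps)
  qed simp
  then show ?thesis
    by (simp add: hsum_def sum_distrib_left)
qed

lemma hsum_Suc': "hsum (Suc m) x y = x * hsum m x y + y ^ m"
  by (simp add: hsum_def sum_distrib_left sum.lessThan_Suc_shift mult.assoc del: sum.lessThan_Suc)

text \<open>Peeling off the last or the first term gives two recursions that are mirror images of
  each other.\<close>

lemma hsum_commute: "hsum m x y = hsum m y x"
proof (induction m)
  case (Suc m)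
  then show ?case by (simp only: hsum_Suc[of m x y] hsum_Suc'[of m y x])
qed simp

lemma symm2_hsum: "symm2 (hsum m)"
  by (auto simp: symm2_def hsum_commute)

text \<open>Pulling out the least power of each variable turns an interval of values of
  \<open>p\<close> into a monomial times a symmetric polynomial. The two bounds keep the truncated
  differences exact.\<close>

lemma sum_power_interval:
  fixes x y :: "'a::comm_ring_1"
  assumes "k \<le> L" "U \<le> Suc t"
  shows "(\<Sum>p\<in>{L..<U}. x ^ (p - k) * y ^ (t - p)) = x ^ (L - k) * y ^ (Suc t - U) * hsum (U - L) x y"
proof -
  have "(\<Sum>p\<in>{L..<U}. x ^ (p - k) * y ^ (t - p)) =
      (\<Sum>a<U - L. x ^ (L + a - k) * y ^ (t - (L + a)))"
    by (rule sum.reindex_bij_witness[of _ "\<lambda>a. L + a" "\<lambda>p. p - L"]) auto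
  also have "\<dots> = (\<Sum>a<U - L. x ^ (L - k) * y ^ (Suc t - U) * (x ^ a * y ^ (U - L - Suc a)))"
  proof (rule sum.cong)
    fix a assume "a \<in> {..<U - L}"
    then have e: "L + a - k = (L - k) + a" "t - (L + a) = (Suc t - U) + (U - L - Suc a)"
      using assms by auto
    show "x ^ (L + a - k) * y ^ (t - (L + a)) = x ^ (L - k) * y ^ (Suc t - U) * (x ^ a * y ^ (U - L - Suc a))"
      unfolding e power_add by (simp add: algebra_simps)
  qed simp
  finally show ?thesis by (simp add: hsum_def sum_distrib_left)
qed

text \<open>What is left of \<open>loc_sum\<close> when its common factors are removed. A set flag
  marks an end of the interval at which the extra letter is forbidden; with the flag unset its
  factor is constant and has been pulled out.\<close>

definition wsum :: "bool \<Rightarrow> bool \<Rightarrow> nat \<Rightarrow> 'a::comm_ring_1 \<Rightarrow> 'a \<Rightarrow> 'a" where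
  "wsum b c m x y = (\<Sum>a\<le>m. x ^ a * y ^ (m - a) *
     (if b \<and> 0 < a then 1 - y else 1) * (if c \<and> a < m then 1 - x else 1))"

lemma wsum_flip: "wsum b c m x y = wsum c b m y x"
  unfolding wsum_def
  by (rule sum.reindex_bij_witness[of _ "\<lambda>a. m - a" "\<lambda>a. m - a"]) (auto simp: algebra_simps)

lemma wsum_TF: "wsum True False m x y = hsum (Suc m) x y - x * y * hsum m x y"
proof -
  have "wsum True False m x y = y ^ m + (\<Sum>a<m. x ^ Suc a * y ^ (m - Suc a) * (1 - y))"
    by (simp add: wsum_def sum.atMost_shift)
  also have "\<dots> = y ^ m + x * (1 - y) * hsum m x y"
    by (simp add: hsum_def sum_distrib_left algebra_simps)
  finally show ?thesis by (simp add: hsum_Suc' algebra_simps)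
qed

text \<open>Reversing the sum exchanges the flags, which settles equal flags. For unequal flags the
  symmetry is visible in the closed form with \<open>hsum\<close>.\<close>

lemma symm2_wsum: "symm2 (wsum b c m)"
proof (cases "b = c")
  case True
  then show ?thesis by (auto simp: symm2_def wsum_flip)
next
  case False
  have "symm2 (wsum True False m)" "symm2 (wsum False True m)"
    by (auto simp: symm2_def wsum_flip[of False True] wsum_TF hsum_commute mult.commute)
  with False show ?thesis by (cases b) auto
qed

abbreviation carry :: "nat \<Rightarrow> nat \<Rightarrow> 'a \<Rightarrow> 'a \<Rightarrow> 'a::comm_ring_1" where
  "carry k t' x y \<equiv> x ^ (t' - k) * (if t' < k then 1 - y else 1)"

text \<open>Row \<open>s\<close> of a fibre: \<open>p\<close> is \<open>P (Suc i) s\<close>,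
  \<open>k'\<close> and \<open>k\<close> are rows \<open>s - 1\<close> and \<open>s\<close> of
  \<open>P i\<close>, while \<open>t\<close> and \<open>t'\<close> are rows \<open>s\<close> and
  \<open>s + 1\<close> of \<open>P (i + 2)\<close>. The two conditionals have summed out the extra
  second letter of row \<open>s\<close> and the extra first letter of row
  \<open>s - 1\<close>.\<close>

definition loc_sum :: "nat \<Rightarrow> nat \<Rightarrow> nat \<Rightarrow> nat \<Rightarrow> 'a::comm_ring_1 \<Rightarrow> 'a \<Rightarrow> 'a" where
  "loc_sum k' k t t' x y = (\<Sum>p\<in>{max k t'..min t k'}. x ^ (p - k) * y ^ (t - p) *
     (if t' < p then 1 - y else 1) * (if p < k' then 1 - x else 1))"

lemma loc_sum_eq:
  fixes x y :: "'a::comm_ring_1"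
  assumes "k \<le> t" "t' \<le> t" "k \<le> k'" "t' \<le> k'"
  shows "loc_sum k' k t t' x y = x ^ (t' - k) * y ^ (t - k') *
     (if t' < k then 1 - y else 1) * (if t < k' then 1 - x else 1) *
     wsum (\<not> t' < k) (\<not> t < k') (min t k' - max k t') x y"
proof -
  define L U where "L = max k t'" and "U = min t k'"
  have LU: "L \<le> U" using assms by (auto simp: L_def U_def)
  have "loc_sum k' k t t' x y = (\<Sum>a\<le>U - L. x ^ (L + a - k) * y ^ (t - (L + a)) *
     (if t' < L + a then 1 - y else 1) * (if L + a < k' then 1 - x else 1))"
    unfolding loc_sum_def L_def[symmetric] U_def[symmetric]
    by (rule sum.reindex_bij_witness[of _ "\<lambda>a. L + a" "\<lambda>p. p - L"]) (use LU in auto)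
  also have "\<dots> = (\<Sum>a\<le>U - L. x ^ (t' - k) * y ^ (t - k') *
     (if t' < k then 1 - y else 1) * (if t < k' then 1 - x else 1) *
     (x ^ a * y ^ (U - L - a) * (if \<not> t' < k \<and> 0 < a then 1 - y else 1) *
       (if \<not> t < k' \<and> a < U - L then 1 - x else 1)))"
  proof (rule sum.cong)
    fix a assume "a \<in> {..U - L}"
    then have a: "a \<le> U - L" by simp
    have e: "L + a - k = (t' - k) + a" "t - (L + a) = (t - k') + (U - L - a)"
      using assms a by (auto simp: L_def U_def min_def max_def)
    have f: "(if t' < L + a then 1 - y else 1) = (if t' < k then 1 - y else 1) * (if \<not> t' < k \<and> 0 < a then 1 - y else 1)"
      by (auto simp: L_def)
    have "L + a < k' \<longleftrightarrow> t < k' \<or> a < U - L"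
      using assms a LU by (auto simp: U_def L_def min_def max_def)
    then have g: "(if L + a < k' then 1 - x else 1) = (if t < k' then 1 - x else 1) * (if \<not> t < k' \<and> a < U - L then 1 - x else 1)"
      by auto
    show "x ^ (L + a - k) * y ^ (t - (L + a)) *
     (if t' < L + a then 1 - y else 1) * (if L + a < k' then 1 - x else 1) = x ^ (t' - k) * y ^ (t - k') *
     (if t' < k then 1 - y else 1) * (if t < k' then 1 - x else 1) *
     (x ^ a * y ^ (U - L - a) * (if \<not> t' < k \<and> 0 < a then 1 - y else 1) *
       (if \<not> t < k' \<and> a < U - L then 1 - x else 1))"
      unfolding e f g power_add by (simp only: ac_simps)
  qed simp
  finally show ?thesis
    by (simp only: wsum_def L_def U_def sum_distrib_left)
qed

text \<open>The row where the variation starts. Its admissible pairs are a parameter because the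
  ballot condition cuts them down; the extra first letter of this row is counted with the next
  row.\<close>

definition row_sum :: "(nat \<times> bool) set \<Rightarrow> nat \<Rightarrow> nat \<Rightarrow> 'a::comm_ring_1 \<Rightarrow> 'a \<Rightarrow> 'a" where
  "row_sum K k t x y = (\<Sum>(p, e)\<in>K. x ^ (p - k) * y ^ (t - p) * (if e then - y else 1))"

lemma row_sum_split:
  fixes x y :: "'a::comm_ring_1"
  assumes "finite A" "finite B"
  shows "row_sum (A \<times> {False} \<union> B \<times> {True}) k t x y =
    (\<Sum>p\<in>A. x ^ (p - k) * y ^ (t - p)) - y * (\<Sum>p\<in>B. x ^ (p - k) * y ^ (t - p))"
proof -
  have "row_sum (A \<times> {False} \<union> B \<times> {True}) k t x y =
     row_sum (A \<times> {False}) k t x y + row_sum (B \<times> {True}) k t x y"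
    unfolding row_sum_def using assms by (intro sum.union_disjoint) auto
  also have "row_sum (A \<times> {False}) k t x y = (\<Sum>p\<in>A. x ^ (p - k) * y ^ (t - p))"
    by (simp add: row_sum_def sum.cartesian_product[symmetric])
  also have "row_sum (B \<times> {True}) k t x y = - (y * (\<Sum>p\<in>B. x ^ (p - k) * y ^ (t - p)))"
    by (simp add: row_sum_def sum.cartesian_product[symmetric] sum_distrib_left sum_negf ac_simps)
  finally show ?thesis by simp
qed

text \<open>Omitting or allowing the extra letter gives two sums over intervals. If
  \<open>t' < k\<close> the intervals agree and leave the factor \<open>1 - y\<close> of
  \<open>carry\<close>; otherwise the sums combine to
  \<open>hsum (Suc d) x y - x * y * hsum d x y\<close>.\<close>

lemma row_sum_free:
  assumes "k \<le> t" "t' \<le> t"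
  shows "\<exists>S. symm2 S \<and> (\<forall>x y :: 'a::comm_ring_1.
    row_sum {(p, e). k \<le> p \<and> t' \<le> p \<and> p \<le> t \<and> (e \<longrightarrow> t' < p)} k t x y =
      carry k t' x y * S x y)"
proof -
  let ?A = "{max k t'..<Suc t}" and ?B = "{max k (Suc t')..<Suc t}"
  have K: "{(p, e). k \<le> p \<and> t' \<le> p \<and> p \<le> t \<and> (e \<longrightarrow> t' < p)} = ?A \<times> {False} \<union> ?B \<times> {True}"
    by auto
  show ?thesis
  proof (cases "t' < k")
    case True
    then have m: "max k t' = k" "max k (Suc t') = k" by auto
    show ?thesis
      unfolding K m using assms True
      by (intro exI[of _ "hsum (Suc t - k)"])
        (auto simp: row_sum_split sum_power_interval symm2_hsum algebra_simps
          simp del: sum.op_ivl_Suc)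
  next
    case False
    define d where "d = t - t'"
    have d: "Suc t - t' = Suc d" "Suc t - Suc t' = d" "Suc t' - k = Suc (t' - k)"
      using assms False by (auto simp: d_def)
    have "symm2 (\<lambda>x y :: 'a. hsum (Suc d) x y - x * y * hsum d x y)"
      by (auto simp: symm2_def hsum_commute mult.commute)
    then show ?thesis
      unfolding K using assms False
      by (intro exI[of _ "\<lambda>x y. hsum (Suc d) x y - x * y * hsum d x y"])
        (auto simp: row_sum_split sum_power_interval max_def algebra_simps d
          simp del: sum.op_ivl_Suc diff_Suc_Suc)
  qed
qed

text \<open>A violation needs \<open>l\<close> second letters, and \<open>x ^ l * (1 - y)\<close> is
  the imbalance of the base monomial. The row sum answers with \<open>y ^ l\<close>; the factor
  \<open>1 - y\<close> is taken by \<open>carry\<close> if \<open>t' < k\<close>, and otherwise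
  meets a factor \<open>1 - x\<close> produced by the extra letters.\<close>

lemma row_sum_bad:
  assumes "k \<le> t" "t' \<le> t" "1 \<le> l"
  shows "\<exists>S. symm2 S \<and> (\<forall>x y :: 'a::comm_ring_1.
    x ^ l * (1 - y) * row_sum {(p, e). k \<le> p \<and> t' \<le> p \<and> p \<le> t \<and> (e \<longrightarrow> t' < p) \<and>
        l \<le> t - p + of_bool e} k t x y =
      carry k t' x y * S x y)"
proof (cases "l \<le> Suc t")
  case False
  \<comment> \<open>The row contains the letter at most \<open>t + 1\<close> times.\<close>
  then have K: "{(p, e). k \<le> p \<and> t' \<le> p \<and> p \<le> t \<and> (e \<longrightarrow> t' < p) \<and> l \<le> t - p + of_bool e} = {}"
    by auto
  show ?thesis unfolding K
    by (intro exI[of _ "\<lambda>_ _. 0"]) (auto simp: symm2_def row_sum_def)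
next
  case True
  \<comment> \<open>An extra letter supplies one of the \<open>l\<close> letters, so the second
    interval reaches one further.\<close>
  let ?A = "{max k t'..<Suc t - l}" and ?B = "{max k (Suc t')..<Suc (Suc t) - l}"
  have K: "{(p, e). k \<le> p \<and> t' \<le> p \<and> p \<le> t \<and> (e \<longrightarrow> t' < p) \<and> l \<le> t - p + of_bool e} = ?A \<times> {False} \<union> ?B \<times> {True}"
    using assms by (auto split: if_splits)
  have l: "Suc t - (Suc t - l) = l" "y * y ^ (Suc t - (Suc (Suc t) - l)) = y ^ l"
    "Suc (Suc t) - l \<le> Suc t" for y :: 'a
    using True assms(3) by (auto simp flip: power_Suc intro!: arg_cong[of _ _ "power y"])
  show ?thesis
  proof (cases "t' < k")
    case gap: True
    then have m: "max k t' = k" "max k (Suc t') = k" by auto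
    define a b where "a = Suc t - l - k" and "b = Suc (Suc t) - l - k"
    have "symm2 (\<lambda>x y :: 'a. (x * y) ^ l * (hsum a x y - hsum b x y))"
      by (auto simp: symm2_def hsum_commute mult.commute)
    moreover have "row_sum (?A \<times> {False} \<union> ?B \<times> {True}) k t x y = y ^ l * (hsum a x y - hsum b x y)" for x y :: 'a
    proof -
      have "(\<Sum>p\<in>?A. x ^ (p - k) * y ^ (t - p)) = y ^ l * hsum a x y"
        unfolding m using l(1) by (subst sum_power_interval) (auto simp: a_def)
      moreover have "y * (\<Sum>p\<in>?B. x ^ (p - k) * y ^ (t - p)) = y ^ l * hsum b x y"
        unfolding m using l(3) by (subst sum_power_interval) (auto simp: b_def simp flip: l(2))
      ultimately show ?thesis
        by (subst row_sum_split) (simp_all add: algebra_simps)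
    qed
    ultimately show ?thesis
      unfolding K using gap
      by (intro exI[of _ "\<lambda>x y. (x * y) ^ l * (hsum a x y - hsum b x y)"])
        (auto simp: power_mult_distrib ac_simps)
  next
    case gap: False
    define a where "a = Suc t - l - t'"
    have a: "Suc (Suc t) - l - Suc t' = a" "Suc t' - k = Suc (t' - k)"
      using assms True gap by (auto simp: a_def)
    have "symm2 (\<lambda>x y :: 'a. (x * y) ^ l * (1 - x) * (1 - y) * hsum a x y)"
      by (auto simp: symm2_def hsum_commute mult.commute mult.left_commute)
    moreover have "row_sum (?A \<times> {False} \<union> ?B \<times> {True}) k t x y = x ^ (t' - k) * y ^ l * (1 - x) * hsum a x y" for x y :: 'a
    proof -
      have "(\<Sum>p\<in>?A. x ^ (p - k) * y ^ (t - p)) = x ^ (t' - k) * y ^ l * hsum a x y"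
        using gap l(1) by (subst sum_power_interval) (auto simp: a_def max_def)
      moreover have "y * (\<Sum>p\<in>?B. x ^ (p - k) * y ^ (t - p)) = x * x ^ (t' - k) * y ^ l * hsum a x y"
        using gap l(3) by (subst sum_power_interval) (auto simp: a_def a(2) max_def ac_simps simp flip: l(2))
      ultimately show ?thesis
        by (subst row_sum_split) (simp_all add: algebra_simps)
    qed
    ultimately show ?thesis
      unfolding K using gap
      by (intro exI[of _ "\<lambda>x y. (x * y) ^ l * (1 - x) * (1 - y) * hsum a x y"])
        (auto simp: power_mult_distrib ac_simps)
  qed
qed

text \<open>The factor \<open>x ^ (t (Suc r) - k r)\<close> and, if \<open>t (Suc r) < k r\<close>, the factor \<open>1 - y\<close> are handed
  from row to row; each is matched with its mirror image from the next row.\<close>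

lemma loc_sum_prod:
  assumes "antimono k" "antimono t" "\<And>s. k s \<le> t s" "\<And>s. t (Suc (Suc s)) \<le> k s" "r \<le> n"
  shows "\<exists>S. symm2 S \<and> (\<forall>x y :: 'a::comm_ring_1.
    carry (k r) (t (Suc r)) x y *
      (\<Prod>s\<in>{r<..n}. loc_sum (k (s - 1)) (k s) (t s) (t (Suc s)) x y) =
    carry (k n) (t (Suc n)) x y * S x y)"
  using \<open>r \<le> n\<close>
proof (induction n rule: dec_induct)
  case base
  show ?case by (intro exI[of _ "\<lambda>_ _. 1"]) (simp add: symm2_def)
next
  case (step n)
  then obtain S where S: "symm2 S" and eq: "\<And>x y :: 'a::comm_ring_1.
    carry (k r) (t (Suc r)) x y *
      (\<Prod>s\<in>{r<..n}. loc_sum (k (s - 1)) (k s) (t s) (t (Suc s)) x y) =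
    carry (k n) (t (Suc n)) x y * S x y"
    by blast
  define W :: "'a \<Rightarrow> 'a \<Rightarrow> 'a" where "W = wsum (\<not> t (Suc (Suc n)) < k (Suc n)) (\<not> t (Suc n) < k n)
    (min (t (Suc n)) (k n) - max (k (Suc n)) (t (Suc (Suc n))))"
  have W: "symm2 W" unfolding W_def by (rule symm2_wsum)
  have loc: "loc_sum (k n) (k (Suc n)) (t (Suc n)) (t (Suc (Suc n))) x y =
     x ^ (t (Suc (Suc n)) - k (Suc n)) * y ^ (t (Suc n) - k n) *
     (if t (Suc (Suc n)) < k (Suc n) then 1 - y else 1) * (if t (Suc n) < k n then 1 - x else 1) *
     W x y" for x y :: 'a
    unfolding W_def by (rule loc_sum_eq) (use assms in \<open>auto intro: antimonoD\<close>)
  define S' where "S' x y = (x * y) ^ (t (Suc n) - k n) *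
    (if t (Suc n) < k n then (1 - x) * (1 - y) else 1) * S x y * W x y" for x y :: 'a
  have "symm2 S'"
    using S W by (simp add: symm2_def S'_def ac_simps)
  moreover have "carry (k r) (t (Suc r)) x y *
      (\<Prod>s\<in>{r<..Suc n}. loc_sum (k (s - 1)) (k s) (t s) (t (Suc s)) x y) =
    carry (k (Suc n)) (t (Suc (Suc n))) x y * S' x y"
    for x y :: 'a
  proof -
    have "{r<..Suc n} = insert (Suc n) {r<..n}" using step by auto
    then have "(\<Prod>s\<in>{r<..Suc n}. loc_sum (k (s - 1)) (k s) (t s) (t (Suc s)) x y) =
      (\<Prod>s\<in>{r<..n}. loc_sum (k (s - 1)) (k s) (t s) (t (Suc s)) x y) *
      loc_sum (k n) (k (Suc n)) (t (Suc n)) (t (Suc (Suc n))) x y"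
      by (simp add: mult.commute)
    then have "carry (k r) (t (Suc r)) x y *
      (\<Prod>s\<in>{r<..Suc n}. loc_sum (k (s - 1)) (k s) (t s) (t (Suc s)) x y) =
      carry (k n) (t (Suc n)) x y * S x y *
      loc_sum (k n) (k (Suc n)) (t (Suc n)) (t (Suc (Suc n))) x y"
      by (simp only: mult.assoc[symmetric] eq)
    then show ?thesis
      unfolding loc S'_def by (simp add: power_mult_distrib ac_simps)
  qed
  ultimately show ?case by blast
qed

section \<open>Set-valued Gelfand--Tsetlin patterns\<close>

type_synonym pattern = "(nat \<Rightarrow> nat \<Rightarrow> nat) \<times> (nat \<Rightarrow> nat \<Rightarrow> bool)"

text \<open>A tableau becomes a pair \<open>(P, E)\<close>: the boxes with minimum at most \<open>a\<close> form the shape \<open>P a\<close>,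
  and \<open>E a r\<close> says that the letter \<open>a + 1\<close> also occurs in row \<open>r\<close> in a box with a smaller
  minimum, necessarily the last box of row \<open>r\<close> of \<open>P a\<close>.\<close>

definition patterns :: "nat \<Rightarrow> (nat \<Rightarrow> nat) \<Rightarrow> pattern set" where
  "patterns n mu = {(P, E). P 0 = (\<lambda>_. 0) \<and> (\<forall>a\<ge>n. P a = mu) \<and>
     (\<forall>a r. P (Suc a) (Suc r) \<le> P a r \<and> P a r \<le> P (Suc a) r) \<and>
     (\<forall>a r. E a r \<longrightarrow> a < n \<and> P (Suc a) (Suc r) < P a r)}"

text \<open>Occurrences of the letter \<open>a + 1\<close> in row \<open>r\<close>: the boxes where
  it is the minimum, plus the possible extra one.\<close>

definition pcount :: "pattern \<Rightarrow> nat \<Rightarrow> nat \<Rightarrow> nat" where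
  "pcount Z a r = fst Z (Suc a) r - fst Z a r + of_bool (snd Z a r)"

definition pcontent :: "nat \<Rightarrow> pattern \<Rightarrow> nat \<Rightarrow> nat" where
  "pcontent n Z a = (\<Sum>r<n. pcount Z a r)"

definition psign :: "nat \<Rightarrow> pattern \<Rightarrow> 'a::comm_ring_1" where
  "psign n Z = (\<Prod>a<n. \<Prod>r<n. if snd Z a r then - 1 else 1)"

definition pweight :: "nat \<Rightarrow> pattern \<Rightarrow> (nat \<Rightarrow> 'a) \<Rightarrow> 'a::comm_ring_1" where
  "pweight n Z x = psign n Z * (\<Prod>a<n. x a ^ pcontent n Z a)"

lemma patternsD:
  assumes "(P, E) \<in> patterns n mu"
  shows "P 0 r = 0" "a \<ge> n \<Longrightarrow> P a = mu" "P (Suc a) (Suc r) \<le> P a r" "P a r \<le> P (Suc a) r"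
    "E a r \<Longrightarrow> a < n" "E a r \<Longrightarrow> P (Suc a) (Suc r) < P a r"
  using assms by (auto simp: patterns_def)

lemma pattern_mono:
  assumes "(P, E) \<in> patterns n mu" "a \<le> b"
  shows "P a r \<le> P b r"
  using assms(2) by (induction b rule: dec_induct) (use patternsD(4)[OF assms(1)] le_trans in blast)+

lemma pattern_antimono:
  assumes "(P, E) \<in> patterns n mu"
  shows "antimono (P a)"
  unfolding antimono_iff_le_Suc using patternsD(3,4)[OF assms] le_trans by blast

lemma pattern_le_shape: "(P, E) \<in> patterns n mu \<Longrightarrow> P a r \<le> mu r"
  using pattern_mono[of P E n mu a "max a n" r] patternsD(2)[of P E n mu "max a n"] by auto

text \<open>Columns increase strictly, so row \<open>r\<close> cannot hold a letter smaller than
  \<open>r + 1\<close>.\<close>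

lemma pattern_triangular: "(P, E) \<in> patterns n mu \<Longrightarrow> a \<le> r \<Longrightarrow> P a r = 0"
proof (induction a arbitrary: r)
  case (Suc a)
  then obtain s where "r = Suc s" by (cases r) auto
  with Suc patternsD(3)[OF Suc(2), of a s] show ?case by auto
qed (auto dest: patternsD)

lemma pattern_rows:
  assumes "(P, E) \<in> patterns n mu" "n \<le> r"
  shows "P a r = 0" "\<not> E a r" "mu r = 0"
proof -
  show m: "mu r = 0"
    using pattern_triangular[OF assms(1), of n r] patternsD(2)[OF assms(1), of n] assms(2) by simp
  show "P a r = 0" for a using pattern_le_shape[OF assms(1), of a r] m by simp
  then show "\<not> E a r" using patternsD(6)[OF assms(1), of a r] by auto
qed

lemma pcount_rows:
  assumes "Z \<in> patterns n mu" "n \<le> r \<or> n \<le> a"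
  shows "pcount Z a r = 0"
proof -
  obtain P E where Z: "Z = (P, E)" by force
  show ?thesis
    using assms(2) patternsD(2)[of P E n mu a] patternsD(2)[of P E n mu "Suc a"]
      patternsD(5)[of P E n mu a r] pattern_rows[of P E n mu r] assms(1)
    unfolding Z pcount_def by auto
qed

text \<open>Signs are absorbed into \<open>- x a\<close>. Row \<open>n\<close> is empty but
  included, because the extra first letter of row \<open>n - 1\<close> will be stored with row
  \<open>n\<close>.\<close>

lemma pweight_alt:
  fixes x :: "nat \<Rightarrow> 'a::comm_ring_1"
  assumes "(P, E) \<in> patterns n mu"
  shows "pweight n (P, E) x =
    (\<Prod>a<n. \<Prod>r\<le>n. x a ^ (P (Suc a) r - P a r) * (if E a r then - x a else 1))"
proof -
  have "pweight n (P, E) x = (\<Prod>a<n. \<Prod>r<n. (if E a r then - 1 else 1) * x a ^ pcount (P, E) a r)"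
    by (simp add: pweight_def psign_def pcontent_def prod.distrib power_sum)
  also have "\<dots> = (\<Prod>a<n. \<Prod>r\<le>n. x a ^ (P (Suc a) r - P a r) * (if E a r then - x a else 1))"
  proof (rule prod.cong[OF refl])
    fix a
    have "x a ^ (P (Suc a) n - P a n) * (if E a n then - x a else 1) = 1"
      using pattern_rows[OF assms, of n] by simp
    then have "(\<Prod>r\<le>n. x a ^ (P (Suc a) r - P a r) * (if E a r then - x a else 1)) =
      (\<Prod>r<n. x a ^ (P (Suc a) r - P a r) * (if E a r then - x a else 1))"
      by (simp flip: lessThan_Suc_atMost)
    also have "\<dots> = (\<Prod>r<n. (if E a r then - 1 else 1) * x a ^ pcount (P, E) a r)"
      by (rule prod.cong) (auto simp: pcount_def)
    finally show "(\<Prod>r<n. (if E a r then - 1 else 1) * x a ^ pcount (P, E) a r) =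
      (\<Prod>r\<le>n. x a ^ (P (Suc a) r - P a r) * (if E a r then - x a else 1))" by simp
  qed
  finally show ?thesis .
qed

text \<open>The varying entries are overwritten by constants, so that equal keys define the fibres
  and sums can be split along a function. \<open>E i (r - 1)\<close> is not masked, although it is
  tied to the varying \<open>P (Suc i) r\<close>.\<close>

definition fibre_key :: "nat \<Rightarrow> nat \<Rightarrow> pattern \<Rightarrow> pattern" where
  "fibre_key i r Z = (\<lambda>a s. if a = Suc i \<and> r \<le> s then 0 else fst Z a s,
     \<lambda>a s. if (a = i \<or> a = Suc i) \<and> r \<le> s then False else snd Z a s)"

lemma fibre_key_eq_iff:
  "fibre_key i r (P, E) = fibre_key i r (P', E') \<longleftrightarrow>
    (\<forall>a s. \<not> (a = Suc i \<and> r \<le> s) \<longrightarrow> P a s = P' a s) \<and>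
    (\<forall>a s. \<not> ((a = i \<or> a = Suc i) \<and> r \<le> s) \<longrightarrow> E a s = E' a s)"
  unfolding fibre_key_def fun_eq_iff prod.inject by auto

text \<open>In a fibre \<open>P (Suc i) s\<close>, \<open>E i s\<close> and \<open>E (Suc i) s\<close> vary for \<open>s \<ge> r\<close>. The condition on
  \<open>E i (s - 1)\<close> involves \<open>P (Suc i) s\<close>, so the independent local data of row \<open>s\<close> are
  \<open>P (Suc i) s\<close>, \<open>E i (s - 1)\<close> and \<open>E (Suc i) s\<close>.\<close>

locale fibre =
  fixes n i r :: nat and mu :: "nat \<Rightarrow> nat" and P0 :: "nat \<Rightarrow> nat \<Rightarrow> nat"
    and E0 :: "nat \<Rightarrow> nat \<Rightarrow> bool" and K :: "(nat \<times> bool) set"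
  assumes Z0: "(P0, E0) \<in> patterns n mu" and i: "Suc i < n" and r: "r < n"
    and K: "\<And>p e. (p, e) \<in> K \<Longrightarrow> P0 i r \<le> p \<and> p \<le> P0 (Suc (Suc i)) r \<and>
        P0 (Suc (Suc i)) (Suc r) \<le> p \<and> (e \<longrightarrow> P0 (Suc (Suc i)) (Suc r) < p) \<and>
        (0 < r \<longrightarrow> p \<le> P0 i (r - 1) \<and> (E0 i (r - 1) \<longrightarrow> p < P0 i (r - 1)))"
begin

abbreviation kap where "kap \<equiv> P0 i"
abbreviation tau where "tau \<equiv> P0 (Suc (Suc i))"
abbreviation loc_prod where "loc_prod x y \<equiv> \<Prod>s\<in>{r<..n}. loc_sum (kap (s - 1)) (kap s) (tau s) (tau (Suc s)) x y"

definition local_choices :: "nat \<Rightarrow> (nat \<times> bool \<times> bool) set" where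
  "local_choices s = {(p, e1, e2). max (kap s) (tau (Suc s)) \<le> p \<and> p \<le> min (tau s) (kap (s - 1)) \<and>
     (e1 \<longrightarrow> p < kap (s - 1)) \<and> (e2 \<longrightarrow> tau (Suc s) < p)}"

text \<open>Rows beyond \<open>n\<close> get explicit zeros since \<open>g\<close> is undefined
  there, and the extra first letter of row \<open>s\<close> is read from
  \<open>g (Suc s)\<close>.\<close>

definition assemble :: "(nat \<times> bool) \<times> (nat \<Rightarrow> nat \<times> bool \<times> bool) \<Rightarrow> pattern" where
  "assemble = (\<lambda>((p, e), g).
    (\<lambda>a s. if a = Suc i \<and> r \<le> s then (if s = r then p else if s \<le> n then fst (g s) else 0) else P0 a s,
     \<lambda>a s. if a = i \<and> r \<le> s then s < n \<and> fst (snd (g (Suc s)))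
       else if a = Suc i \<and> r \<le> s then (if s = r then e else s \<le> n \<and> snd (snd (g s)))
       else E0 a s))"

definition disassemble :: "pattern \<Rightarrow> (nat \<times> bool) \<times> (nat \<Rightarrow> nat \<times> bool \<times> bool)" where
  "disassemble Z = ((fst Z (Suc i) r, snd Z (Suc i) r),
     restrict (\<lambda>s. (fst Z (Suc i) s, snd Z i (s - 1), snd Z (Suc i) s)) {r<..n})"

definition members :: "pattern set" where
  "members = {Z \<in> patterns n mu. fibre_key i r Z = fibre_key i r (P0, E0) \<and>
     (fst Z (Suc i) r, snd Z (Suc i) r) \<in> K}"

lemma assemble_members:
  assumes "(p, e) \<in> K" "g \<in> PiE {r<..n} local_choices"
  shows "assemble ((p, e), g) \<in> members"
proof -
  note pd = patternsD[OF Z0]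
  have g: "kap s \<le> fst (g s)" "tau (Suc s) \<le> fst (g s)" "fst (g s) \<le> tau s" "fst (g s) \<le> kap (s - 1)"
    "fst (snd (g s)) \<Longrightarrow> fst (g s) < kap (s - 1)" "snd (snd (g s)) \<Longrightarrow> tau (Suc s) < fst (g s)"
    if "r < s" "s \<le> n" for s
    using PiE_mem[OF assms(2), of s] that by (auto simp: local_choices_def split: prod.splits)
  note k = K[OF assms(1)]
  obtain P E where PE: "assemble ((p, e), g) = (P, E)" by force
  then have P: "P a s = (if a = Suc i \<and> r \<le> s then (if s = r then p else if s \<le> n then fst (g s) else 0) else P0 a s)"
    and E: "E a s = (if a = i \<and> r \<le> s then s < n \<and> fst (snd (g (Suc s)))
       else if a = Suc i \<and> r \<le> s then (if s = r then e else s \<le> n \<and> snd (snd (g s)))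
       else E0 a s)" for a s
    by (auto simp: assemble_def)
  have zero: "P0 a s = 0" "\<not> E0 a s" if "n \<le> s" for a s
    using pattern_rows[OF Z0 that] by auto
  have "P (Suc a) (Suc s) \<le> P a s" for a s
  proof -
    consider "a = Suc i" "r \<le> s" | "a = i" "r \<le> Suc s" | "\<not> (a = Suc i \<and> r \<le> s)" "\<not> (a = i \<and> r \<le> Suc s)"
      by blast
    then show ?thesis
    proof cases
      case 1
      then show ?thesis using g(2)[of s] k zero(1)[of "Suc s"] by (auto simp: P)
    next
      case 2
      then show ?thesis using g(4)[of "Suc s"] k by (auto simp: P)
    next
      case 3
      then show ?thesis using pd(3)[of a s] by (auto simp: P)
    qed
  qed
  moreover have "P a s \<le> P (Suc a) s" for a s
  proof -
    consider "a = Suc i" "r \<le> s" | "a = i" "r \<le> s" | "\<not> (a = Suc i \<and> r \<le> s)" "\<not> (a = i \<and> r \<le> s)"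
      by blast
    then show ?thesis
    proof cases
      case 1
      then show ?thesis using g(3)[of s] k by (auto simp: P)
    next
      case 2
      then show ?thesis using g(1)[of s] k zero(1)[of s i] by (auto simp: P)
    next
      case 3
      then show ?thesis using pd(4)[of a s] by (auto simp: P)
    qed
  qed
  moreover have "a < n \<and> P (Suc a) (Suc s) < P a s" if "E a s" for a s
  proof -
    consider "a = Suc i" "r \<le> s" | "a = i" "r \<le> s" | "a = i" "Suc s = r" | "\<not> (a = Suc i \<and> r \<le> s)" "\<not> (a = i \<and> r \<le> Suc s)"
      by linarith
    then show ?thesis
    proof cases
      case 1
      then show ?thesis using that g(6)[of s] k i by (auto simp: P E split: if_splits)
    next
      case 2
      then show ?thesis using that g(5)[of "Suc s"] i by (auto simp: P E)
    next
      \<comment> \<open>Row \<open>r - 1\<close> is outside the fibre, yet its fixed extra letter is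
        limited by the varying \<open>p\<close>; the last clause of the assumption on
        \<open>K\<close> is made for this.\<close>
      case 3
      then show ?thesis using that k i by (auto simp: P E)
    next
      case 4
      then show ?thesis using that pd(5,6)[of a s] by (auto simp: P E split: if_splits)
    qed
  qed
  moreover have "P 0 = (\<lambda>_. 0)" using pd(1) by (auto simp: P)
  moreover have "P a = mu" if "n \<le> a" for a using pd(2)[OF that] that i by (auto simp: P fun_eq_iff)
  ultimately have "(P, E) \<in> patterns n mu" by (auto simp: patterns_def)
  moreover have "fibre_key i r (P, E) = fibre_key i r (P0, E0)"
    unfolding fibre_key_eq_iff by (auto simp: P E)
  ultimately show ?thesis using assms(1) unfolding members_def PE by (auto simp: P E)
qed

lemma disassemble_mem:
  assumes "Z \<in> members"
  shows "disassemble Z \<in> K \<times> PiE {r<..n} local_choices" "assemble (disassemble Z) = Z"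
proof -
  obtain P E where Z: "Z = (P, E)" by force
  have PE: "(P, E) \<in> patterns n mu" and mK: "(P (Suc i) r, E (Suc i) r) \<in> K"
    and key: "fibre_key i r (P, E) = fibre_key i r (P0, E0)"
    using assms by (auto simp: members_def Z)
  have eq: "P a s = P0 a s" if "\<not> (a = Suc i \<and> r \<le> s)" for a s
    using key that by (auto simp: fibre_key_eq_iff)
  have eqE: "E a s = E0 a s" if "\<not> ((a = i \<or> a = Suc i) \<and> r \<le> s)" for a s
    using key that by (auto simp: fibre_key_eq_iff)
  note pd = patternsD[OF PE]
  have "(P (Suc i) s, E i (s - 1), E (Suc i) s) \<in> local_choices s" if "s \<in> {r<..n}" for s
  proof -
    have "0 < s" using that by auto
    then obtain q where q: "s = Suc q" using gr0_conv_Suc by blast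
    have "kap s = P i s" "kap q = P i q" "tau s = P (Suc (Suc i)) s" "tau (Suc s) = P (Suc (Suc i)) (Suc s)"
      by (auto simp: eq)
    then show ?thesis
      using pd(3)[of i q] pd(4)[of i s] pd(3)[of "Suc i" s] pd(4)[of "Suc i" s]
        pd(6)[of i q] pd(6)[of "Suc i" s]
      by (auto simp: local_choices_def q)
  qed
  with mK show "disassemble Z \<in> K \<times> PiE {r<..n} local_choices"
    by (auto simp: disassemble_def Z)
  have zero: "P a s = 0" "\<not> E a s" if "n \<le> s" for a s
    using pattern_rows[OF PE that] by auto
  have "(if a = Suc i \<and> r \<le> s then (if s = r then P (Suc i) r else
      if s \<le> n then fst (restrict (\<lambda>s. (P (Suc i) s, E i (s - 1), E (Suc i) s)) {r<..n} s) else 0) else P0 a s) = P a s" for a s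
    using eq[of a s] zero(1)[of s a] r by auto
  moreover have "(if a = i \<and> r \<le> s then s < n \<and> fst (snd (restrict (\<lambda>s. (P (Suc i) s, E i (s - 1), E (Suc i) s)) {r<..n} (Suc s)))
       else if a = Suc i \<and> r \<le> s then (if s = r then E (Suc i) r else s \<le> n \<and> snd (snd (restrict (\<lambda>s. (P (Suc i) s, E i (s - 1), E (Suc i) s)) {r<..n} s)))
       else E0 a s) = E a s" for a s
    using eqE[of a s] zero(2)[of s a] r by auto
  ultimately show "assemble (disassemble Z) = Z"
    by (simp only: assemble_def disassemble_def Z fst_conv snd_conv prod.case)
qed

lemma disassemble_assemble:
  assumes "(p, e) \<in> K" "g \<in> PiE {r<..n} local_choices"
  shows "disassemble (assemble ((p, e), g)) = ((p, e), g)"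
proof -
  have "restrict (\<lambda>s. (fst (assemble ((p, e), g)) (Suc i) s, snd (assemble ((p, e), g)) i (s - 1),
      snd (assemble ((p, e), g)) (Suc i) s)) {r<..n} s = g s" for s
    using PiE_arb[OF assms(2), of s] by (cases "s \<in> {r<..n}") (auto simp: assemble_def prod_eq_iff)
  then show ?thesis
    unfolding disassemble_def by (auto simp: assemble_def)
qed

text \<open>Every interlacing condition on the varying entries concerns a single local triple or the
  pair of row \<open>r\<close>, so the fibre is a full product.\<close>

lemma bij_assemble: "bij_betw assemble (K \<times> PiE {r<..n} local_choices) members"
proof (rule bij_betw_byWitness[where f' = disassemble])
  show "assemble ` (K \<times> PiE {r<..n} local_choices) \<subseteq> members"
    using assemble_members by auto
  show "disassemble ` members \<subseteq> K \<times> PiE {r<..n} local_choices"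
    using disassemble_mem(1) by blast
  show "\<forall>z\<in>K \<times> PiE {r<..n} local_choices. disassemble (assemble z) = z"
    using disassemble_assemble by auto
  show "\<forall>Z\<in>members. assemble (disassemble Z) = Z"
    using disassemble_mem(2) by blast
qed

definition fixed_part :: "(nat \<Rightarrow> 'a::comm_ring_1) \<Rightarrow> 'a" where
  "fixed_part x = (\<Prod>a\<in>{..<n} - {i, Suc i}. \<Prod>s\<le>n. x a ^ (P0 (Suc a) s - P0 a s) * (if E0 a s then - x a else 1)) *
     (\<Prod>s<r. x i ^ (P0 (Suc i) s - P0 i s) * (if E0 i s then - x i else 1)) *
     (\<Prod>s<r. x (Suc i) ^ (P0 (Suc (Suc i)) s - P0 (Suc i) s) * (if E0 (Suc i) s then - x (Suc i) else 1))"

definition local_weight :: "'a::comm_ring_1 \<Rightarrow> 'a \<Rightarrow> nat \<Rightarrow> nat \<times> bool \<times> bool \<Rightarrow> 'a" where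
  "local_weight x y s = (\<lambda>(p, e1, e2). x ^ (p - kap s) * y ^ (tau s - p) *
     (if e1 then - x else 1) * (if e2 then - y else 1))"

lemma sum_local_weight:
  fixes x y :: "'a::comm_ring_1"
  shows "(\<Sum>q\<in>local_choices s. local_weight x y s q) = loc_sum (kap (s - 1)) (kap s) (tau s) (tau (Suc s)) x y"
proof -
  have "local_choices s = Sigma {max (kap s) (tau (Suc s))..min (tau s) (kap (s - 1))}
     (\<lambda>p. {e1. e1 \<longrightarrow> p < kap (s - 1)} \<times> {e2. e2 \<longrightarrow> tau (Suc s) < p})"
    by (auto simp: local_choices_def)
  then have "(\<Sum>q\<in>local_choices s. local_weight x y s q) =
    (\<Sum>p\<in>{max (kap s) (tau (Suc s))..min (tau s) (kap (s - 1))}.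
      \<Sum>e1\<in>{e1. e1 \<longrightarrow> p < kap (s - 1)}. \<Sum>e2\<in>{e2. e2 \<longrightarrow> tau (Suc s) < p}. local_weight x y s (p, e1, e2))"
    by (simp add: sum.Sigma sum.cartesian_product case_prod_unfold)
  also have "\<dots> = (\<Sum>p\<in>{max (kap s) (tau (Suc s))..min (tau s) (kap (s - 1))}. x ^ (p - kap s) * y ^ (tau s - p) *
      (\<Sum>e1\<in>{e1. e1 \<longrightarrow> p < kap (s - 1)}. if e1 then - x else 1) *
      (\<Sum>e2\<in>{e2. e2 \<longrightarrow> tau (Suc s) < p}. if e2 then - y else 1))"
    by (intro sum.cong[OF refl], simp add: local_weight_def sum_distrib_left sum_distrib_right)
      (rule sum.swap)
  also have "\<dots> = loc_sum (kap (s - 1)) (kap s) (tau s) (tau (Suc s)) x y"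
  proof -
    have "(\<Sum>e\<in>{e. e \<longrightarrow> b}. if e then - z else 1) = (if b then 1 - z else 1)" for b and z :: 'a
    proof -
      have "{e. e \<longrightarrow> b} = (if b then {True, False} else {False})" by auto
      then show ?thesis by simp
    qed
    then show ?thesis by (simp add: loc_sum_def ac_simps)
  qed
  finally show ?thesis .
qed

lemma pweight_assemble:
  fixes x :: "nat \<Rightarrow> 'a::comm_ring_1"
  assumes "(p, e) \<in> K" "g \<in> PiE {r<..n} local_choices"
  shows "pweight n (assemble ((p, e), g)) x = fixed_part x *
    (x i ^ (p - kap r) * x (Suc i) ^ (tau r - p) * (if e then - x (Suc i) else 1)) *
    (\<Prod>s\<in>{r<..n}. local_weight (x i) (x (Suc i)) s (g s))"
proof -
  obtain P E where PE: "assemble ((p, e), g) = (P, E)" by force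
  then have P: "P a s = (if a = Suc i \<and> r \<le> s then (if s = r then p else if s \<le> n then fst (g s) else 0) else P0 a s)"
    and E: "E a s = (if a = i \<and> r \<le> s then s < n \<and> fst (snd (g (Suc s)))
       else if a = Suc i \<and> r \<le> s then (if s = r then e else s \<le> n \<and> snd (snd (g s)))
       else E0 a s)" for a s
    by (auto simp: assemble_def)
  define f where "f a s = x a ^ (P (Suc a) s - P a s) * (if E a s then - x a else 1)" for a s
  have split: "(\<Prod>s\<le>n. h s) = (\<Prod>s<r. h s) * (h r * (\<Prod>s\<in>{r<..n}. h s))" for h :: "nat \<Rightarrow> 'a"
  proof -
    have "{..n} = {..<r} \<union> insert r {r<..n}" using r by auto
    then have "(\<Prod>s\<le>n. h s) = (\<Prod>s<r. h s) * prod h (insert r {r<..n})"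
      by (simp only:) (rule prod.union_disjoint, auto)
    then show ?thesis by simp
  qed
  have "(P, E) \<in> patterns n mu"
    using assemble_members[OF assms] by (simp add: PE members_def)
  then have "pweight n (P, E) x = (\<Prod>a<n. \<Prod>s\<le>n. f a s)"
    unfolding f_def by (rule pweight_alt)
  also have "\<dots> = (\<Prod>a\<in>{..<n} - {i, Suc i}. \<Prod>s\<le>n. f a s) * (\<Prod>a\<in>{i, Suc i}. \<Prod>s\<le>n. f a s)"
    by (rule prod.subset_diff) (use i in auto)
  also have "(\<Prod>a\<in>{..<n} - {i, Suc i}. \<Prod>s\<le>n. f a s) =
      (\<Prod>a\<in>{..<n} - {i, Suc i}. \<Prod>s\<le>n. x a ^ (P0 (Suc a) s - P0 a s) * (if E0 a s then - x a else 1))"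
    by (intro prod.cong refl) (auto simp: f_def P E)
  also have "(\<Prod>a\<in>{i, Suc i}. \<Prod>s\<le>n. f a s) = (\<Prod>s\<le>n. f i s) * (\<Prod>s\<le>n. f (Suc i) s)"
    by simp
  also have "(\<Prod>s\<le>n. f i s) = (\<Prod>s<r. x i ^ (P0 (Suc i) s - P0 i s) * (if E0 i s then - x i else 1)) *
      (x i ^ (p - kap r) * (\<Prod>s\<in>{r<..n}. x i ^ (fst (g s) - kap s) * (if fst (snd (g s)) then - x i else 1)))"
  proof -
    have "(\<Prod>s<r. f i s) = (\<Prod>s<r. x i ^ (P0 (Suc i) s - P0 i s) * (if E0 i s then - x i else 1))"
      by (intro prod.cong refl) (auto simp: f_def P E)
    moreover have "f i r * (\<Prod>s\<in>{r<..n}. f i s) =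
      x i ^ (p - kap r) * (\<Prod>s\<in>{r<..n}. x i ^ (fst (g s) - kap s) * (if fst (snd (g s)) then - x i else 1))"
    proof -
      have a: "(\<Prod>s\<in>{r<..n}. f i s) = (\<Prod>s\<in>{r<..n}. x i ^ (fst (g s) - kap s)) * (\<Prod>s\<in>{r<..n}. if E i s then - x i else 1)"
        unfolding prod.distrib[symmetric] by (intro prod.cong refl) (auto simp: f_def P)
      have b: "f i r = x i ^ (p - kap r) * (if E i r then - x i else 1)"
        by (simp add: f_def P)
      have c: "(if E i r then - x i else 1) * (\<Prod>s\<in>{r<..n}. if E i s then - x i else 1) =
          (\<Prod>s\<in>{r<..n}. if fst (snd (g s)) then - x i else 1)"
      proof -
        have "(if E i r then - x i else 1) * (\<Prod>s\<in>{r<..n}. if E i s then - x i else 1) =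
            (\<Prod>s\<in>insert r {r<..n}. if E i s then - x i else 1)"
          by simp
        \<comment> \<open>Row \<open>n\<close> has no extra letter, so the factors of rows
          \<open>r\<close> to \<open>n - 1\<close> remain; these are stored with rows
          \<open>r + 1\<close> to \<open>n\<close>.\<close>
        also have "\<dots> = (\<Prod>s\<in>{r..<n}. if E i s then - x i else 1)"
          by (rule prod.mono_neutral_right) (use r in \<open>auto simp: E\<close>)
        also have "\<dots> = (\<Prod>s\<in>{r<..n}. if fst (snd (g s)) then - x i else 1)"
          by (rule prod.reindex_bij_witness[of _ "\<lambda>s. s - 1" Suc]) (auto simp: E)
        finally show ?thesis .
      qed
      show ?thesis by (simp only: a b c[symmetric] prod.distrib ac_simps)
    qed
    ultimately show ?thesis by (simp only: split)
  qed
  also have "(\<Prod>s\<le>n. f (Suc i) s) = (\<Prod>s<r. x (Suc i) ^ (P0 (Suc (Suc i)) s - P0 (Suc i) s) * (if E0 (Suc i) s then - x (Suc i) else 1)) *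
      (x (Suc i) ^ (tau r - p) * (if e then - x (Suc i) else 1) *
        (\<Prod>s\<in>{r<..n}. x (Suc i) ^ (tau s - fst (g s)) * (if snd (snd (g s)) then - x (Suc i) else 1)))"
  proof -
    have "(\<Prod>s<r. f (Suc i) s) = (\<Prod>s<r. x (Suc i) ^ (P0 (Suc (Suc i)) s - P0 (Suc i) s) * (if E0 (Suc i) s then - x (Suc i) else 1))"
      by (intro prod.cong refl) (auto simp: f_def P E)
    moreover have "f (Suc i) r = x (Suc i) ^ (tau r - p) * (if e then - x (Suc i) else 1)"
      by (simp add: f_def P E)
    moreover have "(\<Prod>s\<in>{r<..n}. f (Suc i) s) =
      (\<Prod>s\<in>{r<..n}. x (Suc i) ^ (tau s - fst (g s)) * (if snd (snd (g s)) then - x (Suc i) else 1))"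
      by (intro prod.cong refl) (auto simp: f_def P E)
    ultimately show ?thesis by (simp only: split)
  qed
  finally show ?thesis
    by (simp add: PE fixed_part_def local_weight_def prod.distrib case_prod_unfold ac_simps)
qed

lemma finite_local_choices: "finite (local_choices s)"
  by (rule finite_subset[of _ "{..tau s} \<times> UNIV"]) (auto simp: local_choices_def)

text \<open>The fibre is a product and the weight is multiplicative over its rows, so the sum
  becomes a product of one-row sums.\<close>

lemma sum_members:
  fixes x :: "nat \<Rightarrow> 'a::comm_ring_1"
  shows "(\<Sum>Z\<in>members. pweight n Z x) = fixed_part x *
    row_sum K (kap r) (tau r) (x i) (x (Suc i)) *
    loc_prod (x i) (x (Suc i))"
proof -
  define R where "R p e = x i ^ (p - kap r) * x (Suc i) ^ (tau r - p) * (if e then - x (Suc i) else 1)" for p e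
  have "(\<Sum>Z\<in>members. pweight n Z x) =
      (\<Sum>z\<in>K \<times> PiE {r<..n} local_choices. pweight n (assemble z) x)"
    by (rule sum.reindex_bij_betw[OF bij_assemble, symmetric])
  also have "\<dots> = (\<Sum>z\<in>K \<times> PiE {r<..n} local_choices.
      fixed_part x * (case fst z of (p, e) \<Rightarrow> R p e) * (\<Prod>s\<in>{r<..n}. local_weight (x i) (x (Suc i)) s (snd z s)))"
    by (rule sum.cong) (auto simp: pweight_assemble R_def)
  also have "\<dots> = (\<Sum>k\<in>K. \<Sum>g\<in>PiE {r<..n} local_choices.
      fixed_part x * (case k of (p, e) \<Rightarrow> R p e) * (\<Prod>s\<in>{r<..n}. local_weight (x i) (x (Suc i)) s (g s)))"
    by (simp only: sum.cartesian_product case_prod_unfold)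
  also have "\<dots> = fixed_part x * (\<Sum>k\<in>K. case k of (p, e) \<Rightarrow> R p e) *
      (\<Sum>g\<in>PiE {r<..n} local_choices. \<Prod>s\<in>{r<..n}. local_weight (x i) (x (Suc i)) s (g s))"
    by (simp only: sum_distrib_left sum_distrib_right) (rule sum.swap)
  also have "(\<Sum>g\<in>PiE {r<..n} local_choices. \<Prod>s\<in>{r<..n}. local_weight (x i) (x (Suc i)) s (g s)) =
      (\<Prod>s\<in>{r<..n}. \<Sum>q\<in>local_choices s. local_weight (x i) (x (Suc i)) s q)"
    by (rule prod_sum_PiE[symmetric]) (auto simp: finite_local_choices)
  also have "\<dots> = loc_prod (x i) (x (Suc i))"
    by (simp only: sum_local_weight)
  finally show ?thesis
    by (simp add: row_sum_def R_def)
qed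

end

section \<open>Symmetry, alternants and cancellation of violations\<close>

lemma finite_patterns: "finite (patterns n mu)"
proof -
  define f :: "pattern \<Rightarrow> nat \<times> nat \<Rightarrow> nat \<times> bool"
    where "f Z = restrict (\<lambda>(a, r). (fst Z a r, snd Z a r)) ({..<n} \<times> {..<n})" for Z
  have "inj_on f (patterns n mu)"
  proof
    fix Z Z' assume Z: "Z \<in> patterns n mu" and Z': "Z' \<in> patterns n mu" and eq: "f Z = f Z'"
    obtain P E P' E' where PE: "Z = (P, E)" "Z' = (P', E')" by force
    have "P a r = P' a r \<and> E a r = E' a r" for a r
    proof (cases "a < n \<and> r < n")
      case True
      then show ?thesis using fun_cong[OF eq, of "(a, r)"] by (simp add: f_def PE)
    next
      case False
      then show ?thesis
        using Z Z' patternsD(2)[of P E n mu a] patternsD(2)[of P' E' n mu a]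
          patternsD(5)[of P E n mu a r] patternsD(5)[of P' E' n mu a r]
          pattern_rows(1)[of P E n mu r a] pattern_rows(1)[of P' E' n mu r a]
          pattern_rows(2)[of P E n mu r a] pattern_rows(2)[of P' E' n mu r a]
        unfolding PE by (cases "n \<le> a") auto
    qed
    then show "Z = Z'" by (auto simp: PE)
  qed
  moreover have "f ` patterns n mu \<subseteq> PiE ({..<n} \<times> {..<n}) (\<lambda>(a, r). {..mu r} \<times> UNIV)"
    by (auto simp: f_def pattern_le_shape split: if_splits)
  moreover have "finite (PiE ({..<n} \<times> {..<n}) (\<lambda>(a, r). {..mu r} \<times> (UNIV :: bool set)))"
    by (rule finite_PiE) auto
  ultimately show ?thesis
    using finite_imageD finite_subset by blast
qed

lemma sum_eq_by_fibres:
  assumes "finite A" "\<And>a. a \<in> A \<Longrightarrow> sum f {b \<in> A. k b = k a} = sum g {b \<in> A. k b = k a}"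
  shows "sum f A = sum g A"
proof -
  have "sum f A = (\<Sum>v\<in>k ` A. sum f {b \<in> A. k b = v})"
    by (rule sum.image_gen[OF assms(1)])
  also have "\<dots> = (\<Sum>v\<in>k ` A. sum g {b \<in> A. k b = v})"
    by (rule sum.cong) (auto simp: assms(2))
  also have "\<dots> = sum g A"
    by (rule sum.image_gen[OF assms(1), symmetric])
  finally show ?thesis .
qed

context fibre
begin

text \<open>The factor handed down the rows ends at row \<open>n\<close>, where both shapes vanish
  and \<open>carry\<close> is 1; nothing asymmetric remains.\<close>

lemma loc_prod_symm:
  "\<exists>S. symm2 S \<and> (\<forall>x y :: 'a::comm_ring_1.
    carry (kap r) (tau (Suc r)) x y *
      loc_prod x y = S x y)"
proof -
  note pd = patternsD[OF Z0]
  have "kap s \<le> tau s" "tau (Suc (Suc s)) \<le> kap s" for s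
    using pd(4)[of i s] pd(4)[of "Suc i" s] pd(3)[of i s] pd(3)[of "Suc i" "Suc s"] by auto
  moreover have "tau (Suc n) = 0" "kap n = 0"
    using pattern_rows(1)[OF Z0] by auto
  ultimately show ?thesis
    using loc_sum_prod[of kap tau r n, where 'a = 'a] pattern_antimono[OF Z0] r by simp
qed

end

lemma prod_transpose_other:
  assumes "i \<notin> A" "j \<notin> A"
  shows "(\<Prod>a\<in>A. f a ((x \<circ> transpose i j) a)) = (\<Prod>a\<in>A. f a (x a))"
  by (rule prod.cong) (use assms in \<open>auto simp: transpose_def\<close>)

definition gsum :: "nat \<Rightarrow> (nat \<Rightarrow> nat) \<Rightarrow> (nat \<Rightarrow> 'a) \<Rightarrow> 'a::comm_ring_1" where
  "gsum n mu x = (\<Sum>Z\<in>patterns n mu. pweight n Z x)"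

text \<open>Bender-Knuth symmetry by summation instead of an involution. The fibres start at row 0,
  where no row above restricts the choice, and \<open>row_sum_free\<close> supplies the
  \<open>carry\<close> that \<open>loc_prod_symm\<close> absorbs.\<close>

lemma gsum_transpose:
  fixes x :: "nat \<Rightarrow> 'a::comm_ring_1"
  assumes "Suc i < n"
  shows "gsum n mu (x \<circ> transpose i (Suc i)) = gsum n mu x"
  unfolding gsum_def
proof (rule sum_eq_by_fibres[OF finite_patterns, where k = "fibre_key i 0"])
  fix Z0 assume Z0: "Z0 \<in> patterns n mu"
  obtain P E where PE: "Z0 = (P, E)" by force
  note pd = patternsD[OF Z0[unfolded PE]]
  define K where "K = {(p, e). P i 0 \<le> p \<and> P (Suc (Suc i)) (Suc 0) \<le> p \<and> p \<le> P (Suc (Suc i)) 0 \<and>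
    (e \<longrightarrow> P (Suc (Suc i)) (Suc 0) < p)}"
  interpret fibre n i 0 mu P E K
    by unfold_locales (use Z0 PE assms in \<open>auto simp: K_def\<close>)
  have mem: "{Z \<in> patterns n mu. fibre_key i 0 Z = fibre_key i 0 Z0} = members"
  proof -
    have "(fst Z (Suc i) 0, snd Z (Suc i) 0) \<in> K"
      if "Z \<in> patterns n mu" "fibre_key i 0 Z = fibre_key i 0 (P, E)" for Z
    proof -
      obtain P' E' where Z: "Z = (P', E')" by force
      have "P' i s = P i s" "P' (Suc (Suc i)) s = P (Suc (Suc i)) s" for s
        using that(2) by (auto simp: Z fibre_key_eq_iff)
      then show ?thesis
        using patternsD(4)[OF that(1)[unfolded Z], of i 0] patternsD(4)[OF that(1)[unfolded Z], of "Suc i" 0]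
          patternsD(3)[OF that(1)[unfolded Z], of "Suc i" 0] patternsD(6)[OF that(1)[unfolded Z], of "Suc i" 0]
        by (auto simp: Z K_def)
    qed
    then show ?thesis by (auto simp: members_def PE)
  qed
  obtain S where S: "symm2 S" "\<And>x y :: 'a. carry (kap 0) (tau (Suc 0)) x y *
      loc_prod x y = S x y"
    using loc_prod_symm[where 'a = 'a] by blast
  have "kap 0 \<le> tau 0" "tau (Suc 0) \<le> tau 0"
    using pd(4)[of i 0] pd(4)[of "Suc i" 0] pd(3)[of "Suc i" 0] by auto
  then obtain S' where S': "symm2 S'" "\<And>x y :: 'a. row_sum K (kap 0) (tau 0) x y =
      carry (kap 0) (tau (Suc 0)) x y * S' x y"
    using row_sum_free[where 'a = 'a, of "kap 0" "tau 0" "tau (Suc 0)"] unfolding K_def by blast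
  have eq: "(\<Sum>Z\<in>members. pweight n Z x) = fixed_part x * S' (x i) (x (Suc i)) * S (x i) (x (Suc i))"
    for x :: "nat \<Rightarrow> 'a"
  proof -
    have "row_sum K (kap 0) (tau 0) (x i) (x (Suc i)) *
      loc_prod (x i) (x (Suc i)) =
      S' (x i) (x (Suc i)) * S (x i) (x (Suc i))"
      unfolding S'(2) S(2)[symmetric] by (simp only: ac_simps)
    then show ?thesis unfolding sum_members by (simp only: mult.assoc)
  qed
  have "fixed_part (x \<circ> transpose i (Suc i)) = fixed_part x"
    unfolding fixed_part_def
    using prod_transpose_other[of i "{..<n} - {i, Suc i}" "Suc i"
      "\<lambda>a z. \<Prod>s\<le>n. z ^ (P (Suc a) s - P a s) * (if E a s then - z else 1)" x] by simp
  then show "(\<Sum>Z | Z \<in> patterns n mu \<and> fibre_key i 0 Z = fibre_key i 0 Z0. pweight n Z (x \<circ> transpose i (Suc i))) =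
    (\<Sum>Z | Z \<in> patterns n mu \<and> fibre_key i 0 Z = fibre_key i 0 Z0. pweight n Z x)"
    using S(1) S'(1) unfolding mem eq by (simp add: symm2_def)
qed

text \<open>Adjacent transpositions generate the symmetric group; a transposition of distant indices
  is reached by conjugation.\<close>

lemma transpose_invariant_imp_permutes_invariant:
  fixes f :: "(nat \<Rightarrow> 'a) \<Rightarrow> 'b"
  assumes inv: "\<And>x i. Suc i < n \<Longrightarrow> f (x \<circ> transpose i (Suc i)) = f x" and p: "p permutes {..<n}"
  shows "f (x \<circ> p) = f x"
proof -
  have less: "f (x \<circ> transpose a b) = f x" if "a < b" "b < n" for a b x
    using that
  proof (induction b arbitrary: x)
    case (Suc b)
    show ?case
    proof (cases "a = b")
      case True
      show ?thesis unfolding True by (rule inv) (use Suc.prems in simp)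
    next
      case False
      then have ab: "a < b" "b < n" using Suc.prems by auto
      then have "transpose (Suc b) b \<circ> transpose b a \<circ> transpose (Suc b) b = transpose (Suc b) a"
        using Suc.prems by (intro transpose_comp_triple) auto
      then have "x \<circ> transpose a (Suc b) =
          x \<circ> transpose b (Suc b) \<circ> transpose a b \<circ> transpose b (Suc b)"
        by (simp only: transpose_commute comp_assoc)
      then show ?thesis
        by (simp only: inv[OF Suc.prems(2)] Suc.IH[OF ab])
    qed
  qed simp
  have trans: "f (x \<circ> transpose a b) = f x" if "a < n" "b < n" "a \<noteq> b" for a b x
    using that less[of a b x] less[of b a x] by (cases "a < b") (auto simp: transpose_commute)
  show ?thesis
    using finite_lessThan p
  proof (induction p rule: permutes_rev_induct)
    case (swap a b p)
    then have "f (x \<circ> p \<circ> transpose a b) = f (x \<circ> p)"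
      by (intro trans) auto
    then show ?case
      using swap.IH by (simp only: comp_assoc)
  qed simp
qed

lemma gsum_permute: "p permutes {..<n} \<Longrightarrow> gsum n mu (x \<circ> p) = gsum n mu x"
  using gsum_transpose by (rule transpose_invariant_imp_permutes_invariant)

section \<open>Alternating sums and alternants\<close>

definition alternation :: "nat \<Rightarrow> ((nat \<Rightarrow> 'a) \<Rightarrow> 'a) \<Rightarrow> (nat \<Rightarrow> 'a) \<Rightarrow> 'a::comm_ring_1" where
  "alternation n f x = (\<Sum>p | p permutes {..<n}. of_int (sign p) * f (x \<circ> p))"

text \<open>Pairing \<open>p\<close> with \<open>p \<circ> transpose i j\<close> shows that the sum
  equals its negative, and in a domain of characteristic 0 this leaves only 0.\<close>

lemma alternation_eq_0:
  fixes f :: "(nat \<Rightarrow> 'a) \<Rightarrow> 'a::{idom, ring_char_0}"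
  assumes "i < n" "j < n" "i \<noteq> j" "\<And>x. f (x \<circ> transpose i j) = f x"
  shows "alternation n f x = 0"
proof -
  have q: "transpose i j permutes {..<n}"
    using assms by (intro permutes_swap_id) auto
  have "alternation n f x = (\<Sum>p | p permutes {..<n}. of_int (sign (p \<circ> transpose i j)) * f (x \<circ> (p \<circ> transpose i j)))"
    unfolding alternation_def by (rule sum_permutations_compose_right[OF q])
  also have "\<dots> = (\<Sum>p | p permutes {..<n}. - (of_int (sign p) * f (x \<circ> p)))"
  proof (rule sum.cong[OF refl])
    fix p assume p: "p \<in> {p. p permutes {..<n}}"
    then have "sign (p \<circ> transpose i j) = - sign p"
      using q assms(3) by (subst sign_compose) (auto simp: sign_swap_id intro: permutes_imp_permutation[of "{..<n}"])
    then show "of_int (sign (p \<circ> transpose i j)) * f (x \<circ> (p \<circ> transpose i j)) = - (of_int (sign p) * f (x \<circ> p))"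
      using assms(4)[of "x \<circ> p"] by (simp add: comp_assoc)
  qed
  also have "\<dots> = - alternation n f x"
    by (simp add: alternation_def sum_negf)
  finally show ?thesis
    by (metis add.inverse_inverse add_eq_0_iff2 mult_2 mult_eq_0_iff zero_neq_numeral)
qed

lemma alternation_sum: "alternation n (\<lambda>x. \<Sum>a\<in>A. f a x) x = (\<Sum>a\<in>A. alternation n (f a) x)"
  unfolding alternation_def sum_distrib_left by (rule sum.swap)

lemma alternation_const_mult: "alternation n (\<lambda>x. c * f x) x = c * alternation n f x"
  by (simp add: alternation_def sum_distrib_left ac_simps)

lemma alternation_mult_symmetric:
  assumes "\<And>p. p permutes {..<n} \<Longrightarrow> g (x \<circ> p) = g x"
  shows "alternation n (\<lambda>x. f x * g x) x = alternation n f x * g x"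
  unfolding alternation_def sum_distrib_right by (rule sum.cong) (auto simp: assms ac_simps)

definition base :: "nat \<Rightarrow> (nat \<Rightarrow> nat) \<Rightarrow> (nat \<Rightarrow> 'a) \<Rightarrow> 'a::comm_ring_1" where
  "base n al x = (\<Prod>j<n. x j ^ (al j + (n - Suc j)) * (1 - x j) ^ j)"

abbreviation alternant :: "nat \<Rightarrow> (nat \<Rightarrow> nat) \<Rightarrow> (nat \<Rightarrow> 'a) \<Rightarrow> 'a::comm_ring_1" where
  "alternant n al \<equiv> alternation n (base n al)"

text \<open>A tableau only shifts the exponents of the base, so under alternation it contributes one
  signed alternant.\<close>

lemma base_mult_pweight:
  "base n la x * pweight n Z x = psign n Z * base n (\<lambda>a. la a + pcontent n Z a) x"
proof -
  have "base n (\<lambda>a. la a + pcontent n Z a) x = base n la x * (\<Prod>a<n. x a ^ pcontent n Z a)"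
    unfolding base_def prod.distrib[symmetric] by (rule prod.cong) (simp_all only: power_add ac_simps)
  then show ?thesis by (simp add: pweight_def ac_simps)
qed

section \<open>First violations of the ballot condition\<close>

text \<open>In a row word the letter \<open>i + 2\<close> precedes \<open>i + 1\<close>, so the ballot condition is tested
  after the last \<open>i + 2\<close> of row \<open>r\<close>, when no \<open>i + 1\<close> of that row has been read.\<close>

definition violation :: "(nat \<Rightarrow> nat) \<Rightarrow> pattern \<Rightarrow> nat \<Rightarrow> nat \<Rightarrow> bool" where
  "violation la Z r i \<longleftrightarrow>
     la i + (\<Sum>s<r. pcount Z i s) < la (Suc i) + (\<Sum>s\<le>r. pcount Z (Suc i) s)"

text \<open>Taking the largest \<open>i\<close> makes the class a union of fibres. The test of
  \<open>j\<close> in row \<open>r\<close> reads that row only through the letter index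
  \<open>Suc j\<close>: for \<open>j > i\<close> this index is not varied, whereas for
  \<open>j = i - 1\<close> it would be.\<close>

definition first_violations :: "nat \<Rightarrow> (nat \<Rightarrow> nat) \<Rightarrow> (nat \<Rightarrow> nat) \<Rightarrow> nat \<Rightarrow> nat \<Rightarrow> pattern set" where
  "first_violations n mu la r i = {Z \<in> patterns n mu. (\<forall>s<r. \<forall>j. \<not> violation la Z s j) \<and>
     (\<forall>j>i. \<not> violation la Z r j) \<and> violation la Z r i}"

text \<open>If row \<open>r\<close> had no letter \<open>i + 2\<close>, the inequality would already
  fail in row \<open>r - 1\<close>, or for \<open>la\<close> itself when \<open>r = 0\<close>. Such
  a letter exists only inside the first \<open>n\<close> rows and the first \<open>n\<close>
  letters.\<close>

lemma first_violation_bound: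
  assumes "antimono la" "Z \<in> patterns n mu" "\<forall>s<r. \<not> violation la Z s i" "violation la Z r i"
  shows "r < n" "Suc i < n"
proof -
  have "pcount Z (Suc i) r \<noteq> 0"
  proof
    assume "pcount Z (Suc i) r = 0"
    then have v: "la i + (\<Sum>s<r. pcount Z i s) < la (Suc i) + (\<Sum>s<r. pcount Z (Suc i) s)"
      using assms(4) by (simp add: violation_def flip: lessThan_Suc_atMost)
    show False
    proof (cases r)
      case 0
      then show False using v antimonoD[OF assms(1), of i "Suc i"] by simp
    next
      case (Suc q)
      then have "\<not> violation la Z q i" using assms(3) by simp
      then show False using v by (simp add: Suc violation_def flip: lessThan_Suc_atMost)
    qed
  qed
  then show "r < n" "Suc i < n"
    using pcount_rows[OF assms(2), of r "Suc i"] by (meson not_le)+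
qed

lemma fibre_key_pcount:
  assumes "fibre_key i r Z = fibre_key i r Z'" "s < r \<or> (a \<noteq> i \<and> a \<noteq> Suc i)"
  shows "pcount Z a s = pcount Z' a s"
proof -
  obtain P E P' E' where Z: "Z = (P, E)" "Z' = (P', E')" by (metis surj_pair)
  show ?thesis
    using assms unfolding Z fibre_key_eq_iff by (auto simp: pcount_def)
qed

text \<open>The core of the cancellation: on each fibre the base monomial supplies exactly the
  imbalance \<open>x ^ l * (1 - y)\<close> for which \<open>row_sum_bad\<close> was set up.\<close>

lemma first_violations_symmetric:
  fixes x :: "nat \<Rightarrow> 'a::comm_ring_1" and mu :: "nat \<Rightarrow> nat"
  assumes la: "antimono la" and i: "Suc i < n" and r: "r < n"
  defines "F \<equiv> \<lambda>x. \<Sum>Z\<in>first_violations n mu la r i. base n la x * pweight n Z x"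
  shows "F (x \<circ> transpose i (Suc i)) = F x"
  unfolding F_def
proof (rule sum_eq_by_fibres[where k = "fibre_key i r"])
  show "finite (first_violations n mu la r i)"
    using finite_patterns by (simp add: first_violations_def)
next
  fix Z0 assume Z0f: "Z0 \<in> first_violations n mu la r i"
  obtain P E where PE: "Z0 = (P, E)" by force
  have Z0: "(P, E) \<in> patterns n mu" using Z0f by (simp add: first_violations_def PE)
  note pd = patternsD[OF Z0]
  \<comment> \<open>Counts of the letters \<open>i + 1\<close> and \<open>i + 2\<close> before row
    \<open>r\<close>, starting from \<open>la\<close>; \<open>l\<close> is the least number of
    letters \<open>i + 2\<close> in row \<open>r\<close> that breaks the condition.\<close>
  define A where "A = la i + (\<Sum>s<r. pcount Z0 i s)"
  define B where "B = la (Suc i) + (\<Sum>s<r. pcount Z0 (Suc i) s)"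
  define l where "l = Suc A - B"
  \<comment> \<open>The condition held in row \<open>r - 1\<close>, where its own letters
    \<open>i + 1\<close> did not count yet; by row \<open>r\<close> they have become a
    surplus.\<close>
  have AB: "B \<le> A \<and> (0 < r \<longrightarrow> B + pcount Z0 i (r - 1) \<le> A)"
  proof (cases r)
    case 0
    then show ?thesis using antimonoD[OF la, of i "Suc i"] by (simp add: A_def B_def)
  next
    case (Suc q)
    then have "\<not> violation la Z0 q i" using Z0f by (simp add: first_violations_def)
    then show ?thesis by (simp add: A_def B_def Suc violation_def lessThan_Suc_atMost[symmetric])
  qed
  define K where "K = {(p, e). P i r \<le> p \<and> P (Suc (Suc i)) (Suc r) \<le> p \<and> p \<le> P (Suc (Suc i)) r \<and>
    (e \<longrightarrow> P (Suc (Suc i)) (Suc r) < p) \<and> l \<le> P (Suc (Suc i)) r - p + of_bool e}"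
  interpret fibre n i r mu P E K
  proof
    fix p e assume K: "(p, e) \<in> K"
    \<comment> \<open>So many letters \<open>i + 2\<close> in row \<open>r\<close> push
      \<open>p\<close> so far left that the bound from row \<open>r - 1\<close> holds by itself,
      even in its strict form for an extra letter. This decouples row \<open>r\<close> from the rows
      above.\<close>
    have "p \<le> P i (r - 1) \<and> (E i (r - 1) \<longrightarrow> p < P i (r - 1))" if "0 < r"
    proof -
      from that obtain q where q: "r = Suc q" using gr0_conv_Suc by blast
      have "l \<ge> Suc (pcount Z0 i q)" using AB q by (auto simp: l_def)
      moreover have "l \<le> P (Suc (Suc i)) r - p + of_bool e" "p \<le> P (Suc (Suc i)) r"
        using K unfolding K_def mem_Collect_eq prod.case by blast+
      moreover have "of_bool e \<le> (1 :: nat)"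
        by simp
      moreover have "P (Suc (Suc i)) r \<le> P (Suc i) q" "P i q \<le> P (Suc i) q"
        using pd(3)[of "Suc i" q] pd(4)[of i q] by (auto simp: q)
      moreover have "pcount Z0 i q = P (Suc i) q - P i q + of_bool (E i q)"
        by (simp add: pcount_def PE)
      ultimately have "p + of_bool (E i q) \<le> P i q"
        by linarith
      then show ?thesis by (cases "E i q") (simp_all add: q)
    qed
    then show "P i r \<le> p \<and> p \<le> P (Suc (Suc i)) r \<and>
        P (Suc (Suc i)) (Suc r) \<le> p \<and> (e \<longrightarrow> P (Suc (Suc i)) (Suc r) < p) \<and>
        (0 < r \<longrightarrow> p \<le> P i (r - 1) \<and> (E i (r - 1) \<longrightarrow> p < P i (r - 1)))"
      using K by (simp add: K_def)
  qed (use Z0 i r in auto)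
  have mem: "{Z \<in> first_violations n mu la r i. fibre_key i r Z = fibre_key i r Z0} = members"
  proof -
    have "Z \<in> first_violations n mu la r i \<longleftrightarrow> (fst Z (Suc i) r, snd Z (Suc i) r) \<in> K"
      if Z: "Z \<in> patterns n mu" and key: "fibre_key i r Z = fibre_key i r Z0" for Z
    proof -
      obtain P' E' where Z': "Z = (P', E')" by force
      have P': "P' i s = P i s" "P' (Suc (Suc i)) s = P (Suc (Suc i)) s" for s
        using key by (auto simp: Z' PE fibre_key_eq_iff)
      have "violation la Z s j = violation la Z0 s j" if "s < r \<or> s = r \<and> i < j" for s j
        using that fibre_key_pcount[OF key] by (auto simp: violation_def intro!: arg_cong2[of _ _ _ _ less] arg_cong2[of _ _ _ _ plus] sum.cong)
      then have "Z \<in> first_violations n mu la r i \<longleftrightarrow> violation la Z r i"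
        using Z0f Z by (auto simp: first_violations_def)
      also have "\<dots> \<longleftrightarrow> A < B + pcount Z (Suc i) r"
        using fibre_key_pcount[OF key] by (simp add: violation_def A_def B_def lessThan_Suc_atMost[symmetric] add.assoc)
      also have "\<dots> \<longleftrightarrow> l \<le> pcount Z (Suc i) r"
        using AB by (auto simp: l_def)
      also have "\<dots> \<longleftrightarrow> (fst Z (Suc i) r, snd Z (Suc i) r) \<in> K"
        using patternsD(4)[OF Z[unfolded Z'], of i r] patternsD(4)[OF Z[unfolded Z'], of "Suc i" r]
          patternsD(3)[OF Z[unfolded Z'], of "Suc i" r] patternsD(6)[OF Z[unfolded Z'], of "Suc i" r]
        by (auto simp: K_def Z' P' pcount_def)
      finally show ?thesis .
    qed
    moreover have "first_violations n mu la r i \<subseteq> patterns n mu"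
      by (auto simp: first_violations_def)
    ultimately show ?thesis unfolding members_def PE[symmetric] by blast
  qed
  obtain S where S: "symm2 S" "\<And>x y :: 'a. carry (kap r) (tau (Suc r)) x y *
      loc_prod x y = S x y"
    using loc_prod_symm[where 'a = 'a] by blast
  have "kap r \<le> tau r" "tau (Suc r) \<le> tau r"
    using pd(4)[of i r] pd(4)[of "Suc i" r] pd(3)[of "Suc i" r] by auto
  moreover have "1 \<le> l" using AB by (auto simp: l_def)
  ultimately obtain S' where S': "symm2 S'" "\<And>x y :: 'a. x ^ l * (1 - y) * row_sum K (kap r) (tau r) x y =
      carry (kap r) (tau (Suc r)) x y * S' x y"
    using row_sum_bad[where 'a = 'a, of "kap r" "tau r" "tau (Suc r)" l] unfolding K_def by blast
  let ?I = "{..<n} - {i, Suc i}"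
  define C where "C x = (\<Prod>j\<in>?I. x j ^ (la j + (n - Suc j)) * (1 - x j) ^ j) *
      (\<Prod>a\<in>?I. \<Prod>s\<le>n. x a ^ (P (Suc a) s - P a s) * (if E a s then - x a else 1))" for x :: "nat \<Rightarrow> 'a"
  define c :: 'a where "c = (\<Prod>s<r. if E i s then - 1 else 1) * (\<Prod>s<r. if E (Suc i) s then - 1 else 1)"
  define N where "N = B + (n - Suc (Suc i))"
  \<comment> \<open>The staircase exponents of the two variables differ by one, which turns the lead
    \<open>A - B\<close> into \<open>l = A - B + 1\<close>.\<close>
  have expo: "la i + (n - Suc i) + (\<Sum>s<r. pcount Z0 i s) = N + l"
    "la (Suc i) + (n - Suc (Suc i)) + (\<Sum>s<r. pcount Z0 (Suc i) s) = N"
    using AB i by (auto simp: N_def l_def A_def B_def)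
  have eq: "(\<Sum>Z\<in>members. base n la x * pweight n Z x) =
      C x * c * ((x i * x (Suc i)) ^ N * ((1 - x i) * (1 - x (Suc i))) ^ i *
        S' (x i) (x (Suc i)) * S (x i) (x (Suc i)))"
    for x :: "nat \<Rightarrow> 'a"
  proof -
    let ?x = "x i" and ?y = "x (Suc i)"
    have "base n la x = (\<Prod>j\<in>?I. x j ^ (la j + (n - Suc j)) * (1 - x j) ^ j) *
       (\<Prod>j\<in>{i, Suc i}. x j ^ (la j + (n - Suc j)) * (1 - x j) ^ j)"
      unfolding base_def by (rule prod.subset_diff) (use i in auto)
    moreover have "(\<Prod>s<r. ?x ^ (P (Suc i) s - P i s) * (if E i s then - ?x else 1)) =
        (\<Prod>s<r. if E i s then - 1 else 1) * ?x ^ (\<Sum>s<r. pcount Z0 i s)"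
      unfolding power_sum prod.distrib[symmetric] by (rule prod.cong) (auto simp: pcount_def PE)
    moreover have "(\<Prod>s<r. ?y ^ (P (Suc (Suc i)) s - P (Suc i) s) * (if E (Suc i) s then - ?y else 1)) =
        (\<Prod>s<r. if E (Suc i) s then - 1 else 1) * ?y ^ (\<Sum>s<r. pcount Z0 (Suc i) s)"
      unfolding power_sum prod.distrib[symmetric] by (rule prod.cong) (auto simp: pcount_def PE)
    ultimately have "base n la x * fixed_part x = C x * c *
        (?x ^ (la i + (n - Suc i) + (\<Sum>s<r. pcount Z0 i s)) * ?y ^ (la (Suc i) + (n - Suc (Suc i)) + (\<Sum>s<r. pcount Z0 (Suc i) s))
        * (1 - ?x) ^ i * (1 - ?y) ^ Suc i)"
      unfolding fixed_part_def C_def c_def by (simp add: power_add ac_simps)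
    \<comment> \<open>Of the powers of \<open>1 - x i\<close> and \<open>1 - x (Suc i)\<close> a
      single factor of the second kind stays unpaired.\<close>
    also have "\<dots> = C x * c * ((?x * ?y) ^ N * ((1 - ?x) * (1 - ?y)) ^ i * (?x ^ l * (1 - ?y)))"
      unfolding expo by (simp add: power_add power_mult_distrib ac_simps)
    finally have 1: "base n la x * fixed_part x = C x * c * ((?x * ?y) ^ N * ((1 - ?x) * (1 - ?y)) ^ i * (?x ^ l * (1 - ?y)))" .
    have 2: "?x ^ l * (1 - ?y) * row_sum K (kap r) (tau r) ?x ?y *
      loc_prod ?x ?y =
      S' ?x ?y * S ?x ?y"
      unfolding S'(2) S(2)[symmetric] by (simp only: ac_simps)
    have "(\<Sum>Z\<in>members. base n la x * pweight n Z x) = base n la x * fixed_part x *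
       row_sum K (kap r) (tau r) ?x ?y * loc_prod ?x ?y"
      by (simp only: sum_distrib_left[symmetric] sum_members mult.assoc)
    also have "\<dots> = C x * c * ((?x * ?y) ^ N * ((1 - ?x) * (1 - ?y)) ^ i *
      (?x ^ l * (1 - ?y) * row_sum K (kap r) (tau r) ?x ?y *
      loc_prod ?x ?y))"
      unfolding 1 by (simp only: mult.assoc)
    also have "\<dots> = C x * c * ((?x * ?y) ^ N * ((1 - ?x) * (1 - ?y)) ^ i * S' ?x ?y * S ?x ?y)"
      unfolding 2 by (simp only: mult.assoc)
    finally show ?thesis .
  qed
  have "C (x \<circ> transpose i (Suc i)) = C x"
    unfolding C_def
    using prod_transpose_other[of i ?I "Suc i" "\<lambda>j z. z ^ (la j + (n - Suc j)) * (1 - z) ^ j" x]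
      prod_transpose_other[of i ?I "Suc i"
      "\<lambda>a z. \<Prod>s\<le>n. z ^ (P (Suc a) s - P a s) * (if E a s then - z else 1)" x] by simp
  then show "(\<Sum>Z | Z \<in> first_violations n mu la r i \<and> fibre_key i r Z = fibre_key i r Z0.
      base n la (x \<circ> transpose i (Suc i)) * pweight n Z (x \<circ> transpose i (Suc i))) =
    (\<Sum>Z | Z \<in> first_violations n mu la r i \<and> fibre_key i r Z = fibre_key i r Z0.
      base n la x * pweight n Z x)"
    using S(1) S'(1) unfolding mem eq by (simp add: symm2_def mult.commute)
qed

definition ballot_patterns :: "nat \<Rightarrow> (nat \<Rightarrow> nat) \<Rightarrow> (nat \<Rightarrow> nat) \<Rightarrow> pattern set" where
  "ballot_patterns n mu la = {Z \<in> patterns n mu. \<forall>r i. \<not> violation la Z r i}"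

lemma first_violation_exists:
  assumes la: "antimono la" and Z: "Z \<in> patterns n mu" "Z \<notin> ballot_patterns n mu la"
  shows "\<exists>r<n. \<exists>i. Suc i < n \<and> Z \<in> first_violations n mu la r i"
proof -
  have ex: "\<exists>r i. violation la Z r i" using Z by (simp add: ballot_patterns_def)
  define r where "r = (LEAST r. \<exists>i. violation la Z r i)"
  have r: "\<exists>i. violation la Z r i"
    unfolding r_def using ex by (rule LeastI_ex)
  have less: "\<not> violation la Z s j" if "s < r" for s j
    using not_less_Least[of s "\<lambda>r. \<exists>i. violation la Z r i"] that by (auto simp: r_def)
  have bound: "r < n" "Suc i < n" if "violation la Z r i" for i
    using first_violation_bound[OF la Z(1) _ that] less by auto
  define i where "i = (GREATEST i. violation la Z r i)"
  have b: "\<forall>j. violation la Z r j \<longrightarrow> j \<le> n" using bound(2) by fastforce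
  have i: "violation la Z r i"
    unfolding i_def by (rule GreatestI_ex_nat[OF r, where b = n]) (use b in blast)
  have "\<not> violation la Z r j" if "i < j" for j
    using Greatest_le_nat[of "violation la Z r" j n] b that by (force simp: i_def)
  then have "Z \<in> first_violations n mu la r i"
    using Z(1) less i by (simp add: first_violations_def)
  with bound[OF i] show ?thesis by blast
qed

theorem alternant_mult_gsum:
  fixes x :: "nat \<Rightarrow> 'a::{idom, ring_char_0}"
  assumes la: "antimono la"
  shows "alternant n la x * gsum n mu x =
    (\<Sum>Z\<in>ballot_patterns n mu la. psign n Z * alternant n (\<lambda>a. la a + pcontent n Z a) x)"
proof -
  define I where "I = {(r, i). r < n \<and> Suc i < n}"
  define V where "V = (\<lambda>(r, i). first_violations n mu la r i)"
  define B where "B = ballot_patterns n mu la"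
  define t where "t Z = alternation n (\<lambda>x. base n la x * pweight n Z x) x" for Z
  have fin: "finite I" by (rule finite_subset[of _ "{..<n} \<times> {..<n}"]) (auto simp: I_def)
  have un: "patterns n mu = B \<union> (\<Union>z\<in>I. V z)"
  proof (intro equalityI subsetI)
    fix Z assume "Z \<in> patterns n mu"
    then show "Z \<in> B \<union> (\<Union>z\<in>I. V z)"
      using first_violation_exists[OF la, of Z n mu] unfolding B_def V_def I_def by blast
  next
    fix Z assume "Z \<in> B \<union> (\<Union>z\<in>I. V z)"
    then show "Z \<in> patterns n mu"
      by (auto simp: B_def V_def ballot_patterns_def first_violations_def)
  qed
  have dis: "B \<inter> (\<Union>z\<in>I. V z) = {}"
    by (auto simp: B_def V_def ballot_patterns_def first_violations_def)
  \<comment> \<open>Both indices are determined by the pattern: \<open>r\<close> is the first row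
    with a violation and \<open>i\<close> the largest index violated in it.\<close>
  have dis2: "V z \<inter> V z' = {}" if "z \<noteq> z'" for z z'
  proof (rule ccontr)
    obtain r i r' i' where z: "z = (r, i)" "z' = (r', i')" by force
    assume "V z \<inter> V z' \<noteq> {}"
    then obtain Z where Z: "Z \<in> first_violations n mu la r i" "Z \<in> first_violations n mu la r' i'"
      by (auto simp: V_def z)
    then have "r = r'"
      unfolding first_violations_def mem_Collect_eq by (metis linorder_neqE_nat)
    moreover from this Z have "i = i'"
      unfolding first_violations_def mem_Collect_eq by (metis linorder_neqE_nat)
    ultimately show False using that z by simp
  qed
  have finV: "finite (V z)" for z
    using finite_patterns[of n mu] by (auto simp: V_def first_violations_def split: prod.splits)
  have zero: "(\<Sum>Z\<in>V z. t Z) = 0" if "z \<in> I" for z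
  proof -
    obtain r i where z: "z = (r, i)" "r < n" "Suc i < n" using \<open>z \<in> I\<close> by (auto simp: I_def)
    show ?thesis
      unfolding t_def alternation_sum[symmetric] V_def z prod.case
      using first_violations_symmetric[OF la z(3,2)] z
      by (intro alternation_eq_0[of i n "Suc i"]) auto
  qed
  have "alternant n la x * gsum n mu x = alternation n (\<lambda>x. base n la x * gsum n mu x) x"
    by (rule alternation_mult_symmetric[symmetric]) (rule gsum_permute)
  also have "\<dots> = (\<Sum>Z\<in>patterns n mu. t Z)"
    by (simp add: gsum_def sum_distrib_left alternation_sum t_def)
  also have "\<dots> = (\<Sum>Z\<in>B. t Z) + (\<Sum>Z\<in>(\<Union>z\<in>I. V z). t Z)"
    unfolding un by (rule sum.union_disjoint)
      (use finite_patterns[of n mu] fin finV dis in \<open>auto simp: B_def ballot_patterns_def\<close>)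
  also have "(\<Sum>Z\<in>(\<Union>z\<in>I. V z). t Z) = (\<Sum>z\<in>I. \<Sum>Z\<in>V z. t Z)"
    by (rule sum.UNION_disjoint) (use fin finV dis2 in auto)
  also have "\<dots> = 0" using zero by (intro sum.neutral) auto
  also have "(\<Sum>Z\<in>B. t Z) = (\<Sum>Z\<in>B. psign n Z * alternant n (\<lambda>a. la a + pcontent n Z a) x)"
    unfolding t_def base_mult_pweight alternation_const_mult ..
  finally show ?thesis by (simp add: B_def)
qed

section \<open>The superstandard tableau and the bialternant formula\<close>

definition superstandard :: "(nat \<Rightarrow> nat) \<Rightarrow> pattern" where
  "superstandard mu = (\<lambda>a r. if r < a then mu r else 0, \<lambda>_ _. False)"

lemma pcount_superstandard: "pcount (superstandard mu) a r = (if r = a then mu r else 0)"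
  by (auto simp: superstandard_def pcount_def)

lemma superstandard_in_patterns:
  assumes "antimono mu" "\<And>r. n \<le> r \<Longrightarrow> mu r = 0"
  shows "superstandard mu \<in> patterns n mu"
  using assms antimonoD[OF assms(1)]
  by (auto simp: superstandard_def patterns_def fun_eq_iff not_less)

text \<open>If row \<open>r\<close> has no letter above \<open>r + 1\<close>, it is filled in one
  step, being empty in \<open>P r\<close> and complete in \<open>P (Suc r)\<close>.\<close>

lemma eq_superstandardI:
  assumes Z: "Z \<in> patterns n mu" and zero: "\<And>a r. r < a \<Longrightarrow> pcount Z a r = 0"
  shows "Z = superstandard mu"
proof -
  obtain P E where PE: "Z = (P, E)" by force
  note pd = patternsD[OF Z[unfolded PE]]
  have step: "P (Suc a) r = P a r" "\<not> E a r" if "r < a" for a r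
    using zero[OF that] pd(4)[of a r] by (auto simp: pcount_def PE split: if_splits)
  have eq: "P b r = P a r" if "a \<le> b" "r < a" for a b r
    using that by (induction b rule: dec_induct) (auto simp: step)
  have P: "P a r = (if r < a then mu r else 0)" for a r
  proof (cases "r < a")
    case True
    then show ?thesis
      using eq[of a "max a n" r] pd(2)[of "max a n"] by simp
  next
    case False
    then show ?thesis using pattern_triangular[OF Z[unfolded PE], of a r] by simp
  qed
  have "\<not> E a r" for a r
  proof (cases "r < a")
    case False
    then have "P a r = 0" by (simp add: P)
    then show ?thesis using pd(6)[of a r] by auto
  qed (use step in auto)
  with P show ?thesis by (auto simp: superstandard_def PE fun_eq_iff)
qed

text \<open>By induction on rows: in row \<open>r\<close> a letter \<open>i + 2\<close> with
  \<open>r \<le> i\<close> would need letters \<open>i + 1\<close> in rows \<open>s < r\<close>, and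
  there are none because \<open>s < i\<close>.\<close>

lemma ballot_patterns_zero:
  assumes "antimono mu" "\<And>r. n \<le> r \<Longrightarrow> mu r = 0"
  shows "ballot_patterns n mu (\<lambda>_. 0) = {superstandard mu}"
proof (intro equalityI subsetI)
  fix Z assume Z: "Z \<in> ballot_patterns n mu (\<lambda>_. 0)"
  then have nv: "(\<Sum>s\<le>r. pcount Z (Suc i) s) \<le> (\<Sum>s<r. pcount Z i s)" for r i
    by (simp add: ballot_patterns_def violation_def not_less)
  have "pcount Z a r = 0" if "r < a" for a r
    using that
  proof (induction r arbitrary: a rule: less_induct)
    case (less r)
    then obtain i where i: "a = Suc i" by (cases a) auto
    have "(\<Sum>s<r. pcount Z i s) = 0"
      using less i by (intro sum.neutral) auto
    then have "(\<Sum>s\<le>r. pcount Z a s) = 0" using nv[of i r] i by simp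
    then show ?case by simp
  qed
  then have "Z = superstandard mu"
    using Z by (intro eq_superstandardI[of Z n]) (auto simp: ballot_patterns_def)
  then show "Z \<in> {superstandard mu}" by simp
next
  fix Z assume "Z \<in> {superstandard mu}"
  moreover have "\<not> violation (\<lambda>_. 0) (superstandard mu) r i" for r i
    using antimonoD[OF assms(1), of i "Suc i"]
    by (auto simp: violation_def pcount_superstandard sum.delta)
  ultimately show "Z \<in> ballot_patterns n mu (\<lambda>_. 0)"
    using superstandard_in_patterns[OF assms] by (simp add: ballot_patterns_def)
qed

lemma pcontent_superstandard:
  assumes "\<And>r. n \<le> r \<Longrightarrow> mu r = 0"
  shows "pcontent n (superstandard mu) = mu"
  using assms by (auto simp: pcontent_def pcount_superstandard fun_eq_iff sum.delta)

text \<open>The bialternant formula: only the superstandard tableau survives, with sign 1 and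
  content \<open>mu\<close>.\<close>

lemma alternant_zero_mult_gsum:
  fixes x :: "nat \<Rightarrow> 'a::{idom, ring_char_0}"
  assumes "antimono mu" "\<And>r. n \<le> r \<Longrightarrow> mu r = 0"
  shows "alternant n (\<lambda>_. 0) x * gsum n mu x = alternant n mu x"
proof -
  have "psign n (superstandard mu) = (1 :: 'a)"
    by (simp add: psign_def superstandard_def)
  then show ?thesis
    using alternant_mult_gsum[of "\<lambda>_. 0" n x mu] ballot_patterns_zero[OF assms] pcontent_superstandard[OF assms(2)]
    by (simp add: antimono_def)
qed

text \<open>Row \<open>n\<close> is empty, so the test there compares the complete contents.\<close>

lemma ballot_content_antimono:
  assumes "antimono la" "Z \<in> ballot_patterns n mu la"
  shows "antimono (\<lambda>a. la a + pcontent n Z a)"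
  unfolding antimono_iff_le_Suc
proof
  fix i
  have Z: "Z \<in> patterns n mu" "\<not> violation la Z n i"
    using assms(2) by (auto simp: ballot_patterns_def)
  then show "la (Suc i) + pcontent n Z (Suc i) \<le> la i + pcontent n Z i"
    using pcount_rows[OF Z(1), of n "Suc i"]
    by (simp add: violation_def pcontent_def flip: lessThan_Suc_atMost)
qed

text \<open>After multiplication by the alternant of 0 both sides are the same sum of alternants,
  and \<open>nz\<close> allows cancelling. Each \<open>la + pcontent n Z\<close> is weakly
  decreasing and vanishes from row \<open>n\<close> on, so the bialternant formula can be read
  backwards.\<close>

lemma gsum_mult_gsum:
  fixes x :: "nat \<Rightarrow> 'a::{idom, ring_char_0}"
  assumes la: "antimono la" "\<And>r. n \<le> r \<Longrightarrow> la r = 0"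
    and nz: "alternant n (\<lambda>_. 0) x \<noteq> 0"
  shows "gsum n la x * gsum n mu x =
    (\<Sum>Z\<in>ballot_patterns n mu la. psign n Z * gsum n (\<lambda>a. la a + pcontent n Z a) x)"
proof -
  have "alternant n (\<lambda>_. 0) x * (gsum n la x * gsum n mu x) = alternant n la x * gsum n mu x"
    by (simp only: alternant_zero_mult_gsum[OF la] flip: mult.assoc)
  also have "\<dots> = (\<Sum>Z\<in>ballot_patterns n mu la. psign n Z * alternant n (\<lambda>a. la a + pcontent n Z a) x)"
    by (rule alternant_mult_gsum[OF la(1)])
  also have "\<dots> = (\<Sum>Z\<in>ballot_patterns n mu la. psign n Z *
      (alternant n (\<lambda>_. 0) x * gsum n (\<lambda>a. la a + pcontent n Z a) x))"
  proof (rule sum.cong[OF refl])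
    fix Z assume Z: "Z \<in> ballot_patterns n mu la"
    then have "la r + pcontent n Z r = 0" if "n \<le> r" for r
      using la(2)[OF that] pcount_rows[of Z n mu _ r] that by (auto simp: pcontent_def ballot_patterns_def)
    then show "psign n Z * alternant n (\<lambda>a. la a + pcontent n Z a) x =
      psign n Z * (alternant n (\<lambda>_. 0) x * gsum n (\<lambda>a. la a + pcontent n Z a) x)"
      using ballot_content_antimono[OF la(1) Z] by (subst alternant_zero_mult_gsum) auto
  qed
  also have "\<dots> = alternant n (\<lambda>_. 0) x * (\<Sum>Z\<in>ballot_patterns n mu la. psign n Z * gsum n (\<lambda>a. la a + pcontent n Z a) x)"
    by (simp add: sum_distrib_left ac_simps)
  finally show ?thesis using nz by simp
qed

section \<open>Tableaux and patterns\<close>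

definition ssvt :: "nat \<Rightarrow> (nat \<Rightarrow> nat) \<Rightarrow> (box \<Rightarrow> nat set) set" where
  "ssvt n mu = {T \<in> set_valued_tableaux (diagram mu) {1..n}. semistandard (diagram mu) T}"

definition tableau_of :: "(nat \<Rightarrow> nat) \<Rightarrow> pattern \<Rightarrow> box \<Rightarrow> nat set" where
  "tableau_of mu Z = restrict (\<lambda>(r, j). {Suc a | a. fst Z a r \<le> j \<and> j < fst Z (Suc a) r} \<union>
     {Suc a | a. snd Z a r \<and> fst Z a r = Suc j}) (diagram mu)"

definition pattern_of :: "(nat \<Rightarrow> nat) \<Rightarrow> (box \<Rightarrow> nat set) \<Rightarrow> pattern" where
  "pattern_of mu T = (\<lambda>a r. card {j. j < mu r \<and> Min (T (r, j)) \<le> a},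
     \<lambda>a r. \<exists>j<mu r. Suc a \<in> T (r, j) \<and> Min (T (r, j)) \<le> a)"

lemma ssvt_box:
  assumes "T \<in> ssvt n mu" "j < mu r"
  shows "T (r, j) \<noteq> {}" "finite (T (r, j))" "T (r, j) \<subseteq> {1..n}"
  using assms by (auto simp: ssvt_def set_valued_tableaux_def PiE_iff diagram_def)


lemma ssvt_row:
  assumes T: "T \<in> ssvt n mu" and "Suc j \<le> j'" "j' < mu r" "a \<in> T (r, j)" "b \<in> T (r, j')"
  shows "a \<le> b"
  using assms(2,3,5)
proof (induction j' arbitrary: b rule: dec_induct)
  case base
  have "Max (T (r, j)) \<le> Min (T (r, Suc j))"
    using T base by (auto simp: ssvt_def semistandard_def diagram_def)
  then show ?case
    using Max_ge[OF ssvt_box(2)[OF T, of j r] assms(4)] Min_le[OF ssvt_box(2)[OF T, of "Suc j" r] base(2)] base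
    by auto
next
  case (step k)
  have k: "k < mu r" using step by simp
  obtain c where c: "c \<in> T (r, k)" using ssvt_box(1)[OF T k] by blast
  have "Max (T (r, k)) \<le> Min (T (r, Suc k))"
    using T step by (auto simp: ssvt_def semistandard_def diagram_def)
  then have "c \<le> b"
    using Max_ge[OF ssvt_box(2)[OF T k] c] Min_le[OF ssvt_box(2)[OF T, of "Suc k" r] step.prems(2)] step
    by auto
  with step.IH[OF k c] show ?case by simp
qed

lemma ssvt_column:
  assumes T: "T \<in> ssvt n mu" and "antimono mu" "j < mu (Suc r)" "a \<in> T (r, j)" "b \<in> T (Suc r, j)"
  shows "a < b"
proof -
  have j: "j < mu r" using assms(3) antimonoD[OF assms(2), of r "Suc r"] by simp
  have "Max (T (r, j)) < Min (T (Suc r, j))"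
    using T assms(3) j by (auto simp: ssvt_def semistandard_def diagram_def)
  then show ?thesis
    using Max_ge[OF ssvt_box(2)[OF T j] assms(4)] Min_le[OF ssvt_box(2)[OF T assms(3)] assms(5)] by simp
qed

lemma Min_ssvt_le_iff:
  assumes "T \<in> ssvt n mu" "j < mu r"
  shows "Min (T (r, j)) \<le> a \<longleftrightarrow> (\<exists>b\<in>T (r, j). b \<le> a)"
  using ssvt_box[OF assms] by (simp add: Min_le_iff)

text \<open>Minima increase along a row, so the boxes counted by \<open>pattern_of\<close> form an
  initial segment and their number is its length.\<close>

lemma pattern_of_shape:
  assumes T: "T \<in> ssvt n mu" and j: "j < mu r"
  shows "j < fst (pattern_of mu T) a r \<longleftrightarrow> (\<exists>b\<in>T (r, j). b \<le> a)"
proof -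
  let ?S = "{j. j < mu r \<and> Min (T (r, j)) \<le> a}"
  have fin: "finite ?S" by simp
  have down: "i \<in> ?S" if "k \<in> ?S" "i \<le> k" for i k
  proof (cases "i = k")
    case False
    from that obtain b where b: "b \<in> T (r, k)" "b \<le> a" using Min_ssvt_le_iff[OF T] by auto
    from that obtain c where "c \<in> T (r, i)" using ssvt_box(1)[OF T, of i r] by auto
    moreover from this have "c \<le> b" using ssvt_row[OF T, of i k r c b] False that b by auto
    ultimately show ?thesis using that b Min_ssvt_le_iff[OF T, of i r a] by (auto intro: le_trans)
  qed (use that in simp)
  have "j < card ?S \<longleftrightarrow> j \<in> ?S"
  proof
    assume "j \<in> ?S"
    then have "{..j} \<subseteq> ?S" using down by blast
    from card_mono[OF fin this] show "j < card ?S" by simp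
  next
    assume "j < card ?S"
    show "j \<in> ?S"
    proof (rule ccontr)
      assume "j \<notin> ?S"
      have "?S \<subseteq> {..<j}"
      proof
        fix i assume "i \<in> ?S"
        then have "\<not> j \<le> i" using down[of i j] \<open>j \<notin> ?S\<close> by blast
        then show "i \<in> {..<j}" by simp
      qed
      from card_mono[OF _ this] show False using \<open>j < card ?S\<close> by simp
    qed
  qed
  then show ?thesis using j Min_ssvt_le_iff[OF T j] by (simp add: pattern_of_def)
qed

lemma pattern_of_le: "fst (pattern_of mu T) a r \<le> mu r"
proof -
  have "card {j. j < mu r \<and> Min (T (r, j)) \<le> a} \<le> card {..<mu r}"
    by (rule card_mono) auto
  then show ?thesis by (simp add: pattern_of_def)
qed

text \<open>The box after one that holds \<open>a + 1\<close> has minimum at least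
  \<open>a + 1\<close>, so an extra \<open>a + 1\<close> can stand only in the last box of
  \<open>P a\<close>; one bit per row suffices.\<close>

lemma pattern_of_extra:
  assumes T: "T \<in> ssvt n mu"
  shows "snd (pattern_of mu T) a r \<longleftrightarrow>
    (\<exists>j. fst (pattern_of mu T) a r = Suc j \<and> j < mu r \<and> Suc a \<in> T (r, j))"
proof
  assume "snd (pattern_of mu T) a r"
  then obtain j where j: "j < mu r" "Suc a \<in> T (r, j)" "Min (T (r, j)) \<le> a"
    unfolding pattern_of_def snd_conv by blast
  then have less: "j < fst (pattern_of mu T) a r"
    using pattern_of_shape[OF T j(1), of a] Min_ssvt_le_iff[OF T j(1), of a] by simp
  have "\<not> Suc j < fst (pattern_of mu T) a r"
  proof
    assume l: "Suc j < fst (pattern_of mu T) a r"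
    then have s: "Suc j < mu r" using pattern_of_le[of mu T a r] by simp
    then obtain b where "b \<in> T (r, Suc j)" "b \<le> a"
      using pattern_of_shape[OF T s, of a] l by auto
    then show False using ssvt_row[OF T _ s j(2)] by force
  qed
  with less j show "\<exists>j. fst (pattern_of mu T) a r = Suc j \<and> j < mu r \<and> Suc a \<in> T (r, j)"
    by (intro exI[of _ j]) auto
next
  assume "\<exists>j. fst (pattern_of mu T) a r = Suc j \<and> j < mu r \<and> Suc a \<in> T (r, j)"
  then obtain j where j: "fst (pattern_of mu T) a r = Suc j" "j < mu r" "Suc a \<in> T (r, j)" by blast
  then show "snd (pattern_of mu T) a r"
    using pattern_of_shape[OF T j(2), of a] Min_ssvt_le_iff[OF T j(2), of a] by (auto simp: pattern_of_def)
qed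

lemma pattern_of_in_patterns:
  assumes T: "T \<in> ssvt n mu" and mu: "antimono mu"
  shows "pattern_of mu T \<in> patterns n mu"
proof -
  obtain P E where PE: "pattern_of mu T = (P, E)" by force
  have sh: "j < P a r \<longleftrightarrow> (\<exists>b\<in>T (r, j). b \<le> a)" if "j < mu r" for j r a
    using pattern_of_shape[OF T that, of a] by (simp add: PE)
  have le: "P a r \<le> mu r" for a r
    using pattern_of_le[of mu T a r] by (simp add: PE)
  have ex: "E a r \<longleftrightarrow> (\<exists>j. P a r = Suc j \<and> j < mu r \<and> Suc a \<in> T (r, j))" for a r
    using pattern_of_extra[OF T, of a r] by (simp add: PE)
  have le': "A \<le> P a r" if "\<And>j. j < A \<Longrightarrow> j < mu r \<and> (\<exists>b\<in>T (r, j). b \<le> a)" for A a r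
    by (metis that sh less_irrefl not_le)
  have "P 0 r = 0" for r
  proof (rule ccontr)
    assume "P 0 r \<noteq> 0"
    then have "0 < mu r" "0 < P 0 r" using le[of 0 r] by auto
    then obtain b where "b \<in> T (r, 0)" "b \<le> 0" using sh by auto
    then show False using ssvt_box(3)[OF T \<open>0 < mu r\<close>] by auto
  qed
  moreover have "P a = mu" if "n \<le> a" for a
  proof
    fix r
    have "mu r \<le> P a r"
    proof (rule le')
      fix j assume j: "j < mu r"
      then obtain b where "b \<in> T (r, j)" using ssvt_box(1)[OF T j] by blast
      then show "j < mu r \<and> (\<exists>b\<in>T (r, j). b \<le> a)"
        using ssvt_box(3)[OF T j] that j by (force intro!: bexI[of _ b])
    qed
    then show "P a r = mu r" using le[of a r] by simp
  qed
  moreover have col: "j < mu r \<and> (\<exists>b\<in>T (r, j). b < c)" if "j < mu (Suc r)" "c \<in> T (Suc r, j)" for j r c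
  proof -
    have "j < mu r" using that(1) antimonoD[OF mu, of r "Suc r"] by simp
    then show ?thesis using ssvt_box(1)[OF T] ssvt_column[OF T mu that(1) _ that(2)] by blast
  qed
  moreover have "P (Suc a) (Suc r) \<le> P a r" for a r
  proof (rule le')
    fix j assume j: "j < P (Suc a) (Suc r)"
    then have m: "j < mu (Suc r)" using le[of "Suc a" "Suc r"] by simp
    then obtain c where "c \<in> T (Suc r, j)" "c \<le> Suc a" using j sh[OF m] by auto
    with col[OF m] show "j < mu r \<and> (\<exists>b\<in>T (r, j). b \<le> a)"
      by (meson less_Suc_eq_le less_le_trans)
  qed
  moreover have "P a r \<le> P (Suc a) r" for a r
    by (rule le') (use sh le in \<open>meson le_SucI less_le_trans\<close>)
  moreover have "a < n \<and> P (Suc a) (Suc r) < P a r" if "E a r" for a r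
  proof -
    from that obtain j where j: "P a r = Suc j" "j < mu r" "Suc a \<in> T (r, j)" unfolding ex by blast
    \<comment> \<open>Below a box containing \<open>a + 1\<close> every letter exceeds
      \<open>a + 1\<close>.\<close>
    have "\<not> j < P (Suc a) (Suc r)"
    proof
      assume l: "j < P (Suc a) (Suc r)"
      then have m: "j < mu (Suc r)" using le[of "Suc a" "Suc r"] by simp
      then obtain c where "c \<in> T (Suc r, j)" "c \<le> Suc a" using l sh[OF m] by auto
      then show False using ssvt_column[OF T mu m j(3)] by force
    qed
    then show ?thesis using j ssvt_box(3)[OF T j(2)] by auto
  qed
  ultimately show ?thesis
    by (auto simp: patterns_def PE)
qed

lemma tableau_of_eq:
  "j < mu r \<Longrightarrow> tableau_of mu (P, E) (r, j) =
     {Suc a | a. P a r \<le> j \<and> j < P (Suc a) r} \<union> {Suc a | a. E a r \<and> P a r = Suc j}"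
  by (simp add: tableau_of_def diagram_def)

lemma mem_tableau_of:
  assumes "j < mu r"
  shows "b \<in> tableau_of mu (P, E) (r, j) \<longleftrightarrow>
     (\<exists>a. b = Suc a \<and> (P a r \<le> j \<and> j < P (Suc a) r \<or> E a r \<and> P a r = Suc j))"
  unfolding tableau_of_eq[where mu = mu and r = r and j = j, OF assms] by blast

text \<open>The least \<open>b\<close> with \<open>j < P b r\<close> is the minimum of the box; the
  extra letters are larger and do not affect the test.\<close>

lemma tableau_of_shape:
  assumes Z: "(P, E) \<in> patterns n mu" and j: "j < mu r"
  shows "(\<exists>b\<in>tableau_of mu (P, E) (r, j). b \<le> a) \<longleftrightarrow> j < P a r"
proof
  assume "\<exists>b\<in>tableau_of mu (P, E) (r, j). b \<le> a"
  then obtain c where c: "Suc c \<le> a" "P c r \<le> j \<and> j < P (Suc c) r \<or> E c r \<and> P c r = Suc j"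
    unfolding bex_simps mem_tableau_of[where mu = mu and r = r and j = j, OF j] Bex_def by blast
  then show "j < P a r"
    using pattern_mono[OF Z, of "Suc c" a r] pattern_mono[OF Z, of "c" a r] by auto
next
  assume l: "j < P a r"
  define b where "b = (LEAST b. j < P b r)"
  have b: "j < P b r" "b \<le> a" using l unfolding b_def by (auto intro: LeastI Least_le)
  then have "b \<noteq> 0" using patternsD(1)[OF Z, of r] by (metis not_less_zero)
  then obtain c where c: "b = Suc c" by (cases b) auto
  then have "P c r \<le> j" using not_less_Least[of c "\<lambda>b. j < P b r"] by (simp add: b_def[symmetric])
  then have "b \<in> tableau_of mu (P, E) (r, j)" using b j c by (auto simp: mem_tableau_of)
  with b show "\<exists>b\<in>tableau_of mu (P, E) (r, j). b \<le> a" by blast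
qed

lemma tableau_of_in_ssvt:
  assumes Z: "(P, E) \<in> patterns n mu" and mu: "antimono mu"
  shows "tableau_of mu (P, E) \<in> ssvt n mu"
proof -
  let ?T = "tableau_of mu (P, E)"
  note pd = patternsD[OF Z]
  have sub: "?T (r, j) \<subseteq> {1..n}" if "j < mu r" for r j
  proof
    fix b assume "b \<in> ?T (r, j)"
    with that obtain a where a: "b = Suc a" "P a r \<le> j \<and> j < P (Suc a) r \<or> E a r \<and> P a r = Suc j"
      by (auto simp: mem_tableau_of)
    then show "b \<in> {1..n}"
      using pd(2)[of a] pd(2)[of "Suc a"] pd(5)[of a r] by (cases "a < n") auto
  qed
  have ne: "?T (r, j) \<noteq> {}" if "j < mu r" for r j
    using tableau_of_shape[OF Z that, of n] that pd(2)[of n] by auto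
  have fin: "finite (?T (r, j))" if "j < mu r" for r j
    using sub[OF that] finite_subset by blast
  have "?T \<in> set_valued_tableaux (diagram mu) {1..n}"
    using sub ne fin unfolding set_valued_tableaux_def tableau_of_def
    by (auto simp: diagram_def PiE_iff)
  moreover have row: "a \<le> b" if "a \<in> ?T (r, j)" "b \<in> ?T (r, Suc j)" "Suc j < mu r" for a b r j
  proof -
    from that obtain c where c: "a = Suc c" "P c r \<le> j \<and> j < P (Suc c) r \<or> E c r \<and> P c r = Suc j"
      by (auto simp: mem_tableau_of)
    from that obtain d where d: "b = Suc d" "P d r \<le> Suc j \<and> Suc j < P (Suc d) r \<or> E d r \<and> P d r = Suc (Suc j)"
      by (auto simp: mem_tableau_of)
    show ?thesis
    proof (rule ccontr)
      assume "\<not> a \<le> b"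
      then have "Suc d \<le> c" using c d by simp
      then show False
        using pattern_mono[OF Z, of "Suc d" c r] pattern_mono[OF Z, of d c r] c(2) d(2) by auto
    qed
  qed
  moreover have col: "a < b" if "a \<in> ?T (r, j)" "b \<in> ?T (Suc r, j)" "j < mu r" "j < mu (Suc r)" for a b r j
  proof -
    from that obtain c where c: "a = Suc c" "P c r \<le> j \<and> j < P (Suc c) r \<or> E c r \<and> P c r = Suc j"
      by (auto simp: mem_tableau_of)
    from that obtain d where d: "b = Suc d" "P d (Suc r) \<le> j \<and> j < P (Suc d) (Suc r) \<or> E d (Suc r) \<and> P d (Suc r) = Suc j"
      by (auto simp: mem_tableau_of)
    show ?thesis
    proof (rule ccontr)
      assume "\<not> a < b"
      then have "d \<le> c" using c d by simp
      moreover have "j < P (Suc d) (Suc r)"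
        using d(2) pd(4)[of d "Suc r"] by auto
      ultimately have "j < P (Suc c) (Suc r)"
        using pattern_mono[OF Z, of "Suc d" "Suc c" "Suc r"] by simp
      then show False using c(2) pd(3)[of c r] pd(6)[of c r] by auto
    qed
  qed
  moreover have "semistandard (diagram mu) ?T"
    unfolding semistandard_def diagram_def using row col fin ne
    by (auto simp: Max_le_iff Max_less_iff Min_gr_iff)
  ultimately show ?thesis by (simp add: ssvt_def)
qed

lemma pattern_of_tableau_of:
  assumes Z: "Z \<in> patterns n mu" and mu: "antimono mu"
  shows "pattern_of mu (tableau_of mu Z) = Z"
proof -
  obtain P E where PE: "Z = (P, E)" by force
  note Z' = Z[unfolded PE]
  obtain P' E' where PE': "pattern_of mu (tableau_of mu (P, E)) = (P', E')" by force
  note T = tableau_of_in_ssvt[OF Z' mu]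
  have sh: "j < P' a r \<longleftrightarrow> j < P a r" if "j < mu r" for j a r
    using pattern_of_shape[OF T that, of a] tableau_of_shape[OF Z' that, of a] by (simp add: PE')
  have P: "P' a r = P a r" for a r
    using pattern_of_le[of mu "tableau_of mu (P, E)" a r] pattern_le_shape[OF Z', of a r] sh[of "P a r" r a] sh[of "P' a r" r a]
    by (fastforce simp: PE')
  have "E' a r = E a r" for a r
  proof -
    have "E' a r \<longleftrightarrow> (\<exists>j. P a r = Suc j \<and> j < mu r \<and> Suc a \<in> tableau_of mu (P, E) (r, j))"
      using pattern_of_extra[OF T, of a r] by (simp add: PE' P)
    also have "\<dots> \<longleftrightarrow> (\<exists>j. P a r = Suc j \<and> j < mu r \<and> E a r)"
      by (rule ex_cong1) (auto simp: mem_tableau_of)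
    also have "\<dots> \<longleftrightarrow> E a r"
    proof
      assume "E a r"
      then have "P a r \<noteq> 0" using patternsD(6)[OF Z', of a r] by simp
      then obtain j where "P a r = Suc j" by (cases "P a r") auto
      then show "\<exists>j. P a r = Suc j \<and> j < mu r \<and> E a r"
        using pattern_le_shape[OF Z', of a r] \<open>E a r\<close> by auto
    qed auto
    finally show ?thesis .
  qed
  with P show ?thesis by (simp add: PE PE' fun_eq_iff)
qed

lemma tableau_of_pattern_of:
  assumes T: "T \<in> ssvt n mu" and mu: "antimono mu"
  shows "tableau_of mu (pattern_of mu T) = T"
proof
  fix b :: box
  obtain r j where b: "b = (r, j)" by force
  obtain P E where PE: "pattern_of mu T = (P, E)" by force
  show "tableau_of mu (pattern_of mu T) b = T b"
  proof (cases "j < mu r")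
    case True
    have sh: "j < P a r \<longleftrightarrow> (\<exists>b\<in>T (r, j). b \<le> a)" for a
      using pattern_of_shape[OF T True, of a] by (simp add: PE)
    have ex: "E a r \<longleftrightarrow> (\<exists>j. P a r = Suc j \<and> j < mu r \<and> Suc a \<in> T (r, j))" for a
      using pattern_of_extra[OF T, of a r] by (simp add: PE)
    have "c \<in> tableau_of mu (P, E) (r, j) \<longleftrightarrow> c \<in> T (r, j)" for c
    proof
      assume "c \<in> tableau_of mu (P, E) (r, j)"
      then obtain a where a: "c = Suc a" "P a r \<le> j \<and> j < P (Suc a) r \<or> E a r \<and> P a r = Suc j"
        using True by (auto simp: mem_tableau_of)
      from a(2) show "c \<in> T (r, j)"
      proof
        assume "P a r \<le> j \<and> j < P (Suc a) r"
        then obtain d where "d \<in> T (r, j)" "d \<le> Suc a" "\<not> d \<le> a"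
          using sh[of a] sh[of "Suc a"] by (meson not_le)
        then show ?thesis using a(1) le_antisym not_less_eq_eq by metis
      next
        assume "E a r \<and> P a r = Suc j"
        then show ?thesis using ex[of a] a(1) by auto
      qed
    next
      assume c: "c \<in> T (r, j)"
      then obtain a where a: "c = Suc a" using ssvt_box(3)[OF T True] by (cases c) auto
      show "c \<in> tableau_of mu (P, E) (r, j)"
      proof (cases "j < P a r")
        case False
        moreover have "j < P (Suc a) r" using sh[of "Suc a"] c a by blast
        ultimately show ?thesis using True a by (auto simp: mem_tableau_of)
      next
        case less: True
        have "\<not> Suc j < P a r"
        proof
          assume l: "Suc j < P a r"
          then have s: "Suc j < mu r" using pattern_of_le[of mu T a r] by (simp add: PE)
          then obtain b where "b \<in> T (r, Suc j)" "b \<le> a"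
            using pattern_of_shape[OF T s, of a] l by (auto simp: PE)
          then show False using ssvt_row[OF T _ s c] a by force
        qed
        then have "P a r = Suc j" using less by simp
        then show ?thesis using True a c ex[of a] by (auto simp: mem_tableau_of)
      qed
    qed
    then show ?thesis by (auto simp: PE b)
  next
    case False
    then show ?thesis
      using T by (auto simp: b ssvt_def set_valued_tableaux_def tableau_of_def diagram_def PiE_iff extensional_def)
  qed
qed

lemma bij_pattern_of:
  assumes "antimono mu"
  shows "bij_betw (pattern_of mu) (ssvt n mu) (patterns n mu)"
  by (rule bij_betw_byWitness[where f' = "tableau_of mu"])
    (use assms pattern_of_tableau_of tableau_of_pattern_of pattern_of_in_patterns tableau_of_in_ssvt in auto)

lemma pcount_pattern_of:
  assumes T: "T \<in> ssvt n mu" and mu: "antimono mu"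
  shows "pcount (pattern_of mu T) a r = card {j. j < mu r \<and> Suc a \<in> T (r, j)}"
proof -
  obtain P E where PE: "pattern_of mu T = (P, E)" by force
  have Z: "(P, E) \<in> patterns n mu" using pattern_of_in_patterns[OF T mu] by (simp add: PE)
  have T_eq: "T = tableau_of mu (P, E)" using tableau_of_pattern_of[OF T mu] by (simp add: PE)
  \<comment> \<open>The extra occurrence sits in the last column of \<open>P a\<close>; the
    predecessor is genuine because \<open>E a r\<close> implies \<open>0 < P a r\<close>.\<close>
  have "{j. j < mu r \<and> Suc a \<in> T (r, j)} = {P a r..<P (Suc a) r} \<union> (if E a r then {P a r - 1} else {})"
    (is "?A = ?B")
  proof (intro equalityI subsetI)
    fix j assume "j \<in> ?A"
    then show "j \<in> ?B" unfolding T_eq by (auto simp: mem_tableau_of)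
  next
    fix j assume j: "j \<in> ?B"
    then have "P a r \<le> j \<and> j < P (Suc a) r \<or> E a r \<and> P a r = Suc j"
      using patternsD(6)[OF Z, of a r] by (auto split: if_splits)
    moreover from this have "j < mu r"
      using pattern_le_shape[OF Z, of a r] pattern_le_shape[OF Z, of "Suc a" r] by auto
    ultimately show "j \<in> ?A" unfolding T_eq by (auto simp: mem_tableau_of)
  qed
  also have "card \<dots> = card {P a r..<P (Suc a) r} + card (if E a r then {P a r - 1} else {})"
    by (rule card_Un_disjoint) (use patternsD(6)[OF Z, of a r] in auto)
  finally show ?thesis by (simp add: pcount_def PE)
qed

section \<open>Evaluation of series\<close>

text \<open>The excess of entries over boxes, which is the sign exponent in the Grothendieck
  polynomial.\<close>

definition pextra :: "nat \<Rightarrow> pattern \<Rightarrow> nat" where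
  "pextra n Z = (\<Sum>a<n. \<Sum>r<n. of_bool (snd Z a r))"

lemma psign_eq: "psign n Z = (- 1) ^ pextra n Z"
  unfolding psign_def pextra_def power_sum by (intro prod.cong refl) auto

lemma sum_pcontent:
  assumes "Z \<in> patterns n mu"
  shows "(\<Sum>a<n. pcontent n Z a) = (\<Sum>r<n. mu r) + pextra n Z"
proof -
  obtain P E where Z: "Z = (P, E)" by force
  note PE = assms[unfolded Z]
  have tel: "(\<Sum>a<m. P (Suc a) r - P a r) = P m r" for m r
    using patternsD(1,4)[OF PE] by (induction m) auto
  have "(\<Sum>a<n. pcontent n Z a) = (\<Sum>a<n. \<Sum>r<n. P (Suc a) r - P a r) + pextra n Z"
    by (simp add: pcontent_def pcount_def pextra_def Z sum.distrib)
  also have "(\<Sum>a<n. \<Sum>r<n. P (Suc a) r - P a r) = (\<Sum>r<n. \<Sum>a<n. P (Suc a) r - P a r)"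
    by (rule sum.swap)
  also have "\<dots> = (\<Sum>r<n. P n r)" by (simp only: tel)
  also have "\<dots> = (\<Sum>r<n. mu r)" using patternsD(2)[OF PE, of n] by simp
  finally show ?thesis .
qed

lemma psize_eq:
  assumes "\<And>r. n \<le> r \<Longrightarrow> mu r = 0"
  shows "psize mu = (\<Sum>r<n. mu r)"
proof -
  have "i < n" if "mu i \<noteq> 0" for i using assms[of i] that by (cases "i < n") auto
  then show ?thesis
    unfolding psize_def by (intro sum.mono_neutral_left) auto
qed

definition pmonomial :: "nat \<Rightarrow> pattern \<Rightarrow> nat multiset" where
  "pmonomial n Z = (\<Sum>a<n. replicate_mset (pcontent n Z a) (Suc a))"

lemma count_pmonomial:
  "count (pmonomial n Z) b = (if b \<in> {1..n} then pcontent n Z (b - 1) else 0)"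
proof -
  have "count (pmonomial n Z) b = (\<Sum>a<n. if Suc a = b then pcontent n Z a else 0)"
    by (auto simp: pmonomial_def count_sum intro!: sum.cong)
  also have "\<dots> = (\<Sum>a<n. if a = b - 1 \<and> b \<noteq> 0 then pcontent n Z a else 0)"
    by (intro sum.cong) auto
  also have "\<dots> = (if b \<in> {1..n} then pcontent n Z (b - 1) else 0)"
    by (cases "b = 0") (auto simp: sum.delta)
  finally show ?thesis .
qed

lemma set_pmonomial: "set_mset (pmonomial n Z) \<subseteq> {1..n}"
  using count_pmonomial[of n Z] by (metis count_eq_zero_iff subsetI)

lemma size_pmonomial: "size (pmonomial n Z) = (\<Sum>a<n. pcontent n Z a)"
  by (simp add: pmonomial_def size_multiset_sum)

lemma diagram_Sigma_lessThan:
  assumes "\<And>r. n \<le> r \<Longrightarrow> mu r = 0"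
  shows "diagram mu = Sigma {..<n} (\<lambda>r. {..<mu r})"
  using assms by (force simp: diagram_def not_less[symmetric])

lemma ssvt_rows:
  assumes "T \<in> ssvt n mu" "antimono mu" "n \<le> r"
  shows "mu r = 0"
  using pattern_of_in_patterns[OF assms(1,2)] assms(3)
    pattern_rows(3)[of "fst (pattern_of mu T)" "snd (pattern_of mu T)" n mu r] by simp

lemma tableau_monomial_eq:
  assumes T: "T \<in> ssvt n mu" and mu: "antimono mu"
  shows "tableau_monomial (diagram mu) T = pmonomial n (pattern_of mu T)"
proof (rule multiset_eqI)
  fix b
  have D: "diagram mu = Sigma {..<n} (\<lambda>r. {..<mu r})"
    by (rule diagram_Sigma_lessThan) (rule ssvt_rows[OF T mu])
  have box: "finite (T d)" "T d \<subseteq> {1..n}" if "d \<in> diagram mu" for d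
    using ssvt_box(2,3)[OF T, of "snd d" "fst d"] that by (simp_all add: diagram_def case_prod_unfold)
  have "count (tableau_monomial (diagram mu) T) b = (\<Sum>d\<in>diagram mu. if b \<in> T d then 1 else 0)"
    unfolding tableau_monomial_def count_sum
    by (intro sum.cong refl) (use box in \<open>auto simp: count_mset_set'\<close>)
  also have "\<dots> = (\<Sum>r<n. card {j. j < mu r \<and> b \<in> T (r, j)})"
  proof -
    have "(\<Sum>d\<in>diagram mu. if b \<in> T d then 1 else 0) = (\<Sum>r<n. \<Sum>j<mu r. if b \<in> T (r, j) then 1 else 0)"
      unfolding D by (simp add: sum.Sigma case_prod_unfold)
    also have "\<dots> = (\<Sum>r<n. card {j. j < mu r \<and> b \<in> T (r, j)})"
      by (intro sum.cong refl) (simp add: sum.If_cases lessThan_def Int_def)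
    finally show ?thesis .
  qed
  also have "\<dots> = count (pmonomial n (pattern_of mu T)) b"
  proof (cases "b \<in> {1..n}")
    case True
    then have "b = Suc (b - 1)" by simp
    then have "card {j. j < mu r \<and> b \<in> T (r, j)} = pcount (pattern_of mu T) (b - 1) r" for r
      using pcount_pattern_of[OF T mu, of "b - 1" r] by simp
    then show ?thesis using True by (simp add: count_pmonomial pcontent_def)
  next
    case False
    then have "{j. j < mu r \<and> b \<in> T (r, j)} = {}" for r
      using ssvt_box(3)[OF T, of _ r] by blast
    then show ?thesis using False by (simp only: count_pmonomial if_False) simp
  qed
  finally show "count (tableau_monomial (diagram mu) T) b = count (pmonomial n (pattern_of mu T)) b" .
qed

lemma tableau_sign_eq:
  assumes T: "T \<in> ssvt n mu" and mu: "antimono mu"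
  shows "(- 1) ^ (tableau_size (diagram mu) T - psize mu) = psign n (pattern_of mu T)"
proof -
  have "tableau_size (diagram mu) T = size (tableau_monomial (diagram mu) T)"
    by (simp add: tableau_size_def tableau_monomial_def size_multiset_sum)
  also have "\<dots> = psize mu + pextra n (pattern_of mu T)"
    using sum_pcontent[OF pattern_of_in_patterns[OF T mu]] psize_eq[of n mu] ssvt_rows[OF T mu]
    by (simp add: tableau_monomial_eq[OF T mu] size_pmonomial)
  finally show ?thesis by (simp add: psign_eq)
qed

text \<open>Every letter of a tableau occurs in its monomial, so a monomial in the letters up to
  \<open>n\<close> admits only the finite alphabet.\<close>

lemma groth_tableaux_eq:
  assumes "set_mset M \<subseteq> {1..n}" "finite (diagram mu)"
  shows "groth_tableaux mu M = {T \<in> ssvt n mu. tableau_monomial (diagram mu) T = M}"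
proof -
  have "T b \<subseteq> {1..n}" if T: "T \<in> groth_tableaux mu M" and b: "b \<in> diagram mu" for T b
  proof -
    have fin: "finite (T b)" and M: "M = (\<Sum>b\<in>diagram mu. mset_set (T b))"
      using T b by (auto simp: groth_tableaux_def tableau_monomial_def set_valued_tableaux_def PiE_iff)
    have "set_mset (mset_set (T b)) \<subseteq> set_mset M"
      unfolding M set_mset_sum[OF assms(2)] using b by blast
    then show ?thesis using assms(1) fin by simp
  qed
  then have "T \<in> set_valued_tableaux (diagram mu) {1..n}" if "T \<in> groth_tableaux mu M" for T
    using that by (auto simp: groth_tableaux_def set_valued_tableaux_def PiE_iff)
  moreover have "set_valued_tableaux (diagram mu) {1..n} \<subseteq> set_valued_tableaux (diagram mu) {1..}"
    unfolding set_valued_tableaux_def by (rule PiE_mono) auto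
  ultimately show ?thesis
    unfolding ssvt_def groth_tableaux_def by blast
qed

lemma groth_eq:
  assumes "set_mset M \<subseteq> {1..n}" "mu \<in> partitions"
  shows "groth mu M = (\<Sum>Z | Z \<in> patterns n mu \<and> pmonomial n Z = M. psign n Z)"
proof -
  have mu: "antimono mu" and fin: "finite (diagram mu)"
    using assms(2) by (auto simp: partitions_def diagram_Sigma)
  have "groth mu M = (\<Sum>T | T \<in> ssvt n mu \<and> pmonomial n (pattern_of mu T) = M. psign n (pattern_of mu T))"
    unfolding groth_def groth_tableaux_eq[OF assms(1) fin]
    by (intro sum.cong) (auto simp: tableau_sign_eq tableau_monomial_eq mu)
  also have "\<dots> = (\<Sum>Z | Z \<in> patterns n mu \<and> pmonomial n Z = M. psign n Z)"
  proof (rule sum.reindex_bij_betw)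
    show "bij_betw (pattern_of mu) {T \<in> ssvt n mu. pmonomial n (pattern_of mu T) = M}
        {Z \<in> patterns n mu. pmonomial n Z = M}"
      by (rule bij_betw_Collect[OF bij_pattern_of[OF mu]]) simp
  qed
  finally show ?thesis .
qed

section \<open>Specialization of series in finitely many variables\<close>

definition eval_monomial :: "(nat \<Rightarrow> 'a) \<Rightarrow> nat multiset \<Rightarrow> 'a::comm_ring_1" where
  "eval_monomial x M = (\<Prod>a\<in>#M. x (a - 1))"

lemma eval_monomial_add: "eval_monomial x (A + B) = eval_monomial x A * eval_monomial x B"
  by (simp add: eval_monomial_def)

lemma eval_monomial_eq:
  assumes "set_mset M \<subseteq> {1..n}"
  shows "eval_monomial x M = (\<Prod>a<n. x a ^ count M (Suc a))"
proof -
  have "eval_monomial x M = (\<Prod>b\<in>set_mset M. x (b - 1) ^ count M b)"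
    unfolding eval_monomial_def by (rule image_prod_mset_multiplicity)
  also have "\<dots> = (\<Prod>b\<in>{1..n}. x (b - 1) ^ count M b)"
    by (rule prod.mono_neutral_left) (use assms in \<open>auto simp: not_in_iff\<close>)
  also have "\<dots> = (\<Prod>a<n. x a ^ count M (Suc a))"
    by (rule prod.reindex_bij_witness[of _ Suc "\<lambda>b. b - 1"]) auto
  finally show ?thesis .
qed

definition letter_support :: "nat \<Rightarrow> series \<Rightarrow> nat multiset set" where
  "letter_support n f = {M. set_mset M \<subseteq> {1..n} \<and> f M \<noteq> 0}"

text \<open>Variables beyond \<open>n\<close> are set to 0. A sum over an infinite set would
  silently be 0, hence the evaluation of each construction comes with finiteness of its
  support.\<close>

definition eval_series :: "nat \<Rightarrow> series \<Rightarrow> (nat \<Rightarrow> 'a) \<Rightarrow> 'a::comm_ring_1" where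
  "eval_series n f x = (\<Sum>M\<in>letter_support n f. of_int (f M) * eval_monomial x M)"

lemma eval_series_superset:
  assumes "finite S" "letter_support n f \<subseteq> S" "\<And>M. M \<in> S \<Longrightarrow> set_mset M \<subseteq> {1..n}"
  shows "eval_series n f x = (\<Sum>M\<in>S. of_int (f M) * eval_monomial x M)"
  unfolding eval_series_def
  by (rule sum.mono_neutral_left) (use assms in \<open>auto simp: letter_support_def\<close>)

text \<open>Serves both the tableau sums and the product of two series: in each case a coefficient
  collects the members of a finite weighted family with a given monomial.\<close>

lemma eval_series_reindex:
  fixes x :: "nat \<Rightarrow> 'a::comm_ring_1"
  assumes fin: "finite I" and mono: "\<And>z. z \<in> I \<Longrightarrow> set_mset (m z) \<subseteq> {1..n}"
    and f: "\<And>M. set_mset M \<subseteq> {1..n} \<Longrightarrow> f M = (\<Sum>z | z \<in> I \<and> m z = M. c z)"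
  shows "finite (letter_support n f)"
    "eval_series n f x = (\<Sum>z\<in>I. of_int (c z) * eval_monomial x (m z))"
proof -
  have sub: "letter_support n f \<subseteq> m ` I"
  proof
    fix M assume "M \<in> letter_support n f"
    then have M: "set_mset M \<subseteq> {1..n}" "f M \<noteq> 0" by (auto simp: letter_support_def)
    then have "(\<Sum>z | z \<in> I \<and> m z = M. c z) \<noteq> 0" using f by simp
    then obtain z where "z \<in> {z. z \<in> I \<and> m z = M}" by (rule sum.not_neutral_contains_not_neutral)
    then show "M \<in> m ` I" by blast
  qed
  then show "finite (letter_support n f)" using fin finite_subset by blast
  have "eval_series n f x = (\<Sum>M\<in>m ` I. of_int (f M) * eval_monomial x M)"
    by (rule eval_series_superset) (use fin sub mono in auto)
  also have "\<dots> = (\<Sum>M\<in>m ` I. \<Sum>z | z \<in> I \<and> m z = M. of_int (c z) * eval_monomial x (m z))"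
  proof (rule sum.cong[OF refl])
    fix M assume "M \<in> m ` I"
    then have "f M = (\<Sum>z | z \<in> I \<and> m z = M. c z)" using mono f by blast
    then have "of_int (f M) * eval_monomial x M = (\<Sum>z | z \<in> I \<and> m z = M. of_int (c z) * eval_monomial x M)"
      by (simp add: sum_distrib_right)
    also have "\<dots> = (\<Sum>z | z \<in> I \<and> m z = M. of_int (c z) * eval_monomial x (m z))"
      by (rule sum.cong) auto
    finally show "of_int (f M) * eval_monomial x M =
      (\<Sum>z | z \<in> I \<and> m z = M. of_int (c z) * eval_monomial x (m z))" .
  qed
  also have "\<dots> = (\<Sum>z\<in>I. of_int (c z) * eval_monomial x (m z))"
    by (rule sum.image_gen[OF fin, symmetric])
  finally show "eval_series n f x = (\<Sum>z\<in>I. of_int (c z) * eval_monomial x (m z))" .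
qed

lemma eval_groth:
  assumes "mu \<in> partitions"
  shows "finite (letter_support n (groth mu))" "eval_series n (groth mu) x = gsum n mu x"
proof -
  note * = eval_series_reindex[OF finite_patterns[of n mu] set_pmonomial groth_eq[OF _ assms]]
  show "finite (letter_support n (groth mu))" by (rule *(1))
  have m: "eval_monomial x (pmonomial n Z) = (\<Prod>a<n. x a ^ pcontent n Z a)" for Z
    by (subst eval_monomial_eq[OF set_pmonomial]) (auto simp: count_pmonomial intro!: prod.cong)
  have "eval_series n (groth mu) x = (\<Sum>Z\<in>patterns n mu. of_int (psign n Z) * eval_monomial x (pmonomial n Z))"
    by (rule *(2))
  then show "eval_series n (groth mu) x = gsum n mu x"
    by (simp add: gsum_def pweight_def m psign_eq)
qed

lemma eval_times:
  assumes f: "finite (letter_support n f)" and g: "finite (letter_support n g)"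
  shows "finite (letter_support n (series_times f g))"
    "eval_series n (series_times f g) x = eval_series n f x * eval_series n g x"
proof -
  let ?I = "letter_support n f \<times> letter_support n g"
  have fin: "finite ?I" using f g by simp
  have mono: "set_mset (fst z + snd z) \<subseteq> {1..n}" if "z \<in> ?I" for z
    using that by (auto simp: letter_support_def)
  have eq: "series_times f g M = (\<Sum>z | z \<in> ?I \<and> fst z + snd z = M. f (fst z) * g (snd z))"
    if "set_mset M \<subseteq> {1..n}" for M
    unfolding series_times_def case_prod_unfold
  proof (rule sum.mono_neutral_right)
    show "finite {z. fst z + snd z = M}" using finite_splittings[of M] by (simp add: case_prod_unfold)
    \<comment> \<open>Both parts of a splitting of \<open>M\<close> use letters of \<open>M\<close>,
      so a splitting outside the index set has a zero coefficient.\<close>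
    show "\<forall>z\<in>{z. fst z + snd z = M} - {z \<in> ?I. fst z + snd z = M}. f (fst z) * g (snd z) = 0"
      using that by (fastforce simp: letter_support_def)
  qed auto
  note * = eval_series_reindex[where m = "\<lambda>z. fst z + snd z" and c = "\<lambda>z. f (fst z) * g (snd z)", OF fin mono eq]
  show "finite (letter_support n (series_times f g))" by (rule *(1))
  have "eval_series n f x * eval_series n g x =
      (\<Sum>z\<in>?I. (of_int (f (fst z)) * eval_monomial x (fst z)) * (of_int (g (snd z)) * eval_monomial x (snd z)))"
    unfolding eval_series_def sum_product sum.cartesian_product by (simp add: case_prod_unfold)
  moreover have "eval_series n (series_times f g) x =
      (\<Sum>z\<in>?I. of_int (f (fst z) * g (snd z)) * eval_monomial x (fst z + snd z))"
    by (rule *(2))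
  ultimately show "eval_series n (series_times f g) x = eval_series n f x * eval_series n g x"
    by (simp add: eval_monomial_add ac_simps)
qed

lemma eval_minus:
  assumes f: "finite (letter_support n f)" and g: "finite (letter_support n g)"
  shows "finite (letter_support n (series_minus f g))"
    "eval_series n (series_minus f g) x = eval_series n f x - eval_series n g x"
proof -
  let ?S = "letter_support n f \<union> letter_support n g"
  have sub: "letter_support n (series_minus f g) \<subseteq> ?S"
    by (auto simp: letter_support_def series_minus_def)
  then show "finite (letter_support n (series_minus f g))" using f g finite_subset by blast
  have S: "finite ?S" "\<And>M. M \<in> ?S \<Longrightarrow> set_mset M \<subseteq> {1..n}"
    using f g by (auto simp: letter_support_def)
  show "eval_series n (series_minus f g) x = eval_series n f x - eval_series n g x"
    using eval_series_superset[OF S(1) sub S(2), where x = x] eval_series_superset[OF S(1) _ S(2), where f = f and x = x]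
      eval_series_superset[OF S(1) _ S(2), where f = g and x = x]
    by (simp add: series_minus_def sum_subtractf algebra_simps)
qed

lemma eval_one:
  "finite (letter_support n series_one)" "eval_series n series_one x = 1"
proof -
  have "letter_support n series_one = {{#}}"
    by (auto simp: letter_support_def series_one_def)
  then show "finite (letter_support n series_one)" "eval_series n series_one x = 1"
    by (simp_all add: eval_series_def series_one_def eval_monomial_def)
qed

lemma one_box_in_partitions: "one_box \<in> partitions"
  by (auto simp: one_box_def partitions_def antimono_def)

lemma eval_cal_groth:
  assumes "mu \<in> partitions"
  shows "finite (letter_support n (cal_groth mu))"
    "eval_series n (cal_groth mu) x = gsum n mu x * (1 - gsum n one_box x)"
  using eval_times[OF eval_groth(1)[OF assms] eval_minus(1)[OF eval_one(1) eval_groth(1)[OF one_box_in_partitions]]]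
  by (simp_all add: cal_groth_def eval_groth eval_minus eval_one assms one_box_in_partitions)

text \<open>Kronecker substitution: monomials whose exponents are less than \<open>B\<close> stay distinct.\<close>

definition kron :: "nat \<Rightarrow> nat \<Rightarrow> int poly" where
  "kron B a = monom 1 (B ^ a)"

lemma digits_unique:
  fixes c d :: "nat \<Rightarrow> nat"
  assumes "(\<Sum>a<n. c a * B ^ a) = (\<Sum>a<n. d a * B ^ a)" "\<And>a. a < n \<Longrightarrow> c a < B" "\<And>a. a < n \<Longrightarrow> d a < B" "a < n"
  shows "c a = d a"
  using assms
proof (induction n arbitrary: a c d)
  case (Suc n)
  have e: "(\<Sum>a<Suc n. c a * B ^ a) = c 0 + B * (\<Sum>a<n. c (Suc a) * B ^ a)" for c :: "nat \<Rightarrow> nat"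
    unfolding sum.lessThan_Suc_shift by (simp add: sum_distrib_left ac_simps)
  have "c 0 = d 0"
    using arg_cong[OF Suc.prems(1)[unfolded e], of "\<lambda>k. k mod B"] Suc.prems(2,3)[of 0] by simp
  moreover have "0 < B" using Suc.prems(2)[of 0] by simp
  ultimately have "(\<Sum>a<n. c (Suc a) * B ^ a) = (\<Sum>a<n. d (Suc a) * B ^ a)"
    using Suc.prems(1)[unfolded e] by simp
  then have "c (Suc b) = d (Suc b)" if "b < n" for b
    using Suc.IH[of "\<lambda>a. c (Suc a)" "\<lambda>a. d (Suc a)" b] Suc.prems(2,3) that by simp
  with \<open>c 0 = d 0\<close> show ?case using Suc.prems(4) by (cases a) auto
qed simp

lemma prod_kron:
  "(\<Prod>a\<in>A. kron B (h a) ^ m a) = monom 1 (\<Sum>a\<in>A. m a * B ^ h a)"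
  by (induction A rule: infinite_finite_induct)
    (simp_all add: kron_def monom_power mult_monom one_pCons monom_0 mult.commute)

lemma eval_series_kron_eq_0:
  assumes fin: "finite (letter_support n f)" and zero: "\<And>B. B0 \<le> B \<Longrightarrow> eval_series n f (kron B) = 0"
    and M: "set_mset M \<subseteq> {1..n}"
  shows "f M = 0"
proof (rule ccontr)
  assume "f M \<noteq> 0"
  then have MS: "M \<in> letter_support n f" using M by (simp add: letter_support_def)
  obtain b where b: "\<And>M. M \<in> letter_support n f \<Longrightarrow> size M < b"
    using finite_nat_set_iff_bounded[of "size ` letter_support n f"] fin by auto
  \<comment> \<open>Above \<open>b\<close> all exponents are digits in base \<open>B\<close>, so
    different monomials get different degrees; from \<open>B0\<close> on the evaluation is known to
    vanish.\<close>
  define B where "B = max b B0"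
  define e where "e M = (\<Sum>a<n. count M (Suc a) * B ^ a)" for M
  have ev: "eval_monomial (kron B) M = monom 1 (e M)" if "M \<in> letter_support n f" for M
    using eval_monomial_eq[of M n "kron B"] that prod_kron[where h = "\<lambda>a. a"]
    by (simp add: letter_support_def e_def)
  have inj: "N = M" if N: "N \<in> letter_support n f" and eq: "e N = e M" for N
  proof (rule multiset_eqI)
    fix c
    have small: "count N a < B" if "N \<in> letter_support n f" for a N
      using count_le_size[of N a] b[OF that] by (simp add: B_def)
    have "count N (Suc a) = count M (Suc a)" if "a < n" for a
      using digits_unique[of "\<lambda>a. count N (Suc a)" B n "\<lambda>a. count M (Suc a)" a]
        eq small[OF N] small[OF MS] that by (simp add: e_def)
    moreover have "count N c = 0" "count M c = 0" if "c \<notin> {1..n}"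
      using N MS that by (auto simp: letter_support_def count_eq_zero_iff)
    ultimately show "count N c = count M c"
      by (cases "c \<in> {1..n}") (auto dest: spec[of _ "c - 1"] simp: Suc_le_eq gr0_conv_Suc)
  qed
  have "0 = coeff (eval_series n f (kron B)) (e M)"
    using zero[of B] by (simp add: B_def)
  also have "\<dots> = (\<Sum>N\<in>letter_support n f. coeff (of_int (f N) * eval_monomial (kron B) N) (e M))"
    by (simp add: eval_series_def coeff_sum)
  also have "\<dots> = (\<Sum>N\<in>letter_support n f. if N = M then f M else 0)"
  proof (rule sum.cong[OF refl])
    fix N assume N: "N \<in> letter_support n f"
    have "of_int (f N) * eval_monomial (kron B) N = monom (f N) (e N)"
      by (simp add: ev[OF N] of_int_poly smult_monom)
    then show "coeff (of_int (f N) * eval_monomial (kron B) N) (e M) = (if N = M then f M else 0)"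
      using inj[OF N] by auto
  qed
  also have "\<dots> = f M" using fin MS by simp
  finally show False using \<open>f M \<noteq> 0\<close> by simp
qed

text \<open>The terms of the alternant have pairwise different orders of vanishing at 0, so the lowest one survives.\<close>

lemma alternant_zero_kron_nonzero:
  assumes "n < B"
  shows "alternant n (\<lambda>_. 0) (kron B) \<noteq> 0"
proof
  assume zero: "alternant n (\<lambda>_. 0) (kron B) = 0"
  let ?P = "{p. p permutes {..<n}}"
  define e where "e p = (\<Sum>j<n. (n - Suc j) * B ^ p j)" for p
  define q where "q p = (\<Prod>j<n. (1 - kron B (p j)) ^ j)" for p
  have base: "base n (\<lambda>_. 0) (kron B \<circ> p) = monom 1 (e p) * q p" for p
    by (simp add: base_def q_def e_def prod.distrib prod_kron)
  \<comment> \<open>The remaining factor has constant term 1, so it does not change the lowest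
    term.\<close>
  have q0: "coeff (q p) 0 = 1" for p
  proof -
    have "(0 :: int) ^ (B ^ p j) = 0" for j using assms by (simp add: zero_power)
    moreover have "coeff (q p) 0 = (\<Prod>j<n. (1 - 0 ^ (B ^ p j)) ^ j)"
      by (simp add: q_def kron_def poly_monom poly_prod flip: poly_0_coeff_0)
    ultimately show ?thesis by (simp only: diff_zero power_one prod.neutral_const)
  qed
  have inj: "p = p'" if p: "p permutes {..<n}" and p': "p' permutes {..<n}" and eq: "e p = e p'" for p p'
  proof -
    \<comment> \<open>In base \<open>B\<close> the digit at place \<open>k\<close> is
      \<open>n - 1 - inv p k\<close>, so the exponent determines \<open>p\<close>.\<close>
    have e: "e p = (\<Sum>k<n. (n - Suc (inv p k)) * B ^ k)" if p: "p permutes {..<n}" for p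
      unfolding e_def using permutes_inverses[OF p] permutes_in_image[OF p] permutes_in_image[OF permutes_inv[OF p]]
      by (intro sum.reindex_bij_witness[of _ "inv p" p]) auto
    have "inv p k = inv p' k" for k
    proof (cases "k < n")
      case True
      have "n - Suc (inv p k) = n - Suc (inv p' k)"
        by (rule digits_unique[where n = n and B = B and a = k]) (use eq e[OF p] e[OF p'] assms True in auto)
      moreover have "inv p k < n" "inv p' k < n"
        using True permutes_in_image[OF permutes_inv[OF p], of k] permutes_in_image[OF permutes_inv[OF p'], of k] by auto
      ultimately show ?thesis by simp
    next
      case False
      then show ?thesis
        using permutes_not_in[OF permutes_inv[OF p], of k] permutes_not_in[OF permutes_inv[OF p'], of k] by simp
    qed
    then have "inv p = inv p'" by blast
    then show ?thesis using permutes_inv_inv[OF p] permutes_inv_inv[OF p'] by metis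
  qed
  have fin: "finite ?P" by (simp add: finite_permutations)
  moreover have "?P \<noteq> {}" using permutes_id by blast
  ultimately have "Min (e ` ?P) \<in> e ` ?P" by (intro Min_in) auto
  then obtain p0 where p0: "p0 \<in> ?P" "e p0 = Min (e ` ?P)" by auto
  have min: "e p0 \<le> e p" if "p \<in> ?P" for p
    using that fin by (simp add: p0(2))
  have "0 = (\<Sum>p\<in>?P. coeff (of_int (sign p) * base n (\<lambda>_. 0) (kron B \<circ> p)) (e p0))"
    using arg_cong[OF zero, of "\<lambda>f. coeff f (e p0)"] by (simp add: alternation_def coeff_sum)
  also have "\<dots> = (\<Sum>p\<in>?P. if p = p0 then sign p0 else 0)"
  proof (rule sum.cong[OF refl])
    fix p assume p: "p \<in> ?P"
    have "coeff (of_int (sign p) * base n (\<lambda>_. 0) (kron B \<circ> p)) (e p0) = sign p * coeff (monom 1 (e p) * q p) (e p0)"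
      by (simp add: base of_int_poly)
    also have "coeff (monom 1 (e p) * q p) (e p0) = (if p = p0 then 1 else 0)"
      using min[OF p] inj[of p p0] p p0(1) q0 by (auto simp: coeff_monom_mult)
    also have "sign p * (if p = p0 then 1 else 0) = (if p = p0 then sign p0 else 0)"
      by simp
    finally show "coeff (of_int (sign p) * base n (\<lambda>_. 0) (kron B \<circ> p)) (e p0) = (if p = p0 then sign p0 else 0)" .
  qed
  also have "\<dots> = sign p0" using fin p0 by simp
  finally show False by (simp add: sign_def split: if_splits)
qed

section \<open>Adding corners\<close>

lemma mem_outer_corners_iff:
  assumes "mu \<in> partitions"
  shows "(i, j) \<in> outer_corners mu \<longleftrightarrow> j = mu i \<and> (i = 0 \<or> mu i < mu (i - 1))"
proof
  assume "(i, j) \<in> outer_corners mu"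
  then obtain rho where nin: "\<not> j < mu i" and rho: "rho \<in> partitions"
    and eq: "diagram rho = insert (i, j) (diagram mu)"
    by (auto simp: outer_corners_def diagram_def)
  have mem: "c < rho r \<longleftrightarrow> c < mu r \<or> r = i \<and> c = j" for r c
    using eq by (auto simp: diagram_def set_eq_iff)
  have other: "rho r = mu r" if "r \<noteq> i" for r
    using mem[of "mu r" r] mem[of "rho r" r] that by (auto simp: not_less)
  have "j = mu i"
  proof (rule ccontr)
    assume "j \<noteq> mu i"
    then have "mu i < j" using nin by simp
    moreover have "j < rho i" using mem by blast
    ultimately show False using mem[of "mu i" i] by simp
  qed
  moreover have "mu i < mu (i - 1)" if "i \<noteq> 0"
  proof -
    have "mu i < rho i" using mem \<open>j = mu i\<close> by blast
    also have "rho i \<le> rho (i - 1)" using rho by (intro antimonoD[of rho]) (auto simp: partitions_def)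
    also have "\<dots> = mu (i - 1)" using that by (intro other) auto
    finally show ?thesis .
  qed
  ultimately show "j = mu i \<and> (i = 0 \<or> mu i < mu (i - 1))" by blast
next
  assume c: "j = mu i \<and> (i = 0 \<or> mu i < mu (i - 1))"
  have "antimono (mu(i := Suc (mu i)))"
    unfolding antimono_iff_le_Suc
  proof
    fix r
    show "(mu(i := Suc (mu i))) (Suc r) \<le> (mu(i := Suc (mu i))) r"
      using assms c antimonoD[of mu r "Suc r"] by (auto simp: partitions_def)
  qed
  moreover have "finite {r. (mu(i := Suc (mu i))) r \<noteq> 0}"
    by (rule finite_subset[of _ "insert i {r. mu r \<noteq> 0}"]) (use assms in \<open>auto simp: partitions_def\<close>)
  ultimately have "mu(i := Suc (mu i)) \<in> partitions" by (simp add: partitions_def)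
  moreover have "diagram (mu(i := Suc (mu i))) = insert (i, j) (diagram mu)"
    using c by (auto simp: diagram_def less_Suc_eq split: if_splits)
  moreover have "(i, j) \<notin> diagram mu" using c by (simp add: diagram_def)
  ultimately show "(i, j) \<in> outer_corners mu"
    unfolding outer_corners_def by blast
qed

definition corner_extensions :: "(nat \<Rightarrow> nat) \<Rightarrow> (nat \<Rightarrow> nat) set" where
  "corner_extensions mu = {mup \<in> partitions. \<exists>S \<subseteq> outer_corners mu. diagram mup = diagram mu \<union> S}"

text \<open>A row has at most one outer corner, so a set of corners is encoded by its rows.\<close>

definition corner_rows :: "(nat \<Rightarrow> nat) \<Rightarrow> nat set set" where
  "corner_rows mu = {S. \<forall>a\<in>S. a = 0 \<or> mu a < mu (a - 1)}"

definition add_rows :: "(nat \<Rightarrow> nat) \<Rightarrow> nat set \<Rightarrow> nat \<Rightarrow> nat" where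
  "add_rows mu S = (\<lambda>a. mu a + of_bool (a \<in> S))"

text \<open>An added box may open a new row, which is why \<open>mu\<close> has to vanish one row
  earlier than \<open>n\<close>.\<close>

lemma corner_rows_bounded:
  assumes "S \<in> corner_rows mu" "\<And>r. n \<le> Suc r \<Longrightarrow> mu r = 0" "1 \<le> n"
  shows "S \<subseteq> {..<n}"
proof
  fix a assume "a \<in> S"
  then have "a = 0 \<or> mu a < mu (a - 1)" using assms(1) by (auto simp: corner_rows_def)
  then show "a \<in> {..<n}" using assms(2)[of "a - 1"] assms(3) by (cases a) (auto simp: not_le[symmetric])
qed

text \<open>Corners do not interfere: a row of \<open>S\<close> other than row 0 is strictly shorter
  than the one above before anything is added.\<close>

lemma add_rows_in_partitions:
  assumes mu: "mu \<in> partitions" and S: "S \<in> corner_rows mu"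
  shows "add_rows mu S \<in> partitions"
proof -
  have anti: "antimono mu" and fin: "finite {r. mu r \<noteq> 0}" using mu by (auto simp: partitions_def)
  have "antimono (add_rows mu S)"
    unfolding antimono_iff_le_Suc
  proof
    fix r
    show "add_rows mu S (Suc r) \<le> add_rows mu S r"
      using S antimonoD[OF anti, of r "Suc r"] by (force simp: add_rows_def corner_rows_def)
  qed
  moreover have "finite {r. add_rows mu S r \<noteq> 0}"
  proof (rule finite_subset)
    show "{r. add_rows mu S r \<noteq> 0} \<subseteq> insert 0 ({r. mu r \<noteq> 0} \<union> Suc ` {r. mu r \<noteq> 0})"
    proof
      fix r assume "r \<in> {r. add_rows mu S r \<noteq> 0}"
      then show "r \<in> insert 0 ({r. mu r \<noteq> 0} \<union> Suc ` {r. mu r \<noteq> 0})"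
        using S by (cases r) (force simp: add_rows_def corner_rows_def)+
    qed
  qed (use fin in simp)
  ultimately show ?thesis by (simp add: partitions_def)
qed

lemma corner_extensions_eq:
  assumes mu: "mu \<in> partitions"
  shows "corner_extensions mu = add_rows mu ` corner_rows mu"
proof (intro equalityI subsetI)
  fix mup assume "mup \<in> corner_extensions mu"
  then obtain S where S: "S \<subseteq> outer_corners mu" and eq: "diagram mup = diagram mu \<union> S"
    by (auto simp: corner_extensions_def)
  define R where "R = {a. (a, mu a) \<in> S}"
  have mem: "c < mup r \<longleftrightarrow> c < mu r \<or> (c = mu r \<and> r \<in> R)" for r c
  proof -
    have "c < mup r \<longleftrightarrow> c < mu r \<or> (r, c) \<in> S"
      using eq by (auto simp: diagram_def set_eq_iff)
    moreover have "(r, c) \<in> S \<Longrightarrow> c = mu r" using S mem_outer_corners_iff[OF mu] by blast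
    ultimately show ?thesis by (auto simp: R_def)
  qed
  have "mup r = add_rows mu R r" for r
    using mem[of "mup r" r] mem[of "mu r" r] mem[of "Suc (mu r)" r] by (auto simp: add_rows_def)
  moreover have "R \<in> corner_rows mu"
    using S mem_outer_corners_iff[OF mu] by (auto simp: corner_rows_def R_def)
  ultimately show "mup \<in> add_rows mu ` corner_rows mu" by blast
next
  fix mup assume "mup \<in> add_rows mu ` corner_rows mu"
  then obtain R where R: "R \<in> corner_rows mu" and mup: "mup = add_rows mu R" by blast
  let ?S = "(\<lambda>a. (a, mu a)) ` R"
  have "?S \<subseteq> outer_corners mu"
    using R mem_outer_corners_iff[OF mu] by (auto simp: corner_rows_def)
  moreover have "diagram mup = diagram mu \<union> ?S"
    by (auto simp: diagram_def mup add_rows_def of_bool_def less_Suc_eq split: if_splits)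
  moreover have "mup \<in> partitions" unfolding mup using mu R by (rule add_rows_in_partitions)
  ultimately show "mup \<in> corner_extensions mu" by (auto simp: corner_extensions_def)
qed

lemma inj_add_rows: "inj_on (add_rows mu) A"
proof (rule inj_onI)
  fix S S' assume eq: "add_rows mu S = add_rows mu S'"
  have "a \<in> S \<longleftrightarrow> a \<in> S'" for a
    using fun_cong[OF eq, of a] by (simp add: add_rows_def of_bool_def split: if_splits)
  then show "S = S'" by blast
qed

section \<open>Tableaux of a single box and the factor 1 - G_1\<close>

definition box_fill :: "nat set \<Rightarrow> box \<Rightarrow> nat set" where
  "box_fill S = restrict (\<lambda>_. Suc ` S) {(0, 0)}"

abbreviation box_pattern :: "nat set \<Rightarrow> pattern" where
  "box_pattern S \<equiv> pattern_of one_box (box_fill S)"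

lemma diagram_one_box: "diagram one_box = {(0, 0)}"
  by (auto simp: diagram_def one_box_def split: if_splits)

lemma antimono_one_box: "antimono one_box"
  using one_box_in_partitions by (simp add: partitions_def)

lemma box_fill_in_ssvt: "S \<noteq> {} \<Longrightarrow> S \<subseteq> {..<n} \<Longrightarrow> box_fill S \<in> ssvt n one_box"
  by (auto simp: ssvt_def set_valued_tableaux_def diagram_one_box box_fill_def semistandard_def
      PiE_iff intro: finite_subset)

lemma ssvt_one_box_cases:
  assumes "T \<in> ssvt n one_box"
  obtains S where "S \<noteq> {}" "S \<subseteq> {..<n}" "T = box_fill S"
proof
  define S where "S = {a. Suc a \<in> T (0, 0)}"
  have T: "T (0, 0) \<noteq> {}" "T (0, 0) \<subseteq> {1..n}" "T \<in> extensional {(0, 0)}"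
    using assms by (auto simp: ssvt_def set_valued_tableaux_def diagram_one_box PiE_iff)
  have eq: "T (0, 0) = Suc ` S"
  proof (intro equalityI subsetI)
    fix b assume b: "b \<in> T (0, 0)"
    then have "b = Suc (b - 1)" using T(2) by force
    with b show "b \<in> Suc ` S" unfolding S_def by (metis imageI mem_Collect_eq)
  qed (auto simp: S_def)
  show "S \<noteq> {}" using T(1) eq by blast
  show "S \<subseteq> {..<n}" using T(2) by (auto simp: S_def)
  show "T = box_fill S"
    using T(3) eq by (auto simp: box_fill_def extensional_def fun_eq_iff)
qed

lemma pcount_box_fill:
  assumes "S \<noteq> {}" "S \<subseteq> {..<n}"
  shows "pcount (box_pattern S) a r = of_bool (r = 0 \<and> a \<in> S)"
proof -
  have "{j. j < one_box r \<and> Suc a \<in> box_fill S (r, j)} = (if r = 0 \<and> a \<in> S then {0} else {})"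
    by (auto simp: one_box_def box_fill_def split: if_splits)
  then show ?thesis
    unfolding pcount_pattern_of[OF box_fill_in_ssvt[OF assms] antimono_one_box] by simp
qed

lemma pcontent_box_fill:
  assumes "S \<noteq> {}" "S \<subseteq> {..<n}"
  shows "pcontent n (box_pattern S) a = of_bool (a \<in> S)"
proof -
  have "0 < n" using assms by force
  then show ?thesis
    using sum.delta[of "{..<n}" 0 "\<lambda>_. of_bool (a \<in> S) :: nat"]
    by (simp add: pcontent_def pcount_box_fill[OF assms] of_bool_def if_distrib cong: if_cong conj_cong)
qed

lemma pextra_box_fill:
  assumes "S \<noteq> {}" "S \<subseteq> {..<n}"
  shows "Suc (pextra n (box_pattern S)) = card S"
proof -
  have n: "0 < n" using assms by force
  have "(\<Sum>a<n. of_bool (a \<in> S)) = (\<Sum>r<n. one_box r) + pextra n (box_pattern S)"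
    using sum_pcontent[OF pattern_of_in_patterns[OF box_fill_in_ssvt[OF assms] antimono_one_box]]
    by (simp add: pcontent_box_fill[OF assms])
  moreover have "(\<Sum>r<n. one_box r) = 1"
    using n by (simp add: one_box_def sum.delta fun_upd_def)
  moreover have "(\<Sum>a<n. of_bool (a \<in> S)) = card S"
    using assms(2) by (simp add: of_bool_def sum.If_cases Int_absorb1 Int_def[symmetric])
  ultimately show ?thesis by simp
qed

text \<open>A single box is read from its largest letter down, so \<open>i + 1\<close> has not been
  read when \<open>i + 2\<close> is. Ballotness from \<open>mu\<close> thus asks of each letter
  separately that its row can take a box, which is the corner condition.\<close>

lemma bij_box_fill:
  assumes mu: "mu \<in> partitions" and rows: "\<And>r. n \<le> Suc r \<Longrightarrow> mu r = 0" "1 \<le> n"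
  shows "bij_betw box_pattern (corner_rows mu - {{}}) (ballot_patterns n one_box mu)"
proof -
  have anti: "antimono mu" using mu by (simp add: partitions_def)
  have "bij_betw box_fill {S. S \<noteq> {} \<and> S \<subseteq> {..<n}} (ssvt n one_box)"
    unfolding bij_betw_def
  proof (intro conjI inj_onI)
    fix S S' assume "box_fill S = box_fill S'"
    from fun_cong[OF this, of "(0, 0)"] show "S = S'" by (simp add: box_fill_def inj_image_eq_iff)
  next
    show "box_fill ` {S. S \<noteq> {} \<and> S \<subseteq> {..<n}} = ssvt n one_box"
      by (auto intro: box_fill_in_ssvt elim: ssvt_one_box_cases)
  qed
  then have bij: "bij_betw box_pattern {S. S \<noteq> {} \<and> S \<subseteq> {..<n}} (patterns n one_box)"
    using bij_betw_trans[OF _ bij_pattern_of[OF antimono_one_box]] by (fastforce simp: comp_def)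
  have viol: "(\<forall>r i. \<not> violation mu (box_pattern S) r i) \<longleftrightarrow> S \<in> corner_rows mu"
    if S: "S \<noteq> {}" "S \<subseteq> {..<n}" for S
  proof -
    have *: "violation mu (box_pattern S) r i \<longleftrightarrow>
        mu i + of_bool (0 < r \<and> i \<in> S) < mu (Suc i) + of_bool (Suc i \<in> S)" for r i
    proof -
      have "(\<Sum>s\<le>r. of_bool (s = 0 \<and> Suc i \<in> S)) = (of_bool (Suc i \<in> S) :: nat)"
        by (simp add: of_bool_conj sum.delta flip: sum_distrib_right)
      moreover have "(\<Sum>s<r. of_bool (s = 0 \<and> i \<in> S)) = (of_bool (0 < r \<and> i \<in> S) :: nat)"
        by (simp add: of_bool_conj flip: sum_distrib_right)
      ultimately show ?thesis by (simp add: violation_def pcount_box_fill[OF S])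
    qed
    have "(\<forall>r i. \<not> violation mu (box_pattern S) r i) \<longleftrightarrow>
        (\<forall>i. mu (Suc i) + of_bool (Suc i \<in> S) \<le> mu i)"
      unfolding * not_less
    proof (intro iffI allI)
      fix i assume "\<forall>(r::nat) i. mu (Suc i) + of_bool (Suc i \<in> S) \<le> mu i + of_bool (0 < r \<and> i \<in> S)"
      \<comment> \<open>Row 0 gives the sharpest inequality; in later rows the letter
        \<open>i + 1\<close> of the box can only help.\<close>
      from this[rule_format, of i 0] show "mu (Suc i) + of_bool (Suc i \<in> S) \<le> mu i" by simp
    next
      fix r i assume "\<forall>i. mu (Suc i) + of_bool (Suc i \<in> S) \<le> mu i"
      then show "mu (Suc i) + of_bool (Suc i \<in> S) \<le> mu i + of_bool (0 < r \<and> i \<in> S)"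
        by (simp add: trans_le_add1)
    qed
    also have "\<dots> \<longleftrightarrow> S \<in> corner_rows mu"
    proof
      assume l: "\<forall>i. mu (Suc i) + of_bool (Suc i \<in> S) \<le> mu i"
      show "S \<in> corner_rows mu"
        unfolding corner_rows_def
      proof (intro CollectI ballI)
        fix a assume "a \<in> S"
        then show "a = 0 \<or> mu a < mu (a - 1)" using l[rule_format, of "a - 1"] by (cases a) auto
      qed
    next
      assume "S \<in> corner_rows mu"
      then show "\<forall>i. mu (Suc i) + of_bool (Suc i \<in> S) \<le> mu i"
        using antimonoD[OF anti, of _ "Suc _"] by (auto simp: corner_rows_def Suc_le_eq)
    qed
    finally show ?thesis .
  qed
  have "S \<subseteq> {..<n}" if "S \<in> corner_rows mu" for S
    using that rows by (rule corner_rows_bounded)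
  then have "corner_rows mu - {{}} = {S \<in> {S. S \<noteq> {} \<and> S \<subseteq> {..<n}}. S \<in> corner_rows mu}"
    by auto
  then show ?thesis
    using bij_betw_Collect[OF bij, of "\<lambda>Z. \<forall>r i. \<not> violation mu Z r i" "\<lambda>S. S \<in> corner_rows mu"] viol
    by (simp add: ballot_patterns_def)
qed

text \<open>A box with letter set \<open>S\<close> has sign \<open>(- 1) ^ (card S - 1)\<close>.
  Subtracting the product from \<open>gsum n mu x\<close> changes this to
  \<open>(- 1) ^ card S\<close>, and \<open>gsum n mu x\<close> itself is the term of the empty
  set.\<close>

lemma gsum_mult_one_minus:
  fixes x :: "nat \<Rightarrow> 'a::{idom, ring_char_0}"
  assumes mu: "mu \<in> partitions" and rows: "\<And>r. n \<le> Suc r \<Longrightarrow> mu r = 0" "1 \<le> n"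
    and nz: "alternant n (\<lambda>_. 0) x \<noteq> 0"
  shows "gsum n mu x * (1 - gsum n one_box x) =
    (\<Sum>mup\<in>corner_extensions mu. (- 1) ^ (psize mup + psize mu) * gsum n mup x)"
proof -
  have anti: "antimono mu" using mu by (simp add: partitions_def)
  have z: "mu r = 0" if "n \<le> r" for r using rows(1)[of r] that by simp
  have b: "S \<subseteq> {..<n}" if "S \<in> corner_rows mu" for S
    using that rows by (rule corner_rows_bounded)
  have fin: "finite (corner_rows mu)"
    by (rule finite_subset[of _ "Pow {..<n}"]) (use b in auto)
  have S: "S \<noteq> {}" "S \<subseteq> {..<n}" if "S \<in> corner_rows mu - {{}}" for S
    using b that by auto
  have "gsum n mu x * gsum n one_box x =
    (\<Sum>Z\<in>ballot_patterns n one_box mu. psign n Z * gsum n (\<lambda>a. mu a + pcontent n Z a) x)"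
    by (rule gsum_mult_gsum[OF anti z nz])
  also have "\<dots> = (\<Sum>S\<in>corner_rows mu - {{}}. psign n (box_pattern S) * gsum n (\<lambda>a. mu a + pcontent n (box_pattern S) a) x)"
    using bij_box_fill[of mu n] mu rows by (intro sum.reindex_bij_betw[symmetric]) auto
  also have "\<dots> = (\<Sum>S\<in>corner_rows mu - {{}}. - ((- 1) ^ card S * gsum n (add_rows mu S) x))"
  proof (rule sum.cong[OF refl])
    fix S assume "S \<in> corner_rows mu - {{}}"
    note S = S[OF this]
    have "(\<lambda>a. mu a + pcontent n (box_pattern S) a) = add_rows mu S"
      by (simp add: add_rows_def pcontent_box_fill[OF S])
    then show "psign n (box_pattern S) * gsum n (\<lambda>a. mu a + pcontent n (box_pattern S) a) x = - ((- 1) ^ card S * gsum n (add_rows mu S) x)"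
      by (simp add: psign_eq flip: pextra_box_fill[OF S])
  qed
  also have "\<dots> = - (\<Sum>S\<in>corner_rows mu - {{}}. (- 1) ^ card S * gsum n (add_rows mu S) x)"
    by (rule sum_negf)
  finally have "gsum n mu x * (1 - gsum n one_box x) =
      gsum n mu x + (\<Sum>S\<in>corner_rows mu - {{}}. (- 1) ^ card S * gsum n (add_rows mu S) x)"
    by (simp add: algebra_simps)
  also have "\<dots> = (\<Sum>S\<in>corner_rows mu. (- 1) ^ card S * gsum n (add_rows mu S) x)"
    using sum.remove[OF fin, of "{}" "\<lambda>S. (- 1) ^ card S * gsum n (add_rows mu S) x"]
    by (simp add: corner_rows_def add_rows_def)
  also have "\<dots> = (\<Sum>S\<in>corner_rows mu. (- 1) ^ (psize (add_rows mu S) + psize mu) * gsum n (add_rows mu S) x)"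
  proof (rule sum.cong[OF refl])
    fix S assume S: "S \<in> corner_rows mu"
    note b = b[OF S]
    have "psize (add_rows mu S) = (\<Sum>r<n. add_rows mu S r)"
      by (rule psize_eq) (use z b in \<open>force simp: add_rows_def\<close>)
    also have "\<dots> = psize mu + card S"
      using b z by (simp add: add_rows_def sum.distrib psize_eq[of n mu] of_bool_def sum.If_cases Int_absorb1 Int_def[symmetric])
    finally have "even (psize (add_rows mu S) + psize mu) = even (card S)" by auto
    then have "(- 1 :: 'a) ^ card S = (- 1) ^ (psize (add_rows mu S) + psize mu)"
      by (simp add: minus_one_power_iff)
    then show "(- 1) ^ card S * gsum n (add_rows mu S) x =
        (- 1) ^ (psize (add_rows mu S) + psize mu) * gsum n (add_rows mu S) x" by simp
  qed
  also have "\<dots> = (\<Sum>mup\<in>corner_extensions mu. (- 1) ^ (psize mup + psize mu) * gsum n mup x)"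
    unfolding corner_extensions_eq[OF mu] by (simp add: sum.reindex[OF inj_add_rows])
  finally show ?thesis .
qed

lemma finite_corner_extensions:
  assumes "mu \<in> partitions"
  shows "finite (corner_extensions mu)"
proof -
  define n where "n = Suc (Suc (Max (insert 0 {r. mu r \<noteq> 0})))"
  have fin: "finite {r. mu r \<noteq> 0}" using assms by (simp add: partitions_def)
  have z: "mu r = 0" if "n \<le> Suc r" for r
  proof (rule ccontr)
    assume "mu r \<noteq> 0"
    then have "r \<le> Max (insert 0 {r. mu r \<noteq> 0})" using fin by (intro Max_ge) auto
    with that show False by (simp add: n_def)
  qed
  have "1 \<le> n" by (simp add: n_def)
  with z have "S \<subseteq> {..<n}" if "S \<in> corner_rows mu" for S
    using that by (intro corner_rows_bounded) blast+
  then have "corner_rows mu \<subseteq> Pow {..<n}" by blast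
  then have "finite (corner_rows mu)" by (rule finite_subset) simp
  then show ?thesis
    unfolding corner_extensions_eq[OF assms] by (rule finite_imageI)
qed

section \<open>The signed product expansion in finitely many variables\<close>

definition lr_pairs :: "nat \<Rightarrow> (nat \<Rightarrow> nat) \<Rightarrow> (nat \<Rightarrow> nat) \<Rightarrow> ((nat \<Rightarrow> nat) \<times> pattern) set" where
  "lr_pairs n la mu = Sigma (corner_extensions mu) (\<lambda>mup. ballot_patterns n mup la)"

definition lr_content :: "nat \<Rightarrow> (nat \<Rightarrow> nat) \<Rightarrow> (nat \<Rightarrow> nat) \<times> pattern \<Rightarrow> nat \<Rightarrow> nat" where
  "lr_content n la z = (\<lambda>a. la a + pcontent n (snd z) a)"

lemma finite_lr_pairs: "mu \<in> partitions \<Longrightarrow> finite (lr_pairs n la mu)"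
  unfolding lr_pairs_def
  by (intro finite_SigmaI finite_corner_extensions) (auto simp: ballot_patterns_def finite_patterns)

lemma lr_content_in_partitions:
  assumes la: "la \<in> partitions" and z: "z \<in> lr_pairs n la mu"
  shows "lr_content n la z \<in> partitions"
proof -
  have Z: "snd z \<in> ballot_patterns n (fst z) la" using z by (auto simp: lr_pairs_def)
  have "finite {a. lr_content n la z a \<noteq> 0}"
  proof (rule finite_subset)
    show "{a. lr_content n la z a \<noteq> 0} \<subseteq> {a. la a \<noteq> 0} \<union> {..<n}"
      using Z pcount_rows[of "snd z" n "fst z"]
      by (auto simp: lr_content_def pcontent_def ballot_patterns_def)
  qed (use la in \<open>auto simp: partitions_def\<close>)
  then show ?thesis
    using ballot_content_antimono[OF _ Z] la by (simp add: lr_content_def partitions_def)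
qed

text \<open>The added corners contribute the parity of \<open>psize mup - psize mu\<close> and the
  tableau that of its excess letters. Together this depends only on the content, so terms of equal
  content never cancel and coefficients become counts.\<close>

lemma gsum_product_expansion:
  fixes x :: "nat \<Rightarrow> 'a::{idom, ring_char_0}"
  assumes la: "la \<in> partitions" "\<And>r. n \<le> r \<Longrightarrow> la r = 0"
    and mu: "mu \<in> partitions" and rows: "\<And>r. n \<le> Suc r \<Longrightarrow> mu r = 0" "1 \<le> n"
    and nz: "alternant n (\<lambda>_. 0) x \<noteq> 0"
  shows "gsum n la x * (gsum n mu x * (1 - gsum n one_box x)) =
    (\<Sum>z\<in>lr_pairs n la mu. (- 1) ^ (psize (lr_content n la z) + psize la + psize mu) * gsum n (lr_content n la z) x)"
proof -
  have anti: "antimono la" using la(1) by (simp add: partitions_def)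
  have "gsum n la x * (gsum n mu x * (1 - gsum n one_box x)) =
      (\<Sum>mup\<in>corner_extensions mu. (- 1) ^ (psize mup + psize mu) * (gsum n la x * gsum n mup x))"
  proof -
    have "gsum n mu x * (1 - gsum n one_box x) =
        (\<Sum>mup\<in>corner_extensions mu. (- 1) ^ (psize mup + psize mu) * gsum n mup x)"
      using mu rows nz by (rule gsum_mult_one_minus)
    then show ?thesis by (simp add: sum_distrib_left ac_simps)
  qed
  also have "\<dots> = (\<Sum>mup\<in>corner_extensions mu. \<Sum>Z\<in>ballot_patterns n mup la.
      (- 1) ^ (psize mup + psize mu) * (psign n Z * gsum n (\<lambda>a. la a + pcontent n Z a) x))"
  proof -
    have "gsum n la x * gsum n mup x =
        (\<Sum>Z\<in>ballot_patterns n mup la. psign n Z * gsum n (\<lambda>a. la a + pcontent n Z a) x)" for mup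
      using anti la(2) nz by (rule gsum_mult_gsum)
    then show ?thesis by (simp only: sum_distrib_left)
  qed
  also have "\<dots> = (\<Sum>z\<in>lr_pairs n la mu.
      (- 1) ^ (psize (fst z) + psize mu) * (psign n (snd z) * gsum n (lr_content n la z) x))"
    unfolding lr_pairs_def lr_content_def
    by (subst sum.Sigma)
      (use finite_corner_extensions[OF mu] in \<open>auto simp: ballot_patterns_def finite_patterns case_prod_unfold\<close>)
  also have "\<dots> = (\<Sum>z\<in>lr_pairs n la mu. (- 1) ^ (psize (lr_content n la z) + psize la + psize mu) * gsum n (lr_content n la z) x)"
  proof (rule sum.cong[OF refl])
    fix z assume z: "z \<in> lr_pairs n la mu"
    then have Z: "snd z \<in> patterns n (fst z)" by (auto simp: lr_pairs_def ballot_patterns_def)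
    have r: "fst z r = 0" if "n \<le> r" for r
      using pattern_rows(3)[of "fst (snd z)" "snd (snd z)" n "fst z" r] Z that by simp
    have "psize (lr_content n la z) = (\<Sum>a<n. lr_content n la z a)"
      by (rule psize_eq) (use la(2) pcount_rows[OF Z] in \<open>auto simp: lr_content_def pcontent_def\<close>)
    also have "\<dots> = psize la + psize (fst z) + pextra n (snd z)"
      using sum_pcontent[OF Z] psize_eq[OF r] psize_eq[OF la(2)] by (simp add: lr_content_def sum.distrib)
    finally have "even (psize (lr_content n la z) + psize la + psize mu) = even (psize (fst z) + psize mu + pextra n (snd z))"
      by auto
    then have "(- 1 :: 'a) ^ (psize (lr_content n la z) + psize la + psize mu) = (- 1) ^ (psize (fst z) + psize mu + pextra n (snd z))"
      by (simp only: minus_one_power_iff)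
    then show "(- 1) ^ (psize (fst z) + psize mu) * (psign n (snd z) * gsum n (lr_content n la z) x) =
        (- 1) ^ (psize (lr_content n la z) + psize la + psize mu) * gsum n (lr_content n la z) x"
      by (simp add: psign_eq power_add mult.assoc)
  qed
  finally show ?thesis .
qed

section \<open>Reading words\<close>

lemma num_parts_iff:
  assumes "la \<in> partitions"
  shows "la i \<noteq> 0 \<longleftrightarrow> i < num_parts la"
proof -
  have anti: "antimono la" and fin: "finite {i. la i \<noteq> 0}" using assms by (auto simp: partitions_def)
  show ?thesis
  proof
    assume "la i \<noteq> 0"
    then have "{..i} \<subseteq> {i. la i \<noteq> 0}"
      using antimonoD[OF anti, of _ i] by fastforce
    from card_mono[OF fin this] show "i < num_parts la" by (simp add: num_parts_def)
  next
    assume i: "i < num_parts la"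
    show "la i \<noteq> 0"
    proof
      assume z: "la i = 0"
      have "{j. la j \<noteq> 0} \<subseteq> {..<i}"
      proof
        fix j assume "j \<in> {j. la j \<noteq> 0}"
        then show "j \<in> {..<i}" using antimonoD[OF anti, of i j] z by (cases "i \<le> j") auto
      qed
      from card_mono[OF _ this] i show False by (simp add: num_parts_def)
    qed
  qed
qed

definition row_word :: "(nat \<Rightarrow> nat set) \<Rightarrow> nat \<Rightarrow> nat list" where
  "row_word f m = concat (map (\<lambda>j. rev (sorted_list_of_set (f j))) (rev [0..<m]))"

lemma row_word_Suc: "row_word f (Suc m) = rev (sorted_list_of_set (f m)) @ row_word f m"
  by (simp add: row_word_def)

lemma row_word_0 [simp]: "row_word f 0 = []"
  by (simp add: row_word_def)

lemma row_word_cong: "(\<And>j. j < m \<Longrightarrow> f j = g j) \<Longrightarrow> row_word f m = row_word g m"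
  unfolding row_word_def by (intro arg_cong[of _ _ concat] map_cong) auto

lemma set_row_word: "(\<And>j. j < m \<Longrightarrow> finite (f j)) \<Longrightarrow> set (row_word f m) = (\<Union>j<m. f j)"
  by (induction m) (auto simp: row_word_Suc lessThan_Suc)

lemma content_row_word:
  assumes "\<And>j. j < m \<Longrightarrow> finite (f j)"
  shows "content (row_word f m) a = card {j. j < m \<and> Suc a \<in> f j}"
  using assms
proof (induction m)
  case (Suc m)
  have "count_list (rev (sorted_list_of_set (f m))) (Suc a) = of_bool (Suc a \<in> f m)"
    using Suc.prems[of m] distinct_sorted_list_of_set[of "f m"]
    by (simp add: count_list_rev distinct_count_atmost_1 flip: count_mset)
  moreover have "{j. j < Suc m \<and> Suc a \<in> f j} = {j. j < m \<and> Suc a \<in> f j} \<union> (if Suc a \<in> f m then {m} else {})"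
    by (auto simp: less_Suc_eq)
  then have "card {j. j < Suc m \<and> Suc a \<in> f j} = card {j. j < m \<and> Suc a \<in> f j} + of_bool (Suc a \<in> f m)"
    by (subst \<open>{j. j < Suc m \<and> Suc a \<in> f j} = _\<close>, subst card_Un_disjoint) auto
  ultimately show ?case using Suc by (simp add: content_def row_word_Suc)
qed (simp add: content_def)

lemma sorted_row_word:
  assumes "\<And>j. j < m \<Longrightarrow> finite (f j)" "\<And>j j' a b. j < j' \<Longrightarrow> j' < m \<Longrightarrow> a \<in> f j \<Longrightarrow> b \<in> f j' \<Longrightarrow> a \<le> b"
  shows "sorted_wrt (\<ge>) (row_word f m)"
  using assms
proof (induction m)
  case (Suc m)
  have "sorted_wrt (\<ge>) (row_word f m)"
    using Suc.prems by (intro Suc.IH) (auto intro: less_SucI)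
  moreover have "set (row_word f m) = (\<Union>j<m. f j)"
    using Suc.prems(1) by (intro set_row_word) auto
  moreover have "sorted_wrt (\<ge>) (rev (sorted_list_of_set (f m)))"
    using sorted_sorted_list_of_set[of "f m"] by (simp add: sorted_wrt_rev)
  ultimately show ?case
    using Suc.prems by (auto simp: row_word_Suc sorted_wrt_append)
qed simp

text \<open>Ballotness continued from a content \<open>al\<close> already read, which is what allows
  a word to be split; \<open>al = 0\<close> gives the usual notion.\<close>

definition ballot_from :: "(nat \<Rightarrow> nat) \<Rightarrow> nat list \<Rightarrow> bool" where
  "ballot_from al w \<longleftrightarrow> (\<forall>u. prefix u w \<longrightarrow> antimono (\<lambda>i. al i + content u i))"

lemma ballot_eq_ballot_from: "ballot w \<longleftrightarrow> ballot_from (\<lambda>_. 0) w"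
  by (simp add: ballot_def ballot_from_def)

lemma content_append: "content (u @ v) = (\<lambda>i. content u i + content v i)"
  by (simp add: content_def fun_eq_iff)

lemma ballot_from_append:
  "ballot_from al (u @ v) \<longleftrightarrow> ballot_from al u \<and> ballot_from (\<lambda>i. al i + content u i) v"
  unfolding ballot_from_def prefix_append by (auto simp: content_append add.assoc)

lemma ballot_from_imp_antimono:
  assumes "ballot_from al w"
  shows "antimono al" "antimono (\<lambda>i. al i + content w i)"
  using assms[unfolded ballot_from_def, rule_format, of "[]"] assms[unfolded ballot_from_def, rule_format, of w]
  by (auto simp: content_def)

lemma count_list_takeWhile_sorted:
  fixes w :: "nat list"
  shows "sorted_wrt (\<ge>) w \<Longrightarrow> b \<le> x \<Longrightarrow> count_list (takeWhile (\<lambda>a. b \<le> a) w) x = count_list w x"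
proof (induction w)
  case (Cons y w)
  show ?case
  proof (cases "b \<le> y")
    case False
    have "x \<notin> set (y # w)"
    proof
      assume "x \<in> set (y # w)"
      then have "x \<le> y" using Cons.prems(1) by auto
      then show False using False Cons.prems(2) by simp
    qed
    then show ?thesis using False by (simp add: count_list_0_iff)
  qed (use Cons in auto)
qed simp

text \<open>In a weakly decreasing word all \<open>i + 2\<close> precede all \<open>i + 1\<close>,
  so the prefix ending after the last \<open>i + 2\<close> is the critical one.\<close>

lemma ballot_from_sorted_iff:
  assumes "sorted_wrt (\<ge>) w"
  shows "ballot_from al w \<longleftrightarrow> antimono al \<and> (\<forall>i. al (Suc i) + content w (Suc i) \<le> al i)"
proof
  assume b: "ballot_from al w"
  have "al (Suc i) + content w (Suc i) \<le> al i" for i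
  proof -
    let ?u = "takeWhile (\<lambda>a. Suc (Suc i) \<le> a) w"
    have "prefix ?u w" by (rule takeWhile_is_prefix)
    then have "antimono (\<lambda>i. al i + content ?u i)" using b by (simp add: ballot_from_def)
    from antimonoD[OF this, of i "Suc i"]
    have "al (Suc i) + content ?u (Suc i) \<le> al i + content ?u i" by simp
    moreover have "content ?u (Suc i) = content w (Suc i)"
      unfolding content_def by (rule count_list_takeWhile_sorted[OF assms]) simp
    moreover have "Suc i \<notin> set ?u" by (auto dest: set_takeWhileD)
    then have "content ?u i = 0" by (simp add: content_def count_list_0_iff)
    ultimately show ?thesis by simp
  qed
  then show "antimono al \<and> (\<forall>i. al (Suc i) + content w (Suc i) \<le> al i)"
    using ballot_from_imp_antimono(1)[OF b] by blast
next
  assume l: "antimono al \<and> (\<forall>i. al (Suc i) + content w (Suc i) \<le> al i)"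
  show "ballot_from al w"
    unfolding ballot_from_def antimono_iff_le_Suc
  proof (intro allI impI)
    fix u i assume "prefix u w"
    then obtain v where "w = u @ v" by (auto simp: prefix_def)
    then show "al (Suc i) + content u (Suc i) \<le> al i + content u i"
      using l[THEN conjunct2, rule_format, of i] by (simp add: content_append)
  qed
qed

lemma content_concat: "content (concat (map R [0..<m])) a = (\<Sum>r<m. content (R r) a)"
  by (induction m) (simp_all add: content_append, simp add: content_def)

text \<open>Rows are decreasing words, so each row and letter has one critical moment; the
  inequality there is the negation of \<open>violation\<close>.\<close>

lemma ballot_from_concat_iff:
  assumes "antimono al" "\<And>r. sorted_wrt (\<ge>) (R r)"
  shows "ballot_from al (concat (map R [0..<m])) \<longleftrightarrow>
    (\<forall>r<m. \<forall>i. al (Suc i) + (\<Sum>s\<le>r. content (R s) (Suc i)) \<le> al i + (\<Sum>s<r. content (R s) i))"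
proof (induction m)
  case 0
  show ?case using assms(1) by (simp add: ballot_from_def content_def)
next
  case (Suc m)
  have "ballot_from al (concat (map R [0..<Suc m])) \<longleftrightarrow> ballot_from al (concat (map R [0..<m])) \<and>
      (\<forall>i. al (Suc i) + content (concat (map R [0..<m])) (Suc i) + content (R m) (Suc i) \<le>
        al i + content (concat (map R [0..<m])) i)"
    using ballot_from_imp_antimono(2)[of al "concat (map R [0..<m])"]
    by (auto simp: ballot_from_append ballot_from_sorted_iff[OF assms(2)])
  also have "\<dots> \<longleftrightarrow> (\<forall>r<Suc m. \<forall>i. al (Suc i) + (\<Sum>s\<le>r. content (R s) (Suc i)) \<le> al i + (\<Sum>s<r. content (R s) i))"
    unfolding Suc.IH content_concat by (auto simp: less_Suc_eq add.assoc simp flip: lessThan_Suc_atMost)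
  finally show ?case .
qed

text \<open>\<open>c r\<close> is the column where row \<open>r\<close> starts, as needed for the
  shifted upper part of the composite shape.\<close>

lemma reverse_row_word_rows:
  assumes "fst ` D = {..<q}" "\<And>r. r < q \<Longrightarrow> {j. (r, j) \<in> D} = {c r..<c r + m r}"
  shows "reverse_row_word D T = concat (map (\<lambda>r. row_word (\<lambda>j. T (r, j + c r)) (m r)) [0..<q])"
proof -
  have "concat (map (\<lambda>j. rev (sorted_list_of_set (T (r, j)))) (rev (sorted_list_of_set {j. (r, j) \<in> D}))) =
      row_word (\<lambda>j. T (r, j + c r)) (m r)" if "r < q" for r
  proof -
    have "sorted_list_of_set {j. (r, j) \<in> D} = [c r..<c r + m r]"
      using assms(2)[OF that] by simp
    also have "\<dots> = map (\<lambda>j. j + c r) [0..<m r]"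
      by (simp add: map_add_upt add.commute)
    finally show ?thesis by (simp add: row_word_def rev_map comp_def)
  qed
  moreover have "sorted_list_of_set (fst ` D) = [0..<q]"
    unfolding assms(1) by (simp add: lessThan_atLeast0)
  ultimately show ?thesis
    unfolding reverse_row_word_def by (intro arg_cong[of _ _ concat] map_cong) simp_all
qed

text \<open>Trailing empty rows contribute nothing; the free bound \<open>q\<close> brings any row
  index, however large, into range.\<close>

lemma reverse_row_word_diagram:
  assumes mu: "mu \<in> partitions" and q: "num_parts mu \<le> q"
  shows "reverse_row_word (diagram mu) T = concat (map (\<lambda>r. row_word (\<lambda>j. T (r, j)) (mu r)) [0..<q])"
proof -
  let ?R = "\<lambda>r. row_word (\<lambda>j. T (r, j)) (mu r)"
  have "r \<in> fst ` diagram mu \<longleftrightarrow> mu r \<noteq> 0" for r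
    by (auto simp: diagram_Sigma image_iff)
  then have "fst ` diagram mu = {r. mu r \<noteq> 0}" by blast
  also have "\<dots> = {..<num_parts mu}" using num_parts_iff[OF mu] by auto
  finally have "reverse_row_word (diagram mu) T = concat (map ?R [0..<num_parts mu])"
    using reverse_row_word_rows[of "diagram mu" "num_parts mu" "\<lambda>_. 0" mu T]
    by (simp add: diagram_def atLeast0LessThan lessThan_def)
  moreover have "concat (map ?R [num_parts mu..<q]) = []"
  proof -
    have "mu r = 0" if "num_parts mu \<le> r" for r using num_parts_iff[OF mu, of r] that by simp
    then show ?thesis by (simp add: concat_eq_Nil_conv)
  qed
  moreover have "[0..<q] = [0..<num_parts mu] @ [num_parts mu..<q]"
    using upt_add_eq_append[of 0 "num_parts mu" "q - num_parts mu"] q by simp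
  ultimately show ?thesis by simp
qed

lemma content_ssvt:
  assumes T: "T \<in> ssvt n mu" and mu: "antimono mu"
  shows "content (row_word (\<lambda>j. T (r, j)) (mu r)) a = pcount (pattern_of mu T) a r"
  unfolding pcount_pattern_of[OF T mu] by (rule content_row_word) (rule ssvt_box(2)[OF T])

lemma sorted_ssvt_row:
  assumes T: "T \<in> ssvt n mu"
  shows "sorted_wrt (\<ge>) (row_word (\<lambda>j. T (r, j)) (mu r))"
proof (rule sorted_row_word)
  show "finite (T (r, j))" if "j < mu r" for j using ssvt_box(2)[OF T that] .
  show "a \<le> b" if "j < j'" "j' < mu r" "a \<in> T (r, j)" "b \<in> T (r, j')" for j j' a b
    using ssvt_row[OF T Suc_leI[OF that(1)] that(2-4)] .
qed

lemma content_reverse_row_word: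
  assumes T: "T \<in> ssvt n mu" and mu: "mu \<in> partitions"
  shows "content (reverse_row_word (diagram mu) T) = pcontent n (pattern_of mu T)"
proof
  fix a
  have anti: "antimono mu" using mu by (simp add: partitions_def)
  have "num_parts mu \<le> n"
    using num_parts_iff[OF mu, of n] ssvt_rows[OF T anti, of n] by simp
  then show "content (reverse_row_word (diagram mu) T) a = pcontent n (pattern_of mu T) a"
    by (simp add: reverse_row_word_diagram[OF mu] content_concat content_ssvt[OF T anti] pcontent_def)
qed

lemma ballot_from_reverse_row_word_iff:
  assumes T: "T \<in> ssvt n mu" and mu: "mu \<in> partitions" and al: "antimono al"
  shows "ballot_from al (reverse_row_word (diagram mu) T) \<longleftrightarrow> pattern_of mu T \<in> ballot_patterns n mu al"
proof -
  have anti: "antimono mu" using mu by (simp add: partitions_def)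
  have *: "ballot_from al (reverse_row_word (diagram mu) T) \<longleftrightarrow> (\<forall>r<m. \<forall>i. \<not> violation al (pattern_of mu T) r i)"
    if "num_parts mu \<le> m" for m
    unfolding reverse_row_word_diagram[OF mu that] ballot_from_concat_iff[OF al sorted_ssvt_row[OF T]]
    by (simp add: content_ssvt[OF T anti] violation_def not_less)
  have "ballot_from al (reverse_row_word (diagram mu) T) \<longleftrightarrow> (\<forall>r i. \<not> violation al (pattern_of mu T) r i)"
  proof (intro iffI allI)
    fix r i assume "ballot_from al (reverse_row_word (diagram mu) T)"
    \<comment> \<open>Padding by empty rows brings row \<open>r\<close> into the tested
      range.\<close>
    then show "\<not> violation al (pattern_of mu T) r i"
      using *[of "num_parts mu + Suc r"] by simp
  qed (use *[of "num_parts mu"] in simp)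
  then show ?thesis
    using pattern_of_in_patterns[OF T anti] by (simp add: ballot_patterns_def)
qed

section \<open>Tableaux on two diagrams touching at a corner\<close>

definition upper_tableau :: "(nat \<Rightarrow> nat) \<Rightarrow> (nat \<Rightarrow> nat) \<Rightarrow> (box \<Rightarrow> nat set) \<Rightarrow> box \<Rightarrow> nat set" where
  "upper_tableau mu la T = restrict (\<lambda>(i, j). T (i, j + mu 0)) (diagram la)"

definition lower_tableau :: "(nat \<Rightarrow> nat) \<Rightarrow> (nat \<Rightarrow> nat) \<Rightarrow> (box \<Rightarrow> nat set) \<Rightarrow> box \<Rightarrow> nat set" where
  "lower_tableau mu la T = restrict (\<lambda>(i, j). T (i + num_parts la, j)) (diagram mu)"

definition join_tableaux :: "(nat \<Rightarrow> nat) \<Rightarrow> (nat \<Rightarrow> nat) \<Rightarrow> (box \<Rightarrow> nat set) \<Rightarrow> (box \<Rightarrow> nat set) \<Rightarrow> box \<Rightarrow> nat set" where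
  "join_tableaux mu la T1 T2 = restrict (\<lambda>(i, j). if i < num_parts la then T1 (i, j - mu 0)
     else T2 (i - num_parts la, j)) (oplus_shape mu la)"

lemma mem_oplus_shape_iff:
  assumes "la \<in> partitions"
  shows "(i, j) \<in> oplus_shape mu la \<longleftrightarrow>
    (if i < num_parts la then mu 0 \<le> j \<and> j < mu 0 + la i else j < mu (i - num_parts la))"
proof -
  have "(i, j) \<in> oplus_shape mu la \<longleftrightarrow>
      (\<exists>c. j = c + mu 0 \<and> c < la i) \<or> (\<exists>r. i = r + num_parts la \<and> j < mu r)"
    by (auto simp: oplus_shape_def diagram_def)
  also have "(\<exists>c. j = c + mu 0 \<and> c < la i) \<longleftrightarrow> i < num_parts la \<and> mu 0 \<le> j \<and> j < mu 0 + la i"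
  proof
    assume "\<exists>c. j = c + mu 0 \<and> c < la i"
    then show "i < num_parts la \<and> mu 0 \<le> j \<and> j < mu 0 + la i"
      using num_parts_iff[OF assms, of i] by auto
  next
    assume "i < num_parts la \<and> mu 0 \<le> j \<and> j < mu 0 + la i"
    then show "\<exists>c. j = c + mu 0 \<and> c < la i" by (intro exI[of _ "j - mu 0"]) auto
  qed
  also have "(\<exists>r. i = r + num_parts la \<and> j < mu r) \<longleftrightarrow> num_parts la \<le> i \<and> j < mu (i - num_parts la)"
    by (metis add_diff_cancel_right' le_add2 le_add_diff_inverse2)
  finally show ?thesis by auto
qed

context
  fixes la mu :: "nat \<Rightarrow> nat"
  assumes la: "la \<in> partitions" and mu: "mu \<in> partitions"
begin

lemma split_tableau:
  assumes T: "T \<in> set_valued_tableaux (oplus_shape mu la) {1..n}" and ss: "semistandard (oplus_shape mu la) T"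
  shows "upper_tableau mu la T \<in> ssvt n la" "lower_tableau mu la T \<in> ssvt n mu"
    "join_tableaux mu la (upper_tableau mu la T) (lower_tableau mu la T) = T"
proof -
  note mem = mem_oplus_shape_iff[OF la, of _ _ mu]
  note parts = num_parts_iff[OF la]
  have up: "(i, j + mu 0) \<in> oplus_shape mu la" if "j < la i" for i j
    using that parts[of i] by (auto simp: mem)
  have low: "(i + num_parts la, j) \<in> oplus_shape mu la" if "j < mu i" for i j
    using that by (auto simp: mem)
  have box: "T b \<noteq> {}" "finite (T b)" "T b \<subseteq> {1..n}" if "b \<in> oplus_shape mu la" for b
    using T that by (auto simp: set_valued_tableaux_def PiE_iff)
  have row: "Max (T (i, j)) \<le> Min (T (i, Suc j))" if "(i, j) \<in> oplus_shape mu la" "(i, Suc j) \<in> oplus_shape mu la" for i j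
    using ss that by (simp add: semistandard_def)
  have col: "Max (T (i, j)) < Min (T (Suc i, j))" if "(i, j) \<in> oplus_shape mu la" "(Suc i, j) \<in> oplus_shape mu la" for i j
    using ss that by (simp add: semistandard_def)
  show "upper_tableau mu la T \<in> ssvt n la"
    using box[OF up] row[OF up] col[OF up] up up[of "Suc _"] up[of _ "Suc _"]
    by (auto simp: ssvt_def set_valued_tableaux_def semistandard_def upper_tableau_def diagram_def PiE_iff
        simp del: Max_less_iff Min_gr_iff Max.bounded_iff Min.bounded_iff)
  show "lower_tableau mu la T \<in> ssvt n mu"
    using box[OF low] row[OF low] col[OF low] low low[of "Suc _"] low[of _ "Suc _"]
    by (auto simp: ssvt_def set_valued_tableaux_def semistandard_def lower_tableau_def diagram_def PiE_iff
        simp del: Max_less_iff Min_gr_iff Max.bounded_iff Min.bounded_iff)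
  show "join_tableaux mu la (upper_tableau mu la T) (lower_tableau mu la T) = T"
  proof
    fix b :: box
    obtain i j where b: "b = (i, j)" by force
    show "join_tableaux mu la (upper_tableau mu la T) (lower_tableau mu la T) b = T b"
    proof (cases "(i, j) \<in> oplus_shape mu la")
      case True
      then show ?thesis
        by (auto simp: b join_tableaux_def upper_tableau_def lower_tableau_def mem diagram_def split: if_splits)
    next
      case False
      then show ?thesis
        using T by (auto simp: b join_tableaux_def set_valued_tableaux_def PiE_iff extensional_def)
    qed
  qed
qed

lemma join_tableaux_props:
  assumes T1: "T1 \<in> ssvt n la" and T2: "T2 \<in> ssvt n mu"
  defines "T \<equiv> join_tableaux mu la T1 T2"
  shows "T \<in> set_valued_tableaux (oplus_shape mu la) {1..n}" "semistandard (oplus_shape mu la) T"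
    "upper_tableau mu la T = T1" "lower_tableau mu la T = T2"
proof -
  note mem = mem_oplus_shape_iff[OF la, of _ _ mu]
  note parts = num_parts_iff[OF la]
  have anti: "antimono mu" using mu by (simp add: partitions_def)
  have T: "T (i, j) = (if i < num_parts la then T1 (i, j - mu 0) else T2 (i - num_parts la, j))"
    if "(i, j) \<in> oplus_shape mu la" for i j
    using that by (simp add: T_def join_tableaux_def)
  note b1 = ssvt_box[OF T1] and b2 = ssvt_box[OF T2]
  have ss1: "Suc j < la i \<Longrightarrow> Max (T1 (i, j)) \<le> Min (T1 (i, Suc j))"
    "j < la i \<Longrightarrow> j < la (Suc i) \<Longrightarrow> Max (T1 (i, j)) < Min (T1 (Suc i, j))" for i j
    using T1 by (auto simp: ssvt_def semistandard_def diagram_def)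
  have ss2: "Suc j < mu i \<Longrightarrow> Max (T2 (i, j)) \<le> Min (T2 (i, Suc j))"
    "j < mu i \<Longrightarrow> j < mu (Suc i) \<Longrightarrow> Max (T2 (i, j)) < Min (T2 (Suc i, j))" for i j
    using T2 by (auto simp: ssvt_def semistandard_def diagram_def)
  have "T (i, j) \<noteq> {} \<and> finite (T (i, j)) \<and> T (i, j) \<subseteq> {1..n}" if "(i, j) \<in> oplus_shape mu la" for i j
  proof (cases "i < num_parts la")
    case True
    then have "j - mu 0 < la i" using that by (auto simp: mem)
    from b1[OF this] show ?thesis using True by (simp add: T[OF that])
  next
    case False
    then have "j < mu (i - num_parts la)" using that by (auto simp: mem)
    from b2[OF this] show ?thesis using False by (simp add: T[OF that])
  qed
  then show "T \<in> set_valued_tableaux (oplus_shape mu la) {1..n}"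
    by (auto simp: set_valued_tableaux_def PiE_iff T_def join_tableaux_def)
  have "Max (T (i, j)) \<le> Min (T (i, Suc j))" if "(i, j) \<in> oplus_shape mu la" "(i, Suc j) \<in> oplus_shape mu la" for i j
    using that ss1(1)[of "j - mu 0" i] ss2(1)[of j "i - num_parts la"]
    unfolding T[OF that(1)] T[OF that(2)] by (auto simp: mem Suc_diff_le split: if_splits)
  moreover have "Max (T (i, j)) < Min (T (Suc i, j))" if m: "(i, j) \<in> oplus_shape mu la" "(Suc i, j) \<in> oplus_shape mu la" for i j
  proof -
    consider "Suc i < num_parts la" | "Suc i = num_parts la" | "num_parts la \<le> i" by linarith
    then show ?thesis
    proof cases
      case 1
      then show ?thesis
        using m ss1(2)[of "j - mu 0" i] unfolding T[OF m(1)] T[OF m(2)] by (auto simp: mem split: if_splits)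
    next
      \<comment> \<open>The last row of \<open>la\<close> starts at column \<open>mu 0\<close> and
        the first row of \<open>mu\<close> ends before it, so no box of one lies above a box of the
        other.\<close>
      case 2
      then show ?thesis using m by (auto simp: mem)
    next
      case 3
      then show ?thesis
        using m ss2(2)[of j "i - num_parts la"] unfolding T[OF m(1)] T[OF m(2)]
        by (auto simp: mem Suc_diff_le split: if_splits)
    qed
  qed
  ultimately show "semistandard (oplus_shape mu la) T"
    by (simp add: semistandard_def)
  have up: "(i, j + mu 0) \<in> oplus_shape mu la \<and> i < num_parts la" if "j < la i" for i j
    using that parts[of i] by (auto simp: mem)
  have low: "(i + num_parts la, j) \<in> oplus_shape mu la" if "j < mu i" for i j
    using that by (auto simp: mem)
  show "upper_tableau mu la T = T1"
  proof
    fix b :: box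
    show "upper_tableau mu la T b = T1 b"
      using T1 up[of "snd b" "fst b"]
      by (cases b) (auto simp: upper_tableau_def diagram_def T ssvt_def set_valued_tableaux_def PiE_iff extensional_def restrict_def)
  qed
  show "lower_tableau mu la T = T2"
  proof
    fix b :: box
    show "lower_tableau mu la T b = T2 b"
      using T2 low[of "snd b" "fst b"]
      by (cases b) (auto simp: lower_tableau_def diagram_def T ssvt_def set_valued_tableaux_def PiE_iff extensional_def restrict_def)
  qed
qed

text \<open>The rows of \<open>la\<close> are on top and are read first; the column shift is
  invisible in the word.\<close>

lemma reverse_row_word_oplus:
  "reverse_row_word (oplus_shape mu la) T =
    reverse_row_word (diagram la) (upper_tableau mu la T) @ reverse_row_word (diagram mu) (lower_tableau mu la T)"
proof -
  let ?D = "oplus_shape mu la" and ?p = "num_parts la" and ?q = "num_parts mu"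
  note mem = mem_oplus_shape_iff[OF la, of _ _ mu]
  define c where "c i = (if i < ?p then mu 0 else 0)" for i
  define m where "m i = (if i < ?p then la i else mu (i - ?p))" for i
  have cols: "{j. (i, j) \<in> ?D} = {c i..<c i + m i}" for i
    by (auto simp: mem c_def m_def)
  have "m i \<noteq> 0 \<longleftrightarrow> i < ?p + ?q" for i
    using num_parts_iff[OF la, of i] num_parts_iff[OF mu, of "i - ?p"] by (auto simp: m_def)
  moreover have "i \<in> fst ` ?D \<longleftrightarrow> m i \<noteq> 0" for i
  proof -
    have "i \<in> fst ` ?D \<longleftrightarrow> {j. (i, j) \<in> ?D} \<noteq> {}" by force
    then show ?thesis by (simp add: cols)
  qed
  ultimately have "fst ` ?D = {..<?p + ?q}" by blast
  then have "reverse_row_word ?D T = concat (map (\<lambda>i. row_word (\<lambda>j. T (i, j + c i)) (m i)) [0..<?p + ?q])"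
    using cols by (rule reverse_row_word_rows)
  also have "[0..<?p + ?q] = [0..<?p] @ map (\<lambda>i. i + ?p) [0..<?q]"
    by (simp only: map_add_upt add.commute[of ?q ?p] upt_add_eq_append[OF le0])
  also have "concat (map (\<lambda>i. row_word (\<lambda>j. T (i, j + c i)) (m i)) \<dots>) =
      concat (map (\<lambda>i. row_word (\<lambda>j. T (i, j + c i)) (m i)) [0..<?p]) @
      concat (map (\<lambda>i. row_word (\<lambda>j. T (i + ?p, j + c (i + ?p))) (m (i + ?p))) [0..<?q])"
    by (simp add: comp_def)
  also have "concat (map (\<lambda>i. row_word (\<lambda>j. T (i, j + c i)) (m i)) [0..<?p]) =
      reverse_row_word (diagram la) (upper_tableau mu la T)"
    unfolding reverse_row_word_diagram[OF la order_refl]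
    by (intro arg_cong[of _ _ concat] map_cong refl)
      (auto simp: c_def m_def upper_tableau_def diagram_def intro!: row_word_cong)
  also have "concat (map (\<lambda>i. row_word (\<lambda>j. T (i + ?p, j + c (i + ?p))) (m (i + ?p))) [0..<?q]) =
      reverse_row_word (diagram mu) (lower_tableau mu la T)"
    unfolding reverse_row_word_diagram[OF mu order_refl]
    by (intro arg_cong[of _ _ concat] map_cong refl)
      (auto simp: c_def m_def lower_tableau_def diagram_def intro!: row_word_cong)
  finally show ?thesis .
qed

end

section \<open>The expansion and its uniqueness\<close>

definition lr_tableaux :: "nat \<Rightarrow> (nat \<Rightarrow> nat) \<Rightarrow> (nat \<Rightarrow> nat) \<Rightarrow> (nat \<Rightarrow> nat) \<Rightarrow> ((nat \<Rightarrow> nat) \<times> (box \<Rightarrow> nat set)) set" where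
  "lr_tableaux k la mu nu = {(mup, T).
      mup \<in> partitions \<and>
      (\<exists>S \<subseteq> outer_corners mu. diagram mup = diagram mu \<union> S) \<and>
      T \<in> set_valued_tableaux (oplus_shape mup la) {1..k} \<and>
      semistandard (oplus_shape mup la) T \<and>
      ballot (reverse_row_word (oplus_shape mup la) T) \<and>
      content (reverse_row_word (oplus_shape mup la) T) = nu}"

lemma lr_tableaux_iff:
  "(mup, T) \<in> lr_tableaux k la mu nu \<longleftrightarrow> mup \<in> corner_extensions mu \<and>
      T \<in> set_valued_tableaux (oplus_shape mup la) {1..k} \<and>
      semistandard (oplus_shape mup la) T \<and>
      ballot (reverse_row_word (oplus_shape mup la) T) \<and>
      content (reverse_row_word (oplus_shape mup la) T) = nu"
  by (auto simp: lr_tableaux_def corner_extensions_def)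

lemma set_reverse_row_word:
  assumes "finite D" "\<And>b. b \<in> D \<Longrightarrow> finite (T b)" "b \<in> D" "a \<in> T b"
  shows "a \<in> set (reverse_row_word D T)"
proof -
  obtain i j where b: "b = (i, j)" by force
  have "finite {j. (i, j) \<in> D}"
    by (rule finite_subset[of _ "snd ` D"]) (use assms(1) in force)+
  then show ?thesis
    using assms unfolding b reverse_row_word_def by (force simp: image_iff)
qed

lemma finite_oplus_shape:
  assumes "la \<in> partitions" "mu \<in> partitions"
  shows "finite (oplus_shape mu la)"
  using assms by (auto simp: oplus_shape_def diagram_Sigma partitions_def)

text \<open>A letter beyond \<open>num_parts nu\<close> would make a further entry of the content
  nonzero. Hence the count does not depend on the alphabet, and one coefficient serves every number
  of variables.\<close>

lemma lr_tableaux_alphabet: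
  assumes la: "la \<in> partitions" and nu: "nu \<in> partitions" and k: "num_parts nu \<le> k"
  shows "lr_tableaux k la mu nu = lr_tableaux (num_parts nu) la mu nu"
proof -
  have "T \<in> set_valued_tableaux (oplus_shape mup la) {1..num_parts nu}"
    if "mup \<in> partitions" "T \<in> set_valued_tableaux (oplus_shape mup la) {1..k}"
      "content (reverse_row_word (oplus_shape mup la) T) = nu" for mup T
  proof -
    have "T b \<subseteq> {1..num_parts nu}" if b: "b \<in> oplus_shape mup la" for b
    proof
      fix a assume a: "a \<in> T b"
      have box: "finite (T d)" "T d \<subseteq> {1..k}" if "d \<in> oplus_shape mup la" for d
        using \<open>T \<in> _\<close> that by (auto simp: set_valued_tableaux_def PiE_iff)
      have "a \<in> set (reverse_row_word (oplus_shape mup la) T)"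
        using finite_oplus_shape[OF la \<open>mup \<in> partitions\<close>] box(1) b a by (rule set_reverse_row_word)
      moreover have "1 \<le> a" using box(2)[OF b] a by auto
      ultimately have "content (reverse_row_word (oplus_shape mup la) T) (a - 1) \<noteq> 0"
        by (simp add: content_def count_list_0_iff)
      then have "a - 1 < num_parts nu"
        using num_parts_iff[OF nu, of "a - 1"] that by (simp add: \<open>content _ = nu\<close>)
      then show "a \<in> {1..num_parts nu}" using \<open>1 \<le> a\<close> by simp
    qed
    then show ?thesis using that(2) by (auto simp: set_valued_tableaux_def PiE_iff)
  qed
  moreover have "set_valued_tableaux D {1..num_parts nu} \<subseteq> set_valued_tableaux D {1..k}" for D
    unfolding set_valued_tableaux_def by (rule PiE_mono) (use k in auto)
  ultimately show ?thesis
    unfolding lr_tableaux_def by blast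
qed

text \<open>The part of the word on \<open>la\<close> is ballot from 0, hence superstandard with
  content \<open>la\<close>; the remaining word is then ballot from \<open>la\<close>. Dropping the
  forced upper part loses nothing.\<close>

lemma bij_lr_tableaux:
  assumes la: "la \<in> partitions" and n: "num_parts la \<le> n"
  shows "bij_betw (\<lambda>(mup, T). (mup, pattern_of mup (lower_tableau mup la T)))
    (lr_tableaux n la mu nu) {z \<in> lr_pairs n la mu. lr_content n la z = nu}"
proof (rule bij_betw_byWitness[where f' = "\<lambda>(mup, Z). (mup, join_tableaux mup la (tableau_of la (superstandard la)) (tableau_of mup Z))"])
  let ?F = "\<lambda>(mup, T). (mup, pattern_of mup (lower_tableau mup la T))"
  let ?G = "\<lambda>(mup, Z). (mup, join_tableaux mup la (tableau_of la (superstandard la)) (tableau_of mup Z))"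
  let ?R = "{z \<in> lr_pairs n la mu. lr_content n la z = nu}"
  have anti: "antimono la" using la by (simp add: partitions_def)
  have rows: "la r = 0" if "n \<le> r" for r using num_parts_iff[OF la, of r] n that by simp
  have mup: "mup \<in> partitions" "antimono mup" if "mup \<in> corner_extensions mu" for mup
    using that by (auto simp: corner_extensions_def partitions_def)
  have zero: "antimono (\<lambda>_. 0 :: nat)" by (simp add: antimono_def)
  have ss: "superstandard la \<in> patterns n la"
    using superstandard_in_patterns[OF anti] rows by blast
  have ss_unique: "T1 \<in> ssvt n la \<Longrightarrow> ballot_from (\<lambda>_. 0) (reverse_row_word (diagram la) T1) \<longleftrightarrow> pattern_of la T1 = superstandard la" for T1
    using ballot_patterns_zero[OF anti, of n] rows by (subst ballot_from_reverse_row_word_iff[OF _ la zero]) auto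
  have key: "ballot (reverse_row_word (oplus_shape mup la) T) \<and> content (reverse_row_word (oplus_shape mup la) T) = nu \<longleftrightarrow>
      pattern_of la (upper_tableau mup la T) = superstandard la \<and>
      pattern_of mup (lower_tableau mup la T) \<in> ballot_patterns n mup la \<and>
      lr_content n la (mup, pattern_of mup (lower_tableau mup la T)) = nu"
    if m: "mup \<in> partitions" and T1: "upper_tableau mup la T \<in> ssvt n la" and T2: "lower_tableau mup la T \<in> ssvt n mup" for mup T
  proof -
    have c1: "content (reverse_row_word (diagram la) (upper_tableau mup la T)) = la"
      if "pattern_of la (upper_tableau mup la T) = superstandard la"
      using content_reverse_row_word[OF T1 la] pcontent_superstandard[of n la] rows that by simp
    show ?thesis
      unfolding reverse_row_word_oplus[OF la m] ballot_eq_ballot_from ballot_from_append ss_unique[OF T1] content_append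
      \<comment> \<open>The content of the upper part is known only once it is superstandard, so the
        other conjuncts are compared under that assumption.\<close>
      by (rule conj_cong[OF refl, THEN trans, rotated])
        (auto simp: c1 ballot_from_reverse_row_word_iff[OF T2 m anti] content_reverse_row_word[OF T2 m] lr_content_def)
  qed
  show "\<forall>z\<in>lr_tableaux n la mu nu. ?G (?F z) = z"
  proof
    fix z assume z: "z \<in> lr_tableaux n la mu nu"
    obtain mup T where zz: "z = (mup, T)" by force
    note z = z[unfolded zz lr_tableaux_iff]
    note m = mup[OF z[THEN conjunct1]]
    note sp = split_tableau[OF la m(1), of T n]
    have "pattern_of la (upper_tableau mup la T) = superstandard la"
      using key[OF m(1) sp(1,2)] z by blast
    then have "upper_tableau mup la T = tableau_of la (superstandard la)"
      using tableau_of_pattern_of[OF sp(1) anti] z by simp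
    moreover have "lower_tableau mup la T = tableau_of mup (pattern_of mup (lower_tableau mup la T))"
      using tableau_of_pattern_of[OF sp(2) m(2)] z by simp
    ultimately show "?G (?F z) = z" using sp(3) z by (simp add: zz)
  qed
  show "?F ` lr_tableaux n la mu nu \<subseteq> ?R"
  proof
    fix w assume "w \<in> ?F ` lr_tableaux n la mu nu"
    then obtain mup T where z: "(mup, T) \<in> lr_tableaux n la mu nu" and w: "w = (mup, pattern_of mup (lower_tableau mup la T))" by auto
    note z = z[unfolded lr_tableaux_iff]
    note m = mup[OF z[THEN conjunct1]]
    show "w \<in> ?R"
      using key[OF m(1) split_tableau(1,2)[OF la m(1), of T n]] z by (auto simp: w lr_pairs_def)
  qed
  have G: "?F (?G z) = z \<and> ?G z \<in> lr_tableaux n la mu nu" if z: "z \<in> ?R" for z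
  proof -
    obtain mup Z where zz: "z = (mup, Z)" by (rule prod.exhaust)
    have m: "mup \<in> corner_extensions mu" and Z: "Z \<in> ballot_patterns n mup la" and c: "lr_content n la (mup, Z) = nu"
      using z by (auto simp: zz lr_pairs_def)
    have Zp: "Z \<in> patterns n mup" using Z by (simp add: ballot_patterns_def)
    have T1: "tableau_of la (superstandard la) \<in> ssvt n la"
      using tableau_of_in_ssvt[of "fst (superstandard la)" "snd (superstandard la)" n la] ss anti by simp
    have T2: "tableau_of mup Z \<in> ssvt n mup"
      using tableau_of_in_ssvt[of "fst Z" "snd Z" n mup] Zp mup[OF m] by simp
    note J = join_tableaux_props[OF la mup(1)[OF m] T1 T2]
    have p1: "pattern_of la (tableau_of la (superstandard la)) = superstandard la"
      by (rule pattern_of_tableau_of[OF ss anti])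
    have p2: "pattern_of mup (tableau_of mup Z) = Z"
      by (rule pattern_of_tableau_of[OF Zp mup(2)[OF m]])
    show ?thesis
      using key[OF mup(1)[OF m], of "join_tableaux mup la (tableau_of la (superstandard la)) (tableau_of mup Z)"]
        J m Z c T1 T2 by (simp add: zz p1 p2 lr_tableaux_iff)
  qed
  then show "\<forall>z\<in>?R. ?F (?G z) = z" by blast
  show "?G ` ?R \<subseteq> lr_tableaux n la mu nu" using G by blast
qed

lemma card_lr_tableaux:
  assumes "la \<in> partitions" "num_parts la \<le> n" "nu \<in> partitions" "num_parts nu \<le> n"
  shows "card (lr_tableaux (num_parts nu) la mu nu) = card {z \<in> lr_pairs n la mu. lr_content n la z = nu}"
  using bij_betw_same_card[OF bij_lr_tableaux[OF assms(1,2), of mu nu]] lr_tableaux_alphabet[OF assms(1,3,4), of mu]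
  by simp

text \<open>The alphabet is the least one that content \<open>nu\<close> permits; the value 0 off
  partitions is what \<open>is_expansion\<close> prescribes.\<close>

definition lr_coefficient :: "(nat \<Rightarrow> nat) \<Rightarrow> (nat \<Rightarrow> nat) \<Rightarrow> (nat \<Rightarrow> nat) \<Rightarrow> int" where
  "lr_coefficient la mu nu =
    (if nu \<in> partitions then int (card (lr_tableaux (num_parts nu) la mu nu)) else 0)"

lemma groth_nonzero_letters:
  assumes "mu \<in> partitions" "groth mu M \<noteq> 0"
  shows "0 \<notin># M"
proof -
  have fin: "finite (diagram mu)" using assms(1) by (auto simp: partitions_def diagram_Sigma)
  obtain T where "T \<in> groth_tableaux mu M" using assms(2) by (force simp: groth_def)
  then have "\<forall>b\<in>diagram mu. finite (T b) \<and> T b \<subseteq> {1..}" and M: "M = (\<Sum>b\<in>diagram mu. mset_set (T b))"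
    by (auto simp: groth_tableaux_def set_valued_tableaux_def PiE_iff tableau_monomial_def)
  then show ?thesis unfolding M set_mset_sum[OF fin] by fastforce
qed

lemma cal_groth_nonzeroE:
  assumes "cal_groth mu M \<noteq> 0"
  obtains A B where "A + B = M" "groth mu A \<noteq> 0" "B = {#} \<or> groth one_box B \<noteq> 0"
proof -
  obtain A B where "A + B = M" "groth mu A * series_minus series_one (groth one_box) B \<noteq> 0"
    using assms unfolding cal_groth_def series_times_def
    by (force elim!: sum.not_neutral_contains_not_neutral)
  then show ?thesis
    using that[of A B] by (auto simp: series_minus_def series_one_def split: if_splits)
qed

lemma cal_groth_nonzero_letters:
  assumes "mu \<in> partitions" "cal_groth mu M \<noteq> 0"
  shows "0 \<notin># M"
  using assms(2)
proof (cases rule: cal_groth_nonzeroE)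
  case (1 A B)
  then show ?thesis
    using groth_nonzero_letters[OF assms(1), of A] groth_nonzero_letters[OF one_box_in_partitions, of B] by auto
qed

text \<open>Columns increase strictly, so with \<open>n\<close> letters there is no tableau with
  more than \<open>n\<close> rows.\<close>

lemma cal_groth_nonzero_num_parts:
  assumes "nu \<in> partitions" "cal_groth nu M \<noteq> 0" "set_mset M \<subseteq> {1..n}"
  shows "num_parts nu \<le> n"
  using assms(2)
proof (cases rule: cal_groth_nonzeroE)
  case (1 A B)
  then have "set_mset A \<subseteq> {1..n}" using assms(3) by auto
  then have "(\<Sum>Z | Z \<in> patterns n nu \<and> pmonomial n Z = A. psign n Z :: int) \<noteq> 0"
    using 1(2) groth_eq[OF _ assms(1)] by simp
  then obtain Z where "Z \<in> {Z. Z \<in> patterns n nu \<and> pmonomial n Z = A}"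
    by (rule sum.not_neutral_contains_not_neutral)
  then have "(fst Z, snd Z) \<in> patterns n nu" by simp
  then have "nu n = 0" using pattern_rows(3)[of _ _ n nu n] by blast
  then show ?thesis using num_parts_iff[OF assms(1), of n] by simp
qed

lemma eval_sum:
  fixes x :: "nat \<Rightarrow> 'a::comm_ring_1"
  assumes "finite I" "\<And>i. i \<in> I \<Longrightarrow> finite (letter_support n (F i))"
  shows "finite (letter_support n (\<lambda>M. \<Sum>i\<in>I. a i * F i M))"
    "eval_series n (\<lambda>M. \<Sum>i\<in>I. a i * F i M) x = (\<Sum>i\<in>I. of_int (a i) * eval_series n (F i) x)"
proof -
  let ?f = "\<lambda>M. \<Sum>i\<in>I. a i * F i M"
  let ?S = "\<Union>i\<in>I. letter_support n (F i)"
  have S: "finite ?S" "\<And>M. M \<in> ?S \<Longrightarrow> set_mset M \<subseteq> {1..n}"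
    using assms by (auto simp: letter_support_def)
  have sub: "letter_support n ?f \<subseteq> ?S"
  proof
    fix M assume "M \<in> letter_support n ?f"
    then have M: "set_mset M \<subseteq> {1..n}" "?f M \<noteq> 0" by (auto simp: letter_support_def)
    from M(2) obtain i where "i \<in> I" "a i * F i M \<noteq> 0" by (rule sum.not_neutral_contains_not_neutral)
    then show "M \<in> ?S" using M(1) by (auto simp: letter_support_def)
  qed
  then show "finite (letter_support n ?f)" using S(1) finite_subset by blast
  have "eval_series n ?f x = (\<Sum>M\<in>?S. of_int (?f M) * eval_monomial x M)"
    by (rule eval_series_superset[OF S(1) sub S(2)])
  also have "\<dots> = (\<Sum>i\<in>I. \<Sum>M\<in>?S. of_int (a i) * (of_int (F i M) * eval_monomial x M))"
    by (simp add: sum_distrib_right mult.assoc) (rule sum.swap)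
  also have "\<dots> = (\<Sum>i\<in>I. of_int (a i) * eval_series n (F i) x)"
  proof (rule sum.cong[OF refl])
    fix i assume "i \<in> I"
    then have "eval_series n (F i) x = (\<Sum>M\<in>?S. of_int (F i M) * eval_monomial x M)"
      by (intro eval_series_superset[OF S(1) _ S(2)]) auto
    then show "(\<Sum>M\<in>?S. of_int (a i) * (of_int (F i M) * eval_monomial x M)) = of_int (a i) * eval_series n (F i) x"
      by (simp add: sum_distrib_left)
  qed
  finally show "eval_series n ?f x = (\<Sum>i\<in>I. of_int (a i) * eval_series n (F i) x)" .
qed

text \<open>The identity is checked one monomial at a time, in a number of variables chosen for that
  monomial; there both sides become finite combinations, and Kronecker points decide
  equality.\<close>

lemma is_expansion_lr_coefficient:
  assumes la: "la \<in> partitions" and mu: "mu \<in> partitions"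
  shows "is_expansion la mu (lr_coefficient la mu)"
  unfolding is_expansion_def
proof (intro conjI allI impI)
  fix nu assume "nu \<notin> partitions"
  then show "lr_coefficient la mu nu = 0" by (simp add: lr_coefficient_def)
next
  fix M
  let ?f = "series_times (cal_groth la) (cal_groth mu)"
  let ?s = "\<lambda>nu. (- 1) ^ (psize nu + psize la + psize mu) :: int"
  let ?a = "\<lambda>nu. ?s nu * lr_coefficient la mu nu"
  let ?C = "{nu \<in> partitions. cal_groth nu M \<noteq> 0}"
  show "?f M = (\<Sum>nu\<in>?C. ?a nu * cal_groth nu M)"
  proof (cases "0 \<in># M")
    case True
    \<comment> \<open>Letters are positive, so both sides vanish on a monomial containing 0.\<close>
    have "?C = {}" using True cal_groth_nonzero_letters by auto
    moreover have "cal_groth la A * cal_groth mu B = 0" if "A + B = M" for A B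
      using cal_groth_nonzero_letters[OF la, of A] cal_groth_nonzero_letters[OF mu, of B] that True
      by (metis mult_eq_0_iff union_iff)
    then have "?f M = 0" unfolding series_times_def by (intro sum.neutral) auto
    ultimately show ?thesis by simp
  next
    case False
    \<comment> \<open>Enough variables for the letters of \<open>M\<close> and the rows of
      \<open>la\<close>, with a spare row below \<open>mu\<close> for a new corner.\<close>
    define n where "n = Max (insert 0 (set_mset M)) + num_parts la + Suc (num_parts mu)"
    have n: "num_parts la \<le> n" "num_parts mu < n" "1 \<le> n" by (auto simp: n_def)
    have M: "set_mset M \<subseteq> {1..n}"
    proof
      fix a assume a: "a \<in># M"
      then have "a \<le> Max (insert 0 (set_mset M))" by simp
      moreover have "a \<noteq> 0" using a False by metis
      ultimately show "a \<in> {1..n}" by (simp add: n_def)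
    qed
    have rla: "la r = 0" if "n \<le> r" for r using num_parts_iff[OF la, of r] n that by simp
    have rmu: "mu r = 0" if "n \<le> Suc r" for r using num_parts_iff[OF mu, of r] n that by simp
    define W where "W = lr_pairs n la mu"
    define I where "I = lr_content n la ` W"
    have finW: "finite W" unfolding W_def by (rule finite_lr_pairs[OF mu])
    have finI: "finite I" unfolding I_def using finW by simp
    have Ip: "nu \<in> partitions \<and> num_parts nu \<le> n" if "nu \<in> I" for nu
    proof -
      from that obtain z where z: "z \<in> W" "nu = lr_content n la z" unfolding I_def by blast
      have "snd z \<in> patterns n (fst z)" using z(1) by (auto simp: W_def lr_pairs_def ballot_patterns_def)
      then have "nu n = 0" using rla[of n] pcount_rows[of "snd z" n "fst z" _ n] by (simp add: z(2) lr_content_def pcontent_def)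
      moreover have "nu \<in> partitions" using lr_content_in_partitions[OF la] z by (simp add: W_def)
      ultimately show ?thesis using num_parts_iff[of nu n] by simp
    qed
    have coeff: "lr_coefficient la mu nu = int (card {z \<in> W. lr_content n la z = nu})" if "nu \<in> partitions" "num_parts nu \<le> n" for nu
      using card_lr_tableaux[OF la n(1) that, of mu] that by (simp add: lr_coefficient_def W_def)
    define g where "g M = (\<Sum>nu\<in>I. ?a nu * cal_groth nu M)" for M
    have ef: "finite (letter_support n ?f)"
      "eval_series n ?f x = gsum n la x * (1 - gsum n one_box x) * (gsum n mu x * (1 - gsum n one_box x))"
      for x :: "nat \<Rightarrow> int poly"
      using eval_times[OF eval_cal_groth(1)[OF la, of n] eval_cal_groth(1)[OF mu, of n]]
      by (simp_all add: eval_cal_groth la mu)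
    have eg: "finite (letter_support n g)"
      "eval_series n g x = (\<Sum>nu\<in>I. of_int (?a nu) * (gsum n nu x * (1 - gsum n one_box x)))"
      for x :: "nat \<Rightarrow> int poly"
    proof -
      have fin: "finite (letter_support n (cal_groth nu))" if "nu \<in> I" for nu
        using Ip[OF that] by (intro eval_cal_groth(1)) simp
      show "finite (letter_support n g)"
        unfolding g_def using finI fin by (rule eval_sum(1))
      have "eval_series n g x = (\<Sum>nu\<in>I. of_int (?a nu) * eval_series n (cal_groth nu) x)"
        unfolding g_def using finI fin by (rule eval_sum(2))
      also have "\<dots> = (\<Sum>nu\<in>I. of_int (?a nu) * (gsum n nu x * (1 - gsum n one_box x)))"
        using Ip by (intro sum.cong refl) (simp add: eval_cal_groth(2))
      finally show "eval_series n g x = (\<Sum>nu\<in>I. of_int (?a nu) * (gsum n nu x * (1 - gsum n one_box x)))" .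
    qed
    have "series_minus ?f g M = 0"
    proof (rule eval_series_kron_eq_0)
      show "finite (letter_support n (series_minus ?f g))" by (rule eval_minus(1)[OF ef(1) eg(1)])
      show "set_mset M \<subseteq> {1..n}" by (rule M)
      fix B assume "Suc n \<le> B"
      let ?x = "kron B" and ?u = "1 - gsum n one_box (kron B)"
      let ?t = "\<lambda>z. (- 1) ^ (psize (lr_content n la z) + psize la + psize mu) * gsum n (lr_content n la z) ?x"
      have nz: "alternant n (\<lambda>_. 0) ?x \<noteq> 0" using \<open>Suc n \<le> B\<close> by (intro alternant_zero_kron_nonzero) simp
      have "gsum n la ?x * (gsum n mu ?x * ?u) =
          (\<Sum>z\<in>W. ?t z)"
        unfolding W_def using la rla mu rmu n(3) nz by (rule gsum_product_expansion)
      also have "\<dots> = (\<Sum>nu\<in>I. \<Sum>z | z \<in> W \<and> lr_content n la z = nu.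
          ?t z)"
        unfolding I_def by (rule sum.image_gen[OF finW])
      also have "\<dots> = (\<Sum>nu\<in>I. of_int (?a nu) * gsum n nu ?x)"
      proof (rule sum.cong[OF refl])
        fix nu assume "nu \<in> I"
        then have c: "lr_coefficient la mu nu = int (card {z \<in> W. lr_content n la z = nu})" using Ip coeff by blast
        have "(\<Sum>z | z \<in> W \<and> lr_content n la z = nu.
          ?t z) =
          (\<Sum>z | z \<in> W \<and> lr_content n la z = nu. (- 1) ^ (psize nu + psize la + psize mu) * gsum n nu ?x)"
          by (rule sum.cong) auto
        then show "(\<Sum>z | z \<in> W \<and> lr_content n la z = nu.
          ?t z) =
          of_int (?a nu) * gsum n nu ?x"
          by (simp add: c)
      qed
      finally have e: "gsum n la ?x * (gsum n mu ?x * ?u) =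
          (\<Sum>nu\<in>I. of_int (?a nu) * gsum n nu ?x)" .
      \<comment> \<open>One factor \<open>?u\<close> was spent on \<open>mu\<close>; the other is
        common to all terms and completes each \<open>gsum n nu\<close> to the value of
        \<open>cal_groth nu\<close>.\<close>
      have "gsum n la ?x * ?u * (gsum n mu ?x * ?u) = gsum n la ?x * (gsum n mu ?x * ?u) * ?u"
        by (simp only: ac_simps)
      also have "\<dots> = (\<Sum>nu\<in>I. of_int (?a nu) * gsum n nu ?x) * ?u"
        by (simp only: e)
      finally have "gsum n la ?x * ?u * (gsum n mu ?x * ?u) =
          (\<Sum>nu\<in>I. of_int (?a nu) * gsum n nu ?x) * ?u" .
      then have "eval_series n ?f ?x = eval_series n g ?x"
        unfolding ef(2) eg(2) by (simp only: sum_distrib_right mult.assoc)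
      then show "eval_series n (series_minus ?f g) ?x = 0"
        by (simp add: eval_minus(2)[OF ef(1) eg(1)])
    qed
    then have "?f M = g M" by (simp add: series_minus_def)
    \<comment> \<open>The index sets differ harmlessly: outside \<open>I\<close> the count is 0, the
      letters of \<open>M\<close> guaranteeing \<open>num_parts nu \<le> n\<close>, and outside
      \<open>?C\<close> the coefficient of the series at \<open>M\<close> is 0.\<close>
    also have "\<dots> = (\<Sum>nu\<in>?C \<union> I. ?a nu * cal_groth nu M)"
      unfolding g_def
    proof (rule sum.mono_neutral_left)
      show "\<forall>nu\<in>?C \<union> I - I. ?a nu * cal_groth nu M = 0"
      proof
        fix nu assume nu: "nu \<in> ?C \<union> I - I"
        then have p: "nu \<in> partitions" "num_parts nu \<le> n" using cal_groth_nonzero_num_parts[OF _ _ M] by auto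
        have e: "{z \<in> W. lr_content n la z = nu} = {}" using nu by (auto simp: I_def)
        show "?a nu * cal_groth nu M = 0"
          unfolding coeff[OF p] e by simp
      qed
    qed (use finI finite_cal_groth_support in auto)
    also have "\<dots> = (\<Sum>nu\<in>?C. ?a nu * cal_groth nu M)"
      by (rule sum.mono_neutral_right) (use finI finite_cal_groth_support Ip in auto)
    finally show ?thesis .
  qed
qed

section \<open>Linear independence and uniqueness of the expansion\<close>

lemma num_parts_le_psize: "num_parts la \<le> psize la"
  unfolding num_parts_def psize_def card_eq_sum by (rule sum_mono) auto

text \<open>The monomial with exponent sequence \<open>nu\<close>, which is the weight of the
  superstandard tableau of that shape.\<close>

definition part_monomial :: "(nat \<Rightarrow> nat) \<Rightarrow> nat multiset" where
  "part_monomial nu = pmonomial (num_parts nu) (superstandard nu)"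

lemma size_part_monomial:
  assumes "nu \<in> partitions"
  shows "size (part_monomial nu) = psize nu"
proof -
  have z: "nu r = 0" if "num_parts nu \<le> r" for r using num_parts_iff[OF assms, of r] that by simp
  then show ?thesis
    using pcontent_superstandard[of "num_parts nu" nu] psize_eq[of "num_parts nu" nu]
    by (simp add: part_monomial_def size_pmonomial)
qed

text \<open>The series 1 - G_1 has constant term 1, and \<open>groth lam\<close> has no monomial of
  size below \<open>psize lam\<close>; up to that size the extra factor is invisible.\<close>

lemma cal_groth_lowest:
  assumes lam: "lam \<in> partitions" and size: "size M \<le> psize lam"
  shows "cal_groth lam M = groth lam M"
proof -
  let ?h = "series_minus series_one (groth one_box)"
  have "psize one_box = 1"
    using psize_eq[of 1 one_box] by (simp add: one_box_def)
  then have "groth one_box {#} = 0"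
    using groth_nonzero_imp_psize_le[OF one_box_in_partitions, of "{#}"] by fastforce
  then have h: "?h {#} = 1" by (simp add: series_minus_def series_one_def)
  have "cal_groth lam M = (\<Sum>(A, B) | A + B = M. groth lam A * ?h B)"
    by (simp add: cal_groth_def series_times_def)
  also have "\<dots> = (\<Sum>(A, B)\<in>{(M, {#})}. groth lam A * ?h B)"
  proof (rule sum.mono_neutral_right)
    show "finite {(A, B). A + B = M}" by (rule finite_splittings)
    show "\<forall>z\<in>{(A, B). A + B = M} - {(M, {#})}. (case z of (A, B) \<Rightarrow> groth lam A * ?h B) = 0"
    proof
      fix z assume "z \<in> {(A, B). A + B = M} - {(M, {#})}"
      then obtain A B where z: "z = (A, B)" "A + B = M" "B \<noteq> {#}" by (cases z) auto
      then have "size A < size M" by (auto simp: nonempty_has_size)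
      then have "groth lam A = 0" using groth_nonzero_imp_psize_le[OF lam, of A] size by linarith
      then show "(case z of (A, B) \<Rightarrow> groth lam A * ?h B) = 0" by (simp add: z)
    qed
  qed auto
  finally show ?thesis by (simp add: h)
qed

text \<open>Equal sizes leave no room for extra letters. The letters up to \<open>k\<close> then
  fill exactly the shape \<open>P k\<close>, and this lies in the first \<open>k\<close>
  rows.\<close>

lemma pattern_part_monomial:
  assumes nu: "nu \<in> partitions" and size: "psize lam = psize nu"
    and Z: "(P, E) \<in> patterns (num_parts nu) lam" and M: "pmonomial (num_parts nu) (P, E) = part_monomial nu"
  shows "pextra (num_parts nu) (P, E) = 0" "(\<Sum>r<k. nu r) = (\<Sum>r<k. P k r)"
proof -
  define n where "n = num_parts nu"
  note Z = Z[folded n_def] and M = M[folded n_def]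
  have rnu: "nu r = 0" if "n \<le> r" for r using num_parts_iff[OF nu, of r] that by (simp add: n_def)
  have rlam: "lam r = 0" if "n \<le> r" for r by (rule pattern_rows(3)[OF Z that])
  have c: "pcontent n (P, E) a = nu a" for a
  proof (cases "a < n")
    case True
    have "pcontent n (P, E) a = count (part_monomial nu) (Suc a)"
      using True by (simp add: count_pmonomial flip: M)
    also have "\<dots> = nu a"
      using True pcontent_superstandard[of n nu] rnu by (simp add: part_monomial_def count_pmonomial n_def)
    finally show ?thesis .
  next
    case False
    then show ?thesis using pcount_rows[OF Z, of _ a] rnu by (simp add: pcontent_def)
  qed
  have ext: "pextra n (P, E) = 0"
    using sum_pcontent[OF Z] size psize_eq[of n nu] psize_eq[of n lam] rnu rlam by (simp add: c)
  then show "pextra (num_parts nu) (P, E) = 0" by (simp add: n_def)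
  have E: "\<not> E a r" for a r
  proof
    assume e: "E a r"
    then have "a < n" "r < n" using patternsD(5)[OF Z, of a r] pattern_rows(2)[OF Z, of r a] by (auto simp: not_le[symmetric])
    with ext e show False by (auto simp: pextra_def)
  qed
  have tel: "(\<Sum>a<m. P (Suc a) r - P a r) = P m r" for m r
    using patternsD(1,4)[OF Z] by (induction m) auto
  have "(\<Sum>r<k. nu r) = (\<Sum>a<k. \<Sum>r<n. P (Suc a) r - P a r)"
    by (simp add: pcontent_def pcount_def E flip: c)
  also have "\<dots> = (\<Sum>r<n. \<Sum>a<k. P (Suc a) r - P a r)"
    by (rule sum.swap)
  also have "\<dots> = (\<Sum>r<n. P k r)" by (simp only: tel)
  also have "\<dots> = (\<Sum>r<k. P k r)"
  proof (cases "k \<le> n")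
    case True
    then show ?thesis
      using pattern_triangular[OF Z, of k] by (intro sum.mono_neutral_right) auto
  next
    case False
    then show ?thesis
      using pattern_rows(1)[OF Z] by (intro sum.mono_neutral_left) auto
  qed
  finally show "(\<Sum>r<k. nu r) = (\<Sum>r<k. P k r)" .
qed

lemma set_part_monomial: "set_mset (part_monomial nu) \<subseteq> {1..num_parts nu}"
  unfolding part_monomial_def by (rule set_pmonomial)

text \<open>Triangularity as for Kostka numbers: the shape \<open>P k\<close> is contained in
  \<open>lam\<close>.\<close>

lemma groth_part_monomial_dominance:
  assumes nu: "nu \<in> partitions" and lam: "lam \<in> partitions" and size: "psize lam = psize nu"
    and nz: "groth lam (part_monomial nu) \<noteq> 0"
  shows "(\<Sum>r<k. nu r) \<le> (\<Sum>r<k. lam r)"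
proof -
  let ?n = "num_parts nu"
  have "(\<Sum>Z | Z \<in> patterns ?n lam \<and> pmonomial ?n Z = part_monomial nu. psign ?n Z :: int) \<noteq> 0"
    using nz groth_eq[OF set_part_monomial lam] by simp
  then obtain Z where "Z \<in> {Z. Z \<in> patterns ?n lam \<and> pmonomial ?n Z = part_monomial nu}"
    by (rule sum.not_neutral_contains_not_neutral)
  then obtain P E where Z: "(P, E) \<in> patterns ?n lam" "pmonomial ?n (P, E) = part_monomial nu"
    by (cases Z) auto
  have "(\<Sum>r<k. nu r) = (\<Sum>r<k. P k r)" by (rule pattern_part_monomial(2)[OF nu size Z])
  also have "\<dots> \<le> (\<Sum>r<k. lam r)" by (rule sum_mono) (rule pattern_le_shape[OF Z(1)])
  finally show ?thesis .
qed

text \<open>The diagonal Kostka number: equality of the partial sums forces \<open>P k\<close> to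
  fill the first \<open>k\<close> rows completely, so every row holds only its own letter.\<close>

lemma groth_part_monomial:
  assumes nu: "nu \<in> partitions"
  shows "groth nu (part_monomial nu) = 1"
proof -
  let ?n = "num_parts nu"
  have anti: "antimono nu" using nu by (simp add: partitions_def)
  have rnu: "nu r = 0" if "?n \<le> r" for r using num_parts_iff[OF nu, of r] that by simp
  have ss: "superstandard nu \<in> patterns ?n nu" by (rule superstandard_in_patterns[OF anti rnu])
  have "Z = superstandard nu" if Z: "Z \<in> patterns ?n nu" "pmonomial ?n Z = part_monomial nu" for Z
  proof -
    obtain P E where PE: "Z = (P, E)" by force
    note Z' = Z[unfolded PE]
    have P: "P k r = nu r" if "r < k" for k r
    proof (rule ccontr)
      assume "P k r \<noteq> nu r"
      then have "P k r < nu r" using pattern_le_shape[OF Z'(1), of k r] by simp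
      then have "(\<Sum>r<k. P k r) < (\<Sum>r<k. nu r)"
        using that pattern_le_shape[OF Z'(1)] by (intro sum_strict_mono_ex1) auto
      then show False using pattern_part_monomial(2)[OF nu refl Z', of k] by simp
    qed
    have "pcount Z a r = 0" if "r < a" for a r
    proof -
      have "\<not> E a r"
      proof
        assume e: "E a r"
        then have "a < ?n" "r < ?n"
          using patternsD(5)[OF Z'(1), of a r] pattern_rows(2)[OF Z'(1), of r a] by (auto simp: not_le[symmetric])
        then show False using pattern_part_monomial(1)[OF nu refl Z'] e by (auto simp: pextra_def)
      qed
      then show ?thesis using P[of r a] P[of r "Suc a"] that by (simp add: pcount_def PE)
    qed
    then show ?thesis by (rule eq_superstandardI[OF Z(1)])
  qed
  then have "{Z. Z \<in> patterns ?n nu \<and> pmonomial ?n Z = part_monomial nu} = {superstandard nu}"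
    using ss by (auto simp: part_monomial_def)
  then show ?thesis
    unfolding groth_eq[OF set_part_monomial nu] by (simp add: psign_def superstandard_def)
qed

text \<open>A partition of size at most \<open>s\<close> has at most \<open>s\<close> parts, so the
  partial sums up to \<open>s\<close> determine it.\<close>

lemma partition_eqI:
  assumes "\<And>k. k \<le> s \<Longrightarrow> (\<Sum>r<k. la r) = (\<Sum>r<k. mu r)" "la \<in> partitions" "mu \<in> partitions"
    "psize la \<le> s" "psize mu \<le> s"
  shows "la = mu"
proof
  fix r
  show "la r = mu r"
  proof (cases "r < s")
    case True
    then show ?thesis using assms(1)[of r] assms(1)[of "Suc r"] by simp
  next
    case False
    then have "num_parts la \<le> r" "num_parts mu \<le> r"
      using num_parts_le_psize[of la] num_parts_le_psize[of mu] assms(4,5) by auto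
    then show ?thesis
      using num_parts_iff[OF assms(2), of r] num_parts_iff[OF assms(3), of r] by simp
  qed
qed

text \<open>Test a relation on the monomial of a partition \<open>nu\<close> in its support that has minimal size
  and is then maximal in dominance order: only \<open>nu\<close> itself contributes.\<close>

lemma cal_groth_independent:
  assumes rel: "\<And>M. (\<Sum>nu \<in> {nu \<in> partitions. cal_groth nu M \<noteq> 0}. d nu * cal_groth nu M) = 0"
    and nu0: "nu0 \<in> partitions"
  shows "d nu0 = 0"
proof (rule ccontr)
  assume d0: "d nu0 \<noteq> 0"
  define N where "N = {nu \<in> partitions. d nu \<noteq> 0}"
  define s where "s = (LEAST s. \<exists>nu\<in>N. psize nu = s)"
  have "\<exists>s. \<exists>nu\<in>N. psize nu = s" using nu0 d0 by (auto simp: N_def)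
  then have "\<exists>nu\<in>N. psize nu = s" unfolding s_def by (rule LeastI_ex)
  moreover have min: "s \<le> psize nu" if "nu \<in> N" for nu
    unfolding s_def using that by (intro Least_le) auto
  define L where "L = {nu \<in> N. psize nu = s}"
  \<comment> \<open>The sum of all partial sums is strictly monotone in the dominance order on
    partitions of size \<open>s\<close>, so a maximum of this number is a maximal element.\<close>
  define Phi where "Phi nu = (\<Sum>k\<le>s. \<Sum>r<k. nu r)" for nu :: "nat \<Rightarrow> nat"
  have "finite L"
    by (rule finite_subset[OF _ finite_partitions_psize_le[of s]]) (auto simp: L_def N_def)
  moreover have "L \<noteq> {}" using \<open>\<exists>nu\<in>N. psize nu = s\<close> by (auto simp: L_def)
  ultimately have "Max (Phi ` L) \<in> Phi ` L" by (intro Max_in) auto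
  then obtain nu where nu: "nu \<in> L" "Phi nu = Max (Phi ` L)" by auto
  have max: "Phi lam \<le> Phi nu" if "lam \<in> L" for lam
    using that \<open>finite L\<close> by (simp add: nu(2))
  let ?M = "part_monomial nu"
  have p: "nu \<in> partitions" "d nu \<noteq> 0" "psize nu = s" using nu(1) by (auto simp: L_def N_def)
  have lowest: "cal_groth lam ?M = groth lam ?M" if "lam \<in> N" for lam
    using that min[OF that] by (intro cal_groth_lowest) (auto simp: N_def size_part_monomial p)
  have one: "cal_groth nu ?M = 1"
    using lowest[of nu] groth_part_monomial p by (simp add: N_def)
  have other: "d lam * cal_groth lam ?M = 0" if lam: "lam \<in> partitions" "lam \<noteq> nu" for lam
  proof (rule ccontr)
    assume "d lam * cal_groth lam ?M \<noteq> 0"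
    then have l: "lam \<in> N" "groth lam ?M \<noteq> 0"
      using lam(1) lowest[of lam] by (auto simp: N_def)
    then have ps: "psize lam = s"
      using groth_nonzero_imp_psize_le[OF lam(1) l(2)] min[OF l(1)] size_part_monomial[OF p(1)] p(3) by simp
    then have "lam \<in> L" using l(1) by (simp add: L_def)
    have dom: "(\<Sum>r<k. nu r) \<le> (\<Sum>r<k. lam r)" for k
      using groth_part_monomial_dominance[OF p(1) lam(1) _ l(2)] ps p(3) by simp
    have "(\<Sum>r<k. lam r) = (\<Sum>r<k. nu r)" if "k \<le> s" for k
    proof (rule ccontr)
      assume "(\<Sum>r<k. lam r) \<noteq> (\<Sum>r<k. nu r)"
      then have "(\<Sum>r<k. nu r) < (\<Sum>r<k. lam r)" using dom[of k] by simp
      then have "Phi nu < Phi lam"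
        unfolding Phi_def using dom that by (intro sum_strict_mono_ex1) auto
      then show False using max[OF \<open>lam \<in> L\<close>] by simp
    qed
    then have "lam = nu" using lam(1) p(1) ps p(3) by (intro partition_eqI[of s]) auto
    then show False using lam(2) by simp
  qed
  let ?C = "{nu \<in> partitions. cal_groth nu ?M \<noteq> 0}"
  have "0 = (\<Sum>lam\<in>?C. d lam * cal_groth lam ?M)" by (simp only: rel)
  also have "\<dots> = (\<Sum>lam\<in>{nu}. d lam * cal_groth lam ?M)"
    by (rule sum.mono_neutral_right) (use finite_cal_groth_support one other p in auto)
  also have "\<dots> = d nu" by (simp add: one)
  finally show False using p(2) by simp
qed

lemma is_expansion_unique:
  assumes c: "is_expansion la mu c" and c': "is_expansion la mu c'"
  shows "c = c'"
proof
  fix nu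
  show "c nu = c' nu"
  proof (cases "nu \<in> partitions")
    case True
    define d where "d nu = (- 1) ^ (psize nu + psize la + psize mu) * (c nu - c' nu)" for nu
    have "(\<Sum>nu \<in> {nu \<in> partitions. cal_groth nu M \<noteq> 0}. d nu * cal_groth nu M) = 0" for M
      using c[unfolded is_expansion_def, THEN conjunct2, rule_format, of M]
        c'[unfolded is_expansion_def, THEN conjunct2, rule_format, of M]
      by (simp add: d_def algebra_simps sum_subtractf)
    then have "d nu = 0" using True by (rule cal_groth_independent)
    then show ?thesis by (simp add: d_def)
  next
    case False
    then show ?thesis using c c' by (simp add: is_expansion_def)
  qed
qed

theorem theorem3p7:
  fixes k :: nat and la mu nu :: "nat \<Rightarrow> nat"
  assumes "k \<ge> 1"
    and "la \<in> partitions" and "num_parts la \<le> k"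
    and "mu \<in> partitions" and "num_parts mu \<le> k"
    and "nu \<in> partitions" and "num_parts nu \<le> k"
  shows "structure_constant la mu nu =
    int (card {(mup, T).
      mup \<in> partitions \<and>
      (\<exists>S \<subseteq> outer_corners mu. diagram mup = diagram mu \<union> S) \<and>
      T \<in> set_valued_tableaux (oplus_shape mup la) {1..k} \<and>
      semistandard (oplus_shape mup la) T \<and>
      ballot (reverse_row_word (oplus_shape mup la) T) \<and>
      content (reverse_row_word (oplus_shape mup la) T) = nu})"
proof -
  have "is_expansion la mu (lr_coefficient la mu)"
    using assms by (intro is_expansion_lr_coefficient)
  then have "structure_constant la mu = lr_coefficient la mu"
    unfolding structure_constant_def using is_expansion_unique by (intro the_equality)
  then have "structure_constant la mu nu = lr_coefficient la mu nu" by simp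
  \<comment> \<open>The least alphabet and \<open>{1..k}\<close> admit the same tableaux because
    \<open>num_parts nu \<le> k\<close>.\<close>
  also have "lr_coefficient la mu nu = int (card (lr_tableaux k la mu nu))"
    using assms lr_tableaux_alphabet[of la nu k mu] by (simp add: lr_coefficient_def)
  finally show ?thesis by (simp only: lr_tableaux_def)
qed

end
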